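(* Let $\mathcal{T}$ be a triangulated category with arbitrary coproducts and a perfect generator. (1) A functor $F\colon\mathcal{T}^{\mathrm{op}}\to\mathrm{Ab}$ is cohomological and sends all coproducts in $\mathcal{T}$ to products if and only if $F\cong\mathrm{Hom}_{\mathcal{T}}(-,X)$ for some object $X$ in $\mathcal{T}$. (2) An exact functor $\mathcal{T}\to\mathcal{U}$ between triangulated categories preserves all coproducts if and only if it has a right adjoint.
   Context: $\mathrm{Ab}$ is the category of abelian groups; $\Sigma$ denotes the suspension (shift) of a triangulated category. A functor from a triangulated category to an abelian category is cohomological if it sends each exact triangle to an exact sequence ($\mathcal{T}^{\mathrm{op}}$ carries its canonical triangulated structure). An exact functor between triangulated categories is a functor $F$ with a natural isomorphism $\eta\colon F\circ\Sigma\to\Sigma\circ F$ such that for every exact triangle $X\xrightarrow{\alpha}Y\xrightarrow{\beta}Z\xrightarrow{\gamma}\Sigma X$ the triangle $FX\xrightarrow{F\alpha}FY\xrightarrow{F\beta}FZ\xrightarrow{\eta_X\circ F\gamma}\Sigma(FX)$ is exact. A triangulated subcategory of $\mathcal{T}$ is a non-empty full subcategory $\mathcal{S}$ with $\Sigma^nX\in\mathcal{S}$ for all $X\in\mathcal{S}$, $n\in\mathbb{Z}$, and such that if two of the objects $X,Y,Z$ in an exact triangle $X\to Y\to Z\to\Sigma X$ of $\mathcal{T}$ belong to $\mathcal{S}$, then so does the third. An object $S$ of a triangulated category $\mathcal{T}$ with arbitrary coproducts is a perfect generator if: (PG1) there is no proper full triangulated subcategory of $\mathcal{T}$ which contains $S$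 and is closed under taking coproducts; (PG2) given a countable family of maps $X_i\to Y_i$ in $\mathcal{T}$ such that the map $\mathrm{Hom}_{\mathcal{T}}(S,X_i)\to\mathrm{Hom}_{\mathcal{T}}(S,Y_i)$ is surjective for all $i$, the induced map $\mathrm{Hom}_{\mathcal{T}}(S,\coprod_iX_i)\to\mathrm{Hom}_{\mathcal{T}}(S,\coprod_iY_i)$ is surjective. *)

theory Defs
  imports "HOL-Algebra.Product_Groups" "HOL-Algebra.Exact_Sequence" "HOL-Library.Equipollence" "HOL-Library.Countable_Set"
begin

section \<open>Size\<close>

text \<open>
  ``Arbitrary coproducts'' are coproducts of families indexed by sets, in a category whose objects
  may form a proper class but whose Hom's are sets. The role of the universe of sets is played
  by a type \<open>'u\<close>: a set (of any type) is \<^emph>\<open>small\<close> if its cardinality is strictly less than that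
  of \<open>'u\<close>. If the cardinality of \<open>'u\<close> is inaccessible, these are, up to bijection, the members
  of a Grothendieck universe; only uncountability of \<open>'u\<close> is needed below. Strictness matters:
  if \<open>\<le>\<close> replaced \<open><\<close>, then by Cantor's theorem every object of a preadditive category with
  small Hom-sets and small coproducts would be zero. Each small set is in bijection with a small subset of \<open>'u\<close>, so it suffices
  to consider families indexed by small sets \<open>I :: 'u set\<close>.
\<close>

definition small :: "'u itself \<Rightarrow> 'a set \<Rightarrow> bool" where
  "small u A \<longleftrightarrow> A \<prec> (UNIV :: 'u set)"


section \<open>Categories and functors\<close>

record ('o, 'm) category =
  Obj :: "'o set"
  Arr :: "'m set"
  Dom :: "'m \<Rightarrow> 'o"
  Cod :: "'m \<Rightarrow> 'o"
  Ident :: "'o \<Rightarrow> 'm"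
  Comp :: "'m \<Rightarrow> 'm \<Rightarrow> 'm"  (infixr "\<cdot>\<index>" 70)

definition Hom :: "('o, 'm, 'x) category_scheme \<Rightarrow> 'o \<Rightarrow> 'o \<Rightarrow> 'm set" where
  "Hom C X Y = {f \<in> Arr C. Dom C f = X \<and> Cod C f = Y}"

locale category =
  fixes C :: "('o, 'm, 'x) category_scheme" (structure)
  assumes dom_cod: "f \<in> Arr C \<Longrightarrow> Dom C f \<in> Obj C \<and> Cod C f \<in> Obj C"
    and ident: "X \<in> Obj C \<Longrightarrow> Ident C X \<in> Hom C X X"
    and comp: "f \<in> Hom C X Y \<Longrightarrow> g \<in> Hom C Y Z \<Longrightarrow> g \<cdot> f \<in> Hom C X Z"
    and comp_ident: "f \<in> Hom C X Y \<Longrightarrow> f \<cdot> Ident C X = f"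
    and ident_comp: "f \<in> Hom C X Y \<Longrightarrow> Ident C Y \<cdot> f = f"
    and comp_assoc: "f \<in> Hom C W X \<Longrightarrow> g \<in> Hom C X Y \<Longrightarrow> h \<in> Hom C Y Z
      \<Longrightarrow> (h \<cdot> g) \<cdot> f = h \<cdot> (g \<cdot> f)"

definition locally_small :: "'u itself \<Rightarrow> ('o, 'm, 'x) category_scheme \<Rightarrow> bool" where
  "locally_small u C \<longleftrightarrow> (\<forall>X \<in> Obj C. \<forall>Y \<in> Obj C. small u (Hom C X Y))"

definition iso_arr :: "('o, 'm, 'x) category_scheme \<Rightarrow> 'm \<Rightarrow> bool" where
  "iso_arr C f \<longleftrightarrow> f \<in> Arr C \<and>
    (\<exists>g \<in> Hom C (Cod C f) (Dom C f).
       g \<cdot>\<^bsub>C\<^esub> f = Ident C (Dom C f) \<and> f \<cdot>\<^bsub>C\<^esub> g = Ident C (Cod C f))"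

definition isomorphic :: "('o, 'm, 'x) category_scheme \<Rightarrow> 'o \<Rightarrow> 'o \<Rightarrow> bool" where
  "isomorphic C X Y \<longleftrightarrow> (\<exists>f \<in> Hom C X Y. iso_arr C f)"

definition zero_object :: "('o, 'm, 'x) category_scheme \<Rightarrow> 'o \<Rightarrow> bool" where
  "zero_object C Z \<longleftrightarrow> Z \<in> Obj C \<and>
    (\<forall>X \<in> Obj C. (\<exists>!f. f \<in> Hom C Z X) \<and> (\<exists>!f. f \<in> Hom C X Z))"

definition is_coproduct ::
  "('o, 'm, 'x) category_scheme \<Rightarrow> 'i set \<Rightarrow> ('i \<Rightarrow> 'o) \<Rightarrow> 'o \<Rightarrow> ('i \<Rightarrow> 'm) \<Rightarrow> bool" where
  "is_coproduct C I X P \<iota> \<longleftrightarrow>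
     (\<forall>i \<in> I. X i \<in> Obj C) \<and> P \<in> Obj C \<and> (\<forall>i \<in> I. \<iota> i \<in> Hom C (X i) P) \<and>
     (\<forall>Z \<in> Obj C. \<forall>f. (\<forall>i \<in> I. f i \<in> Hom C (X i) Z) \<longrightarrow>
        (\<exists>!h. h \<in> Hom C P Z \<and> (\<forall>i \<in> I. h \<cdot>\<^bsub>C\<^esub> \<iota> i = f i)))"

definition has_coproducts :: "'u itself \<Rightarrow> ('o, 'm, 'x) category_scheme \<Rightarrow> bool" where
  "has_coproducts u C \<longleftrightarrow>
     (\<forall>(I :: 'u set) X. small u I \<and> (\<forall>i \<in> I. X i \<in> Obj C) \<longrightarrow> (\<exists>P \<iota>. is_coproduct C I X P \<iota>))"

record ('o, 'm, 'p, 'n) ftr =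
  on_ob :: "'o \<Rightarrow> 'p"
  on_ar :: "'m \<Rightarrow> 'n"

locale is_functor = A: category A + B: category B
  for A :: "('o, 'm, 'x) category_scheme" and B :: "('p, 'n, 'y) category_scheme" +
  fixes F :: "('o, 'm, 'p, 'n) ftr"
  assumes ob: "X \<in> Obj A \<Longrightarrow> on_ob F X \<in> Obj B"
    and ar: "f \<in> Hom A X Y \<Longrightarrow> on_ar F f \<in> Hom B (on_ob F X) (on_ob F Y)"
    and map_ident: "X \<in> Obj A \<Longrightarrow> on_ar F (Ident A X) = Ident B (on_ob F X)"
    and map_comp: "f \<in> Hom A X Y \<Longrightarrow> g \<in> Hom A Y Z
      \<Longrightarrow> on_ar F (g \<cdot>\<^bsub>A\<^esub> f) = on_ar F g \<cdot>\<^bsub>B\<^esub> on_ar F f"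

definition id_ftr :: "('o, 'm, 'o, 'm) ftr" where
  "id_ftr = \<lparr>on_ob = (\<lambda>X. X), on_ar = (\<lambda>f. f)\<rparr>"

definition comp_ftr ::
  "('p, 'n, 'q, 'l) ftr \<Rightarrow> ('o, 'm, 'p, 'n) ftr \<Rightarrow> ('o, 'm, 'q, 'l) ftr" where
  "comp_ftr G F = \<lparr>on_ob = on_ob G \<circ> on_ob F, on_ar = on_ar G \<circ> on_ar F\<rparr>"

definition natural_iso ::
  "('o, 'm, 'x) category_scheme \<Rightarrow> ('p, 'n, 'y) category_scheme \<Rightarrow>
   ('o, 'm, 'p, 'n) ftr \<Rightarrow> ('o, 'm, 'p, 'n) ftr \<Rightarrow> ('o \<Rightarrow> 'n) \<Rightarrow> bool" where
  "natural_iso A B F G \<eta> \<longleftrightarrow>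
     (\<forall>X \<in> Obj A. \<eta> X \<in> Hom B (on_ob F X) (on_ob G X) \<and> iso_arr B (\<eta> X)) \<and>
     (\<forall>X \<in> Obj A. \<forall>Y \<in> Obj A. \<forall>f \<in> Hom A X Y.
        \<eta> Y \<cdot>\<^bsub>B\<^esub> on_ar F f = on_ar G f \<cdot>\<^bsub>B\<^esub> \<eta> X)"

definition is_equivalence ::
  "('o, 'm, 'x) category_scheme \<Rightarrow> ('p, 'n, 'y) category_scheme \<Rightarrow> ('o, 'm, 'p, 'n) ftr \<Rightarrow> bool"
  where
  "is_equivalence A B F \<longleftrightarrow> is_functor A B F \<and>
     (\<exists>G \<epsilon> \<eta>. is_functor B A G \<and> natural_iso A A (comp_ftr G F) id_ftr \<epsilon> \<and>
        natural_iso B B (comp_ftr F G) id_ftr \<eta>)"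

definition is_right_adjoint ::
  "('o, 'm, 'x) category_scheme \<Rightarrow> ('p, 'n, 'y) category_scheme \<Rightarrow>
   ('o, 'm, 'p, 'n) ftr \<Rightarrow> ('p, 'n, 'o, 'm) ftr \<Rightarrow> bool" where
  "is_right_adjoint A B F G \<longleftrightarrow> is_functor A B F \<and> is_functor B A G \<and>
     (\<exists>\<phi>. (\<forall>X \<in> Obj A. \<forall>Y \<in> Obj B.
             bij_betw (\<phi> X Y) (Hom B (on_ob F X) Y) (Hom A X (on_ob G Y))) \<and>
          (\<forall>X' \<in> Obj A. \<forall>X \<in> Obj A. \<forall>Y \<in> Obj B. \<forall>Y' \<in> Obj B.
             \<forall>a \<in> Hom A X' X. \<forall>g \<in> Hom B (on_ob F X) Y. \<forall>b \<in> Hom B Y Y'.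
               \<phi> X' Y' (b \<cdot>\<^bsub>B\<^esub> g \<cdot>\<^bsub>B\<^esub> on_ar F a) = on_ar G b \<cdot>\<^bsub>A\<^esub> \<phi> X Y g \<cdot>\<^bsub>A\<^esub> a))"

definition preserves_coproducts ::
  "'u itself \<Rightarrow> ('o, 'm, 'x) category_scheme \<Rightarrow> ('p, 'n, 'y) category_scheme \<Rightarrow>
   ('o, 'm, 'p, 'n) ftr \<Rightarrow> bool" where
  "preserves_coproducts u A B F \<longleftrightarrow>
     (\<forall>(I :: 'u set) X P \<iota>. small u I \<and> is_coproduct A I X P \<iota> \<longrightarrow>
        is_coproduct B I (on_ob F \<circ> X) (on_ob F P) (on_ar F \<circ> \<iota>))"


section \<open>Additive categories\<close>

record ('o, 'm) additive = "('o, 'm) category" +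
  hadd :: "'m \<Rightarrow> 'm \<Rightarrow> 'm"
  hzero :: "'o \<Rightarrow> 'o \<Rightarrow> 'm"

definition Hom_grp :: "('o, 'm, 'x) additive_scheme \<Rightarrow> 'o \<Rightarrow> 'o \<Rightarrow> 'm monoid" where
  "Hom_grp C X Y = \<lparr>carrier = Hom C X Y, monoid.mult = hadd C, one = hzero C X Y\<rparr>"

definition hneg :: "('o, 'm, 'x) additive_scheme \<Rightarrow> 'm \<Rightarrow> 'm" where
  "hneg C f = inv\<^bsub>Hom_grp C (Dom C f) (Cod C f)\<^esub> f"

text \<open>The empty index set in \<open>finite_coproducts\<close> provides the zero object.\<close>

locale additive_category = category C
  for C :: "('o, 'm, 'x) additive_scheme" (structure) +
  assumes Hom_comm_group: "X \<in> Obj C \<Longrightarrow> Y \<in> Obj C \<Longrightarrow> comm_group (Hom_grp C X Y)"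
    and comp_add: "f \<in> Hom C X Y \<Longrightarrow> f' \<in> Hom C X Y \<Longrightarrow> g \<in> Hom C Y Z
      \<Longrightarrow> g \<cdot> hadd C f f' = hadd C (g \<cdot> f) (g \<cdot> f')"
    and add_comp: "f \<in> Hom C X Y \<Longrightarrow> g \<in> Hom C Y Z \<Longrightarrow> g' \<in> Hom C Y Z
      \<Longrightarrow> hadd C g g' \<cdot> f = hadd C (g \<cdot> f) (g' \<cdot> f)"
    and finite_coproducts: "finite (I :: nat set) \<Longrightarrow> \<forall>i \<in> I. Xs i \<in> Obj C
      \<Longrightarrow> \<exists>P \<iota>. is_coproduct C I Xs P \<iota>"


section \<open>Triangulated categories\<close>

text \<open>\<open>Exact\<close> is the class of exact triangles; a triangle is given by its three maps.\<close>

record ('o, 'm) triangulated = "('o, 'm) additive" +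
  Susp :: "('o, 'm, 'o, 'm) ftr"
  Exact :: "('m \<times> 'm \<times> 'm) set"

abbreviation susp_ob :: "('o, 'm, 'x) triangulated_scheme \<Rightarrow> 'o \<Rightarrow> 'o" where
  "susp_ob T \<equiv> on_ob (Susp T)"

abbreviation susp_ar :: "('o, 'm, 'x) triangulated_scheme \<Rightarrow> 'm \<Rightarrow> 'm" where
  "susp_ar T \<equiv> on_ar (Susp T)"

definition triangle ::
  "('o, 'm, 'x) triangulated_scheme \<Rightarrow> 'o \<Rightarrow> 'o \<Rightarrow> 'o \<Rightarrow> 'm \<Rightarrow> 'm \<Rightarrow> 'm \<Rightarrow> bool" where
  "triangle T X Y Z a b c \<longleftrightarrow> a \<in> Hom T X Y \<and> b \<in> Hom T Y Z \<and> c \<in> Hom T Z (susp_ob T X)"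

definition exact_triangle ::
  "('o, 'm, 'x) triangulated_scheme \<Rightarrow> 'o \<Rightarrow> 'o \<Rightarrow> 'o \<Rightarrow> 'm \<Rightarrow> 'm \<Rightarrow> 'm \<Rightarrow> bool" where
  "exact_triangle T X Y Z a b c \<longleftrightarrow> triangle T X Y Z a b c \<and> (a, b, c) \<in> Exact T"

locale triangulated_category = additive_category T
  for T :: "('o, 'm, 'x) triangulated_scheme" (structure) +
  assumes Susp_equivalence: "is_equivalence T T (Susp T)"
    and TR1_iso: "exact_triangle T X Y Z a b c \<Longrightarrow> triangle T X' Y' Z' a' b' c'
      \<Longrightarrow> u \<in> Hom T X X' \<Longrightarrow> v \<in> Hom T Y Y' \<Longrightarrow> w \<in> Hom T Z Z'
      \<Longrightarrow> iso_arr T u \<Longrightarrow> iso_arr T v \<Longrightarrow> iso_arr T w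
      \<Longrightarrow> v \<cdot> a = a' \<cdot> u \<Longrightarrow> w \<cdot> b = b' \<cdot> v \<Longrightarrow> susp_ar T u \<cdot> c = c' \<cdot> w
      \<Longrightarrow> exact_triangle T X' Y' Z' a' b' c'"
    and TR1_ident: "X \<in> Obj T \<Longrightarrow> zero_object T Z
      \<Longrightarrow> exact_triangle T X X Z (Ident T X) (hzero T X Z) (hzero T Z (susp_ob T X))"
    and TR1_cone: "a \<in> Hom T X Y \<Longrightarrow> \<exists>Z b c. exact_triangle T X Y Z a b c"
    and TR2: "triangle T X Y Z a b c
      \<Longrightarrow> exact_triangle T X Y Z a b c
        \<longleftrightarrow> exact_triangle T Y Z (susp_ob T X) b c (hneg T (susp_ar T a))"
    and TR3: "exact_triangle T X Y Z a b c \<Longrightarrow> exact_triangle T X' Y' Z' a' b' c'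
      \<Longrightarrow> u \<in> Hom T X X' \<Longrightarrow> v \<in> Hom T Y Y' \<Longrightarrow> v \<cdot> a = a' \<cdot> u
      \<Longrightarrow> \<exists>w \<in> Hom T Z Z'. w \<cdot> b = b' \<cdot> v \<and> susp_ar T u \<cdot> c = c' \<cdot> w"
    and TR4: "exact_triangle T X Y U a1 a2 a3 \<Longrightarrow> exact_triangle T Y Z W b1 b2 b3
      \<Longrightarrow> exact_triangle T X Z V (b1 \<cdot> a1) c2 c3
      \<Longrightarrow> \<exists>d1 d2 d3. exact_triangle T U V W d1 d2 d3 \<and>
            d1 \<cdot> a2 = c2 \<cdot> b1 \<and> c3 \<cdot> d1 = a3 \<and>
            d2 \<cdot> c2 = b2 \<and> b3 \<cdot> d2 = susp_ar T a1 \<cdot> c3 \<and>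
            d3 = susp_ar T a2 \<cdot> b3"

definition exact_functor ::
  "('o, 'm, 'x) triangulated_scheme \<Rightarrow> ('p, 'n, 'y) triangulated_scheme \<Rightarrow>
   ('o, 'm, 'p, 'n) ftr \<Rightarrow> ('o \<Rightarrow> 'n) \<Rightarrow> bool" where
  "exact_functor T U F \<eta> \<longleftrightarrow> is_functor T U F \<and>
     natural_iso T U (comp_ftr F (Susp T)) (comp_ftr (Susp U) F) \<eta> \<and>
     (\<forall>X Y Z a b c. exact_triangle T X Y Z a b c \<longrightarrow>
        exact_triangle U (on_ob F X) (on_ob F Y) (on_ob F Z)
          (on_ar F a) (on_ar F b) (\<eta> X \<cdot>\<^bsub>U\<^esub> on_ar F c))"

text \<open>
  A full subcategory is given by its set of objects. As \<open>\<Sigma>\<close> is an equivalence, the objects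
  \<open>\<Sigma>\<^sup>-\<^sup>nX\<close> with \<open>n \<ge> 0\<close> are determined only up to isomorphism, as the \<open>W\<close> with \<open>\<Sigma>\<^sup>nW \<cong> X\<close>.
\<close>

definition triangulated_subcategory ::
  "('o, 'm, 'x) triangulated_scheme \<Rightarrow> 'o set \<Rightarrow> bool" where
  "triangulated_subcategory T S \<longleftrightarrow> S \<subseteq> Obj T \<and> S \<noteq> {} \<and>
     (\<forall>X \<in> S. \<forall>n :: nat. (susp_ob T ^^ n) X \<in> S \<and>
        (\<forall>W \<in> Obj T. isomorphic T ((susp_ob T ^^ n) W) X \<longrightarrow> W \<in> S)) \<and>
     (\<forall>X Y Z a b c. exact_triangle T X Y Z a b c \<longrightarrow>
        (X \<in> S \<and> Y \<in> S \<longrightarrow> Z \<in> S) \<and> (X \<in> S \<and> Z \<in> S \<longrightarrow> Y \<in> S) \<and> (Y \<in> S \<and> Z \<in> S \<longrightarrow> X \<in> S))"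

definition closed_under_coproducts ::
  "'u itself \<Rightarrow> ('o, 'm, 'x) category_scheme \<Rightarrow> 'o set \<Rightarrow> bool" where
  "closed_under_coproducts u C S \<longleftrightarrow>
     (\<forall>(I :: 'u set) X P \<iota>. small u I \<and> (\<forall>i \<in> I. X i \<in> S) \<and> is_coproduct C I X P \<iota> \<longrightarrow> P \<in> S)"

definition perfect_generator ::
  "'u itself \<Rightarrow> ('o, 'm, 'x) triangulated_scheme \<Rightarrow> 'o \<Rightarrow> bool" where
  "perfect_generator u T S \<longleftrightarrow> S \<in> Obj T \<and>
     (\<forall>\<S>. triangulated_subcategory T \<S> \<and> S \<in> \<S> \<and> closed_under_coproducts u T \<S>
        \<longrightarrow> \<S> = Obj T) \<and>
     (\<forall>(I :: nat set) X Y f P \<iota> Q \<kappa> h.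
        is_coproduct T I X P \<iota> \<and> is_coproduct T I Y Q \<kappa> \<and>
        (\<forall>i \<in> I. f i \<in> Hom T (X i) (Y i)) \<and>
        (\<forall>i \<in> I. (\<lambda>g. f i \<cdot>\<^bsub>T\<^esub> g) ` Hom T S (X i) = Hom T S (Y i)) \<and>
        h \<in> Hom T P Q \<and> (\<forall>i \<in> I. h \<cdot>\<^bsub>T\<^esub> \<iota> i = \<kappa> i \<cdot>\<^bsub>T\<^esub> f i)
        \<longrightarrow> (\<lambda>g. h \<cdot>\<^bsub>T\<^esub> g) ` Hom T S P = Hom T S Q)"


section \<open>Functors from the opposite category to abelian groups\<close>

locale ab_functor_op = category C for C :: "('o, 'm, 'x) category_scheme" (structure) +
  fixes u :: "'u itself" and F :: "('o, 'm, 'g monoid, 'g \<Rightarrow> 'g) ftr"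
  assumes ob: "X \<in> Obj C \<Longrightarrow> comm_group (on_ob F X) \<and> small u (carrier (on_ob F X))"
    and ar: "f \<in> Hom C X Y \<Longrightarrow> on_ar F f \<in> hom (on_ob F Y) (on_ob F X)"
    and map_ident: "X \<in> Obj C \<Longrightarrow> x \<in> carrier (on_ob F X) \<Longrightarrow> on_ar F (Ident C X) x = x"
    and map_comp: "f \<in> Hom C X Y \<Longrightarrow> g \<in> Hom C Y Z \<Longrightarrow> x \<in> carrier (on_ob F Z)
      \<Longrightarrow> on_ar F (g \<cdot> f) x = on_ar F f (on_ar F g x)"

definition ab_natural_iso_op ::
  "('o, 'm, 'x) category_scheme \<Rightarrow> ('o, 'm, 'g monoid, 'g \<Rightarrow> 'g) ftr \<Rightarrow>
   ('o, 'm, 'h monoid, 'h \<Rightarrow> 'h) ftr \<Rightarrow> ('o \<Rightarrow> 'g \<Rightarrow> 'h) \<Rightarrow> bool" where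
  "ab_natural_iso_op C F G \<eta> \<longleftrightarrow>
     (\<forall>X \<in> Obj C. \<eta> X \<in> iso (on_ob F X) (on_ob G X)) \<and>
     (\<forall>X \<in> Obj C. \<forall>Y \<in> Obj C. \<forall>f \<in> Hom C X Y. \<forall>x \<in> carrier (on_ob F Y).
        \<eta> X (on_ar F f x) = on_ar G f (\<eta> Y x))"

definition Hom_functor ::
  "('o, 'm, 'x) additive_scheme \<Rightarrow> 'o \<Rightarrow> ('o, 'm, 'm monoid, 'm \<Rightarrow> 'm) ftr" where
  "Hom_functor C X = \<lparr>on_ob = (\<lambda>Y. Hom_grp C Y X), on_ar = (\<lambda>f g. g \<cdot>\<^bsub>C\<^esub> f)\<rparr>"

text \<open>
  An exact triangle \<open>X \<rightarrow> Y \<rightarrow> Z \<rightarrow> \<Sigma>X\<close> is sent to \<open>F(\<Sigma>X) \<rightarrow> FZ \<rightarrow> FY \<rightarrow> FX\<close>. Note that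
  \<open>exact_seq\<close> lists groups and maps from the end of the sequence to its beginning.
\<close>

definition cohomological_op ::
  "('o, 'm, 'x) triangulated_scheme \<Rightarrow> ('o, 'm, 'g monoid, 'g \<Rightarrow> 'g) ftr \<Rightarrow> bool" where
  "cohomological_op T F \<longleftrightarrow>
     (\<forall>X Y Z a b c. exact_triangle T X Y Z a b c \<longrightarrow>
        exact_seq ([on_ob F X, on_ob F Y, on_ob F Z, on_ob F (susp_ob T X)],
                   [on_ar F a, on_ar F b, on_ar F c]))"

definition coproducts_to_products ::
  "'u itself \<Rightarrow> ('o, 'm, 'x) category_scheme \<Rightarrow> ('o, 'm, 'g monoid, 'g \<Rightarrow> 'g) ftr \<Rightarrow> bool"
  where
  "coproducts_to_products u C F \<longleftrightarrow>
     (\<forall>(I :: 'u set) X P \<iota>. small u I \<and> is_coproduct C I X P \<iota> \<longrightarrow>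
        (\<lambda>x. \<lambda>i\<in>I. on_ar F (\<iota> i) x)
          \<in> iso (on_ob F P) (product_group I (\<lambda>i. on_ob F (X i))))"

end

theory Submission
  imports Defs
begin

text \<open>
  The heart of the matter is to represent a cohomological functor \<open>F : \<T>\<^sup>o\<^sup>p \<rightarrow> Ab\<close> that sends
  coproducts to products, given a perfect generator \<open>S\<close>. By Yoneda's lemma this means to find an
  object \<open>X\<close> and an element \<open>\<xi> \<in> F X\<close> such that \<open>f \<mapsto> F f \<xi>\<close> is a bijection \<open>Hom(Y, X) \<rightarrow> F Y\<close> for
  all \<open>Y\<close>. The objects \<open>Y\<close> at all of whose shifts this holds form a triangulated subcategory closed
  under coproducts, by the five lemma and since \<open>F\<close> sends coproducts to products. So by (PG1) it
  suffices to treat the shifts of \<open>S\<close> (\<open>represented_everywhere\<close>), and as these are retracts of their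
  coproduct \<open>S'\<close>, which inherits (PG2), one is mostly concerned with maps out of \<open>S'\<close>.

  As in the usual proof of Brown representability, \<open>X\<close> is the homotopy colimit of a sequence
  \<open>X\<^sub>0 \<rightarrow> X\<^sub>1 \<rightarrow> \<dots>\<close> with compatible elements \<open>\<xi>\<^sub>i \<in> F X\<^sub>i\<close>, where every element of \<open>F S'\<close> comes from
  \<open>\<xi>\<^sub>0\<close> and where \<open>X\<^sub>i \<rightarrow> X\<^sub>i\<^sub>+\<^sub>1\<close> kills each map \<open>S' \<rightarrow> X\<^sub>i\<close> that \<open>\<xi>\<^sub>i\<close> sends to zero
  (\<open>approximating_sequence\<close>). If \<open>S'\<close> were compact, one would now pass to the colimit of the groups
  \<open>Hom(S', X\<^sub>i)\<close>. A perfect object allows for the following argument instead (\<open>telescope\<close>). The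
  construction makes each \<open>Hom(S', X\<^sub>i\<^sub>+\<^sub>1)\<close> the direct sum of the image of \<open>Hom(S', X\<^sub>0)\<close>, which is
  \<open>F S'\<close>, and the kernel of the next transition map. Such statements on individual maps out of \<open>S'\<close>
  pass to countable coproducts by (PG2), in the form of \<open>perfect_detects_zero\<close> and
  \<open>perfect_detects_zero_on_kernel\<close>. Hence \<open>1 - shift\<close> on the coproduct of the \<open>X\<^sub>i\<close> induces an
  injective map on \<open>Hom(S', -)\<close>, whose cokernel is \<open>F S'\<close>, and the triangle that defines \<open>X\<close> yields
  the bijection \<open>Hom(S', X) \<rightarrow> F S'\<close>.

  For an exact functor \<open>F : \<T> \<rightarrow> \<U>\<close> that preserves coproducts, the functors \<open>Hom(F -, Y)\<close> are
  cohomological and send coproducts to products. The objects that represent them, with their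
  universal elements \<open>F X \<rightarrow> Y\<close>, make up a right adjoint. The converse directions are formal.
\<close>

section \<open>Categories and coproducts\<close>

context category
begin

lemma Hom_objs:
  assumes "f \<in> Hom C X Y"
  shows "X \<in> Obj C" "Y \<in> Obj C"
  using assms dom_cod by (auto simp: Hom_def)

lemma iso_arr_iff:
  assumes "f \<in> Hom C X Y"
  shows "iso_arr C f \<longleftrightarrow> (\<exists>g \<in> Hom C Y X. g \<cdot> f = Ident C X \<and> f \<cdot> g = Ident C Y)"
  using assms by (auto simp: iso_arr_def Hom_def)

lemma isomorphic_iff:
  "isomorphic C X Y \<longleftrightarrow>
     (\<exists>f \<in> Hom C X Y. \<exists>g \<in> Hom C Y X. g \<cdot> f = Ident C X \<and> f \<cdot> g = Ident C Y)"
  unfolding isomorphic_def using iso_arr_iff by auto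

lemma isomorphic_sym: "isomorphic C X Y \<Longrightarrow> isomorphic C Y X"
  unfolding isomorphic_iff by blast

lemma iso_arr_ident: "X \<in> Obj C \<Longrightarrow> iso_arr C (Ident C X)"
  using iso_arr_iff[OF ident] ident ident_comp by blast

lemma retract_cancel:
  assumes "i \<in> Hom C X Y" "p \<in> Hom C Y X" "p \<cdot> i = Ident C X" "g \<in> Hom C W X"
  shows "p \<cdot> i \<cdot> g = g"
  using comp_assoc[OF assms(4,1,2)] assms ident_comp by simp

lemma retract_cancel_right:
  assumes "i \<in> Hom C X Y" "p \<in> Hom C Y X" "p \<cdot> i = Ident C X" "g \<in> Hom C X W"
  shows "(g \<cdot> p) \<cdot> i = g"
  using comp_assoc[OF assms(1,2,4)] assms comp_ident by simp

lemma coproductD: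
  assumes "is_coproduct C I X P \<iota>"
  shows "P \<in> Obj C" "i \<in> I \<Longrightarrow> X i \<in> Obj C" "i \<in> I \<Longrightarrow> \<iota> i \<in> Hom C (X i) P"
  using assms by (auto simp: is_coproduct_def)

lemma coproduct_map_ex:
  assumes "is_coproduct C I X P \<iota>" "Z \<in> Obj C" "\<And>i. i \<in> I \<Longrightarrow> f i \<in> Hom C (X i) Z"
  shows "\<exists>h. h \<in> Hom C P Z \<and> (\<forall>i \<in> I. h \<cdot> \<iota> i = f i)"
  using assms unfolding is_coproduct_def by blast

lemma coproduct_map:
  assumes "is_coproduct C I X P \<iota>" "Z \<in> Obj C" "\<And>i. i \<in> I \<Longrightarrow> f i \<in> Hom C (X i) Z"
  obtains h where "h \<in> Hom C P Z" "\<And>i. i \<in> I \<Longrightarrow> h \<cdot> \<iota> i = f i"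
  using coproduct_map_ex[OF assms] by blast

lemma coproduct_eqI:
  assumes "is_coproduct C I X P \<iota>" "h \<in> Hom C P Z" "h' \<in> Hom C P Z"
    and "\<And>i. i \<in> I \<Longrightarrow> h \<cdot> \<iota> i = h' \<cdot> \<iota> i"
  shows "h = h'"
proof -
  have "Z \<in> Obj C" using Hom_objs(2) assms(2) by blast
  moreover have "\<forall>i \<in> I. h' \<cdot> \<iota> i \<in> Hom C (X i) Z"
    using comp coproductD(3)[OF assms(1)] assms(3) by blast
  ultimately have "\<exists>!k. k \<in> Hom C P Z \<and> (\<forall>i \<in> I. k \<cdot> \<iota> i = h' \<cdot> \<iota> i)"
    using assms(1)[unfolded is_coproduct_def, THEN conjunct2, THEN conjunct2, THEN conjunct2,
        rule_format, of Z "\<lambda>i. h' \<cdot> \<iota> i"] by simp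
  then show ?thesis using assms(2-4) by blast
qed

lemma coproductI:
  assumes "\<And>i. i \<in> I \<Longrightarrow> X i \<in> Obj C" "P \<in> Obj C" "\<And>i. i \<in> I \<Longrightarrow> \<iota> i \<in> Hom C (X i) P"
    and "\<And>Z f. Z \<in> Obj C \<Longrightarrow> (\<And>i. i \<in> I \<Longrightarrow> f i \<in> Hom C (X i) Z)
      \<Longrightarrow> \<exists>!h. h \<in> Hom C P Z \<and> (\<forall>i \<in> I. h \<cdot> \<iota> i = f i)"
  shows "is_coproduct C I X P \<iota>"
  unfolding is_coproduct_def using assms by blast

lemma coproduct_reindex:
  assumes cop: "is_coproduct C J Y P \<kappa>" and g: "bij_betw g I J"
  shows "is_coproduct C I (Y \<circ> g) P (\<kappa> \<circ> g)"
proof (rule coproductI)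
  have gJ: "g i \<in> J" if "i \<in> I" for i using bij_betwE[OF g] that by blast
  show "(Y \<circ> g) i \<in> Obj C" "(\<kappa> \<circ> g) i \<in> Hom C ((Y \<circ> g) i) P" if "i \<in> I" for i
    using coproductD[OF cop] gJ that by auto
  show "P \<in> Obj C" using coproductD[OF cop] by simp
  let ?h = "the_inv_into I g"
  have hI: "?h j \<in> I" "g (?h j) = j" if "j \<in> J" for j
    using g that f_the_inv_into_f_bij_betw[OF g]
    by (auto simp: bij_betw_def intro: the_inv_into_into)
  have hg: "?h (g i) = i" if "i \<in> I" for i
    using g that by (simp add: bij_betw_def the_inv_into_f_f)
  fix Z f assume Z: "Z \<in> Obj C" and f: "\<And>i. i \<in> I \<Longrightarrow> f i \<in> Hom C ((Y \<circ> g) i) Z"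
  have "f (?h j) \<in> Hom C (Y j) Z" if "j \<in> J" for j using f[of "?h j"] hI[OF that] by simp
  then obtain k where k: "k \<in> Hom C P Z" "\<And>j. j \<in> J \<Longrightarrow> k \<cdot> \<kappa> j = f (?h j)"
    using coproduct_map[OF cop Z, of "\<lambda>j. f (?h j)"] by blast
  show "\<exists>!h. h \<in> Hom C P Z \<and> (\<forall>i \<in> I. h \<cdot> (\<kappa> \<circ> g) i = f i)"
  proof (rule ex1I[of _ k])
    show "k \<in> Hom C P Z \<and> (\<forall>i \<in> I. k \<cdot> (\<kappa> \<circ> g) i = f i)"
      using k gJ hg by simp
    fix k' assume k': "k' \<in> Hom C P Z \<and> (\<forall>i \<in> I. k' \<cdot> (\<kappa> \<circ> g) i = f i)"
    show "k' = k"
    proof (rule coproduct_eqI[OF cop])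
      fix j assume j: "j \<in> J"
      show "k' \<cdot> \<kappa> j = k \<cdot> \<kappa> j" using k' hI[OF j] k(2)[OF j] by (metis comp_apply)
    qed (use k k' in auto)
  qed
qed

text \<open>
  The index sets in \<open>has_coproducts\<close> are subsets of \<open>'u\<close>; as every small set is in bijection with one
  of these, coproducts of families over other small sets are obtained by reindexing.
\<close>

lemma small_coproduct:
  fixes u :: "'u itself"
  assumes "has_coproducts u C" "small u I" "\<And>i. i \<in> I \<Longrightarrow> X i \<in> Obj C"
  shows "\<exists>P \<iota>. is_coproduct C I X P \<iota>"
proof -
  obtain g :: "_ \<Rightarrow> 'u" where g: "inj_on g I"
    using assms(2) unfolding small_def lesspoll_def lepoll_def by blast
  let ?h = "the_inv_into I g"
  have bij: "bij_betw g I (g ` I)" using g by (simp add: bij_betw_def)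
  have sm: "small u (g ` I)"
    using assms(2) unfolding small_def
    using bij eqpoll_def lesspoll_eq_trans by (metis eqpoll_sym eq_lesspoll_trans)
  have "\<forall>j \<in> g ` I. (X \<circ> ?h) j \<in> Obj C"
    using assms(3) the_inv_into_f_f[OF g] by auto
  then obtain P \<kappa> where "is_coproduct C (g ` I) (X \<circ> ?h) P \<kappa>"
    using assms(1) sm unfolding has_coproducts_def by blast
  from coproduct_reindex[OF this bij]
  have "is_coproduct C I (X \<circ> ?h \<circ> g) P (\<kappa> \<circ> g)" .
  then have "is_coproduct C I X P (\<kappa> \<circ> g)"
    using the_inv_into_f_f[OF g] unfolding is_coproduct_def by auto
  then show ?thesis by blast
qed

end

lemma small_countable:
  fixes u :: "'u itself"
  assumes "uncountable (UNIV :: 'u set)" "countable A"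
  shows "small u A"
proof -
  have "A \<lesssim> (UNIV :: nat set)"
    using assms(2) unfolding countable_def lepoll_def by blast
  moreover have "(UNIV :: nat set) \<lesssim> (UNIV :: 'u set)"
    using assms(1) countable_finite infinite_le_lepoll by blast
  ultimately have "A \<lesssim> (UNIV :: 'u set)" by (rule lepoll_trans)
  moreover have "\<not> (UNIV :: 'u set) \<lesssim> A"
    using assms countable_lepoll by blast
  ultimately show ?thesis
    unfolding small_def lesspoll_def using eqpoll_imp_lepoll eqpoll_sym by blast
qed

lemma small_subset: "small u B \<Longrightarrow> A \<subseteq> B \<Longrightarrow> small u A"
  unfolding small_def using lesspoll_trans1 subset_imp_lepoll by blast

section \<open>Functors, equivalences and adjunctions\<close>

context is_functor
begin

lemma preserves_isomorphic: "isomorphic A X Y \<Longrightarrow> isomorphic B (on_ob F X) (on_ob F Y)"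
  unfolding A.isomorphic_iff B.isomorphic_iff
  by (metis A.Hom_objs(1) ar map_comp map_ident)

end

text \<open>
  A map out of \<open>F P\<close> is the same as a map out of \<open>P\<close>, so universal properties of the latter
  carry over.
\<close>

lemma left_adjoint_preserves_coproduct:
  assumes adj: "is_right_adjoint A B F G" and cop: "is_coproduct A I X P \<iota>"
  shows "is_coproduct B I (on_ob F \<circ> X) (on_ob F P) (on_ar F \<circ> \<iota>)"
proof -
  interpret F: is_functor A B F using adj by (simp add: is_right_adjoint_def)
  interpret G: is_functor B A G using adj by (simp add: is_right_adjoint_def)
  obtain \<phi> where bij: "\<And>X Y. X \<in> Obj A \<Longrightarrow> Y \<in> Obj B \<Longrightarrow>
        bij_betw (\<phi> X Y) (Hom B (on_ob F X) Y) (Hom A X (on_ob G Y))"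
    and nat: "\<And>X' X Y Y' a g b. \<lbrakk>a \<in> Hom A X' X; g \<in> Hom B (on_ob F X) Y; b \<in> Hom B Y Y'\<rbrakk>
      \<Longrightarrow> \<phi> X' Y' (b \<cdot>\<^bsub>B\<^esub> g \<cdot>\<^bsub>B\<^esub> on_ar F a) = on_ar G b \<cdot>\<^bsub>A\<^esub> \<phi> X Y g \<cdot>\<^bsub>A\<^esub> a"
    using adj unfolding is_right_adjoint_def by (metis F.A.Hom_objs F.B.Hom_objs)
  note cD = F.A.coproductD[OF cop]
  have nat1: "\<phi> X' Y (g \<cdot>\<^bsub>B\<^esub> on_ar F a) = \<phi> X Y g \<cdot>\<^bsub>A\<^esub> a"
    if "a \<in> Hom A X' X" "g \<in> Hom B (on_ob F X) Y" for a g X' X Y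
  proof -
    have obs: "X \<in> Obj A" "Y \<in> Obj B"
      using that F.A.Hom_objs F.B.Hom_objs by blast+
    have "\<phi> X Y g \<cdot>\<^bsub>A\<^esub> a \<in> Hom A X' (on_ob G Y)"
      using bij_betwE[OF bij[OF obs]] that F.A.comp by blast
    moreover have "g \<cdot>\<^bsub>B\<^esub> on_ar F a \<in> Hom B (on_ob F X') Y"
      using that F.ar F.B.comp by blast
    ultimately show ?thesis
      using nat[OF that F.B.ident[OF obs(2)]] F.B.ident_comp F.A.ident_comp obs G.map_ident
      by metis
  qed
  show ?thesis
  proof (rule F.B.coproductI)
    show "(on_ob F \<circ> X) i \<in> Obj B" "(on_ar F \<circ> \<iota>) i \<in> Hom B ((on_ob F \<circ> X) i) (on_ob F P)"
      if "i \<in> I" for i using that cD F.ob F.ar by auto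
    show "on_ob F P \<in> Obj B" using cD F.ob by auto
    fix Z f assume Z: "Z \<in> Obj B" and f: "\<And>i. i \<in> I \<Longrightarrow> f i \<in> Hom B ((on_ob F \<circ> X) i) Z"
    have \<phi>f: "\<phi> (X i) Z (f i) \<in> Hom A (X i) (on_ob G Z)" if "i \<in> I" for i
      using f[OF that] bij_betwE[OF bij[OF cD(2)[OF that] Z]] by auto
    obtain k where k: "k \<in> Hom A P (on_ob G Z)"
        "\<And>i. i \<in> I \<Longrightarrow> k \<cdot>\<^bsub>A\<^esub> \<iota> i = \<phi> (X i) Z (f i)"
      using F.A.coproduct_map[OF cop G.ob[OF Z], of "\<lambda>i. \<phi> (X i) Z (f i)"] \<phi>f by blast
    obtain h where h: "h \<in> Hom B (on_ob F P) Z" "\<phi> P Z h = k"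
      using bij[OF cD(1) Z] k(1) by (metis bij_betw_imp_surj_on imageE)
    have comp_iff: "h' \<cdot>\<^bsub>B\<^esub> on_ar F (\<iota> i) = f i \<longleftrightarrow> \<phi> P Z h' \<cdot>\<^bsub>A\<^esub> \<iota> i = \<phi> (X i) Z (f i)"
      if "i \<in> I" "h' \<in> Hom B (on_ob F P) Z" for i h'
    proof -
      have "h' \<cdot>\<^bsub>B\<^esub> on_ar F (\<iota> i) \<in> Hom B (on_ob F (X i)) Z"
        using that cD F.ar F.B.comp by blast
      then have "h' \<cdot>\<^bsub>B\<^esub> on_ar F (\<iota> i) = f i \<longleftrightarrow>
          \<phi> (X i) Z (h' \<cdot>\<^bsub>B\<^esub> on_ar F (\<iota> i)) = \<phi> (X i) Z (f i)"
        using bij[OF cD(2)[OF that(1)] Z] f[OF that(1)] by (auto simp: bij_betw_def inj_on_def)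
      then show ?thesis using nat1[OF cD(3)[OF that(1)] that(2)] by simp
    qed
    show "\<exists>!h. h \<in> Hom B (on_ob F P) Z \<and> (\<forall>i \<in> I. h \<cdot>\<^bsub>B\<^esub> (on_ar F \<circ> \<iota>) i = f i)"
    proof (rule ex1I[of _ h])
      show "h \<in> Hom B (on_ob F P) Z \<and> (\<forall>i \<in> I. h \<cdot>\<^bsub>B\<^esub> (on_ar F \<circ> \<iota>) i = f i)"
        using h k comp_iff by simp
      fix h' assume h': "h' \<in> Hom B (on_ob F P) Z \<and> (\<forall>i \<in> I. h' \<cdot>\<^bsub>B\<^esub> (on_ar F \<circ> \<iota>) i = f i)"
      have "\<phi> P Z h' = \<phi> P Z h"
      proof (rule F.A.coproduct_eqI[OF cop])
        show "\<phi> P Z h' \<in> Hom A P (on_ob G Z)" "\<phi> P Z h \<in> Hom A P (on_ob G Z)"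
          using h h' bij_betwE[OF bij[OF cD(1) Z]] by auto
        show "\<phi> P Z h' \<cdot>\<^bsub>A\<^esub> \<iota> i = \<phi> P Z h \<cdot>\<^bsub>A\<^esub> \<iota> i" if "i \<in> I" for i
          using comp_iff[OF that] h' h k that by auto
      qed
      then show "h' = h"
        using bij[OF cD(1) Z] h h' by (auto simp: bij_betw_def inj_on_def)
    qed
  qed
qed

text \<open>
  The universal arrows become the counit of the adjunction.
\<close>

lemma right_adjoint_if_universal_arrows:
  assumes "is_functor A B F"
    and univ: "\<And>Y. Y \<in> Obj B \<Longrightarrow> \<exists>X \<in> Obj A. \<exists>\<xi> \<in> Hom B (on_ob F X) Y.
      \<forall>W \<in> Obj A. \<forall>g \<in> Hom B (on_ob F W) Y. \<exists>!f. f \<in> Hom A W X \<and> \<xi> \<cdot>\<^bsub>B\<^esub> on_ar F f = g"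
  shows "\<exists>G. is_right_adjoint A B F G"
proof -
  interpret F: is_functor A B F by fact
  obtain R \<xi> where R: "\<And>Y. Y \<in> Obj B \<Longrightarrow> R Y \<in> Obj A"
    and \<xi>: "\<And>Y. Y \<in> Obj B \<Longrightarrow> \<xi> Y \<in> Hom B (on_ob F (R Y)) Y"
    and u: "\<And>Y W g. Y \<in> Obj B \<Longrightarrow> W \<in> Obj A \<Longrightarrow> g \<in> Hom B (on_ob F W) Y \<Longrightarrow>
      \<exists>!f. f \<in> Hom A W (R Y) \<and> \<xi> Y \<cdot>\<^bsub>B\<^esub> on_ar F f = g"
  proof -
    have "\<forall>Y. \<exists>X \<xi>. Y \<in> Obj B \<longrightarrow> X \<in> Obj A \<and> \<xi> \<in> Hom B (on_ob F X) Y \<and>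
      (\<forall>W \<in> Obj A. \<forall>g \<in> Hom B (on_ob F W) Y. \<exists>!f. f \<in> Hom A W X \<and> \<xi> \<cdot>\<^bsub>B\<^esub> on_ar F f = g)"
      using univ by meson
    then obtain R \<xi> where "\<forall>Y. Y \<in> Obj B \<longrightarrow> R Y \<in> Obj A \<and> \<xi> Y \<in> Hom B (on_ob F (R Y)) Y \<and>
      (\<forall>W \<in> Obj A. \<forall>g \<in> Hom B (on_ob F W) Y.
        \<exists>!f. f \<in> Hom A W (R Y) \<and> \<xi> Y \<cdot>\<^bsub>B\<^esub> on_ar F f = g)"
      by metis
    then show thesis using that[of R \<xi>] by auto
  qed
  define \<phi> where "\<phi> W Y g = (THE f. f \<in> Hom A W (R Y) \<and> \<xi> Y \<cdot>\<^bsub>B\<^esub> on_ar F f = g)" for W Y g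
  have \<phi>: "\<phi> W Y g \<in> Hom A W (R Y)" "\<xi> Y \<cdot>\<^bsub>B\<^esub> on_ar F (\<phi> W Y g) = g"
    if "W \<in> Obj A" "g \<in> Hom B (on_ob F W) Y" for W Y g
    using theI'[OF u[of Y W g]] that F.B.Hom_objs unfolding \<phi>_def by blast+
  have \<phi>_eq: "\<phi> W Y (\<xi> Y \<cdot>\<^bsub>B\<^esub> on_ar F f) = f" if "Y \<in> Obj B" "f \<in> Hom A W (R Y)" for W Y f
  proof -
    have W: "W \<in> Obj A" using that F.A.Hom_objs by blast
    have g: "\<xi> Y \<cdot>\<^bsub>B\<^esub> on_ar F f \<in> Hom B (on_ob F W) Y" using that \<xi> F.ar F.B.comp by blast
    show ?thesis using u[OF that(1) W g] \<phi>[OF W g] that by blast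
  qed
  define G where "G = \<lparr>on_ob = R, on_ar = (\<lambda>b. \<phi> (R (Dom B b)) (Cod B b) (b \<cdot>\<^bsub>B\<^esub> \<xi> (Dom B b)))\<rparr>"
  have G_ob: "on_ob G = R" by (simp add: G_def)
  have G_ar: "on_ar G b = \<phi> (R Y) Y' (b \<cdot>\<^bsub>B\<^esub> \<xi> Y)" if "b \<in> Hom B Y Y'" for b Y Y'
    using that by (simp add: G_def Hom_def)
  have G: "on_ar G b \<in> Hom A (R Y) (R Y')" "\<xi> Y' \<cdot>\<^bsub>B\<^esub> on_ar F (on_ar G b) = b \<cdot>\<^bsub>B\<^esub> \<xi> Y"
    if "b \<in> Hom B Y Y'" for b Y Y'
    unfolding G_ar[OF that] using \<phi>[OF R F.B.comp[OF \<xi> that]] that F.B.Hom_objs by blast+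
  have nat: "\<phi> X' Y' (b \<cdot>\<^bsub>B\<^esub> g \<cdot>\<^bsub>B\<^esub> on_ar F a) = on_ar G b \<cdot>\<^bsub>A\<^esub> \<phi> X Y g \<cdot>\<^bsub>A\<^esub> a"
    if a: "a \<in> Hom A X' X" and g: "g \<in> Hom B (on_ob F X) Y" and b: "b \<in> Hom B Y Y'"
    for X' X Y Y' a g b
  proof -
    have obs: "X \<in> Obj A" "Y \<in> Obj B" "Y' \<in> Obj B" using F.A.Hom_objs F.B.Hom_objs that by blast+
    note p = \<phi>[OF obs(1) g]
    note Fp = F.ar[OF p(1)] and Fa = F.ar[OF a] and Gb = G[OF b] and FGb = F.ar[OF G(1)[OF b]]
    have pa: "\<phi> X Y g \<cdot>\<^bsub>A\<^esub> a \<in> Hom A X' (R Y)" using F.A.comp[OF a p(1)] .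
    have "\<xi> Y' \<cdot>\<^bsub>B\<^esub> on_ar F (on_ar G b \<cdot>\<^bsub>A\<^esub> \<phi> X Y g \<cdot>\<^bsub>A\<^esub> a)
      = \<xi> Y' \<cdot>\<^bsub>B\<^esub> on_ar F (on_ar G b) \<cdot>\<^bsub>B\<^esub> on_ar F (\<phi> X Y g) \<cdot>\<^bsub>B\<^esub> on_ar F a"
      using F.map_comp[OF pa Gb(1)] F.map_comp[OF a p(1)] by simp
    also have "\<dots> = (b \<cdot>\<^bsub>B\<^esub> \<xi> Y) \<cdot>\<^bsub>B\<^esub> on_ar F (\<phi> X Y g) \<cdot>\<^bsub>B\<^esub> on_ar F a"
      using F.B.comp_assoc[OF F.B.comp[OF Fa Fp] FGb \<xi>[OF obs(3)]] Gb by simp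
    also have "\<dots> = b \<cdot>\<^bsub>B\<^esub> g \<cdot>\<^bsub>B\<^esub> on_ar F a"
      using F.B.comp_assoc[OF F.B.comp[OF Fa Fp] \<xi>[OF obs(2)] b]
        F.B.comp_assoc[OF Fa Fp \<xi>[OF obs(2)]] p by simp
    finally show ?thesis using \<phi>_eq[OF obs(3) F.A.comp[OF pa Gb(1)]] by simp
  qed
  have "is_functor B A G"
  proof
    show "on_ob G Y \<in> Obj A" if "Y \<in> Obj B" for Y using R that G_ob by simp
    show "on_ar G b \<in> Hom A (on_ob G Y) (on_ob G Y')" if "b \<in> Hom B Y Y'" for b Y Y'
      using G[OF that] G_ob by simp
    show "on_ar G (Ident B Y) = Ident A (on_ob G Y)" if Y: "Y \<in> Obj B" for Y
    proof -
      have "Ident B Y \<cdot>\<^bsub>B\<^esub> \<xi> Y = \<xi> Y \<cdot>\<^bsub>B\<^esub> on_ar F (Ident A (R Y))"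
        using F.map_ident[OF R[OF Y]] F.B.ident_comp[OF \<xi>[OF Y]] F.B.comp_ident[OF \<xi>[OF Y]] by simp
      then show ?thesis
        unfolding G_ob G_ar[OF F.B.ident[OF Y]] using \<phi>_eq[OF Y F.A.ident[OF R[OF Y]]] by simp
    qed
    show "on_ar G (g \<cdot>\<^bsub>B\<^esub> f) = on_ar G g \<cdot>\<^bsub>A\<^esub> on_ar G f"
      if f: "f \<in> Hom B X Y" and g: "g \<in> Hom B Y Z" for f g X Y Z
    proof -
      have X: "X \<in> Obj B" using F.B.Hom_objs f by blast
      have Y: "Y \<in> Obj B" and Z: "Z \<in> Obj B" using F.B.Hom_objs g by blast+
      have "\<xi> Z \<cdot>\<^bsub>B\<^esub> on_ar F (on_ar G g \<cdot>\<^bsub>A\<^esub> on_ar G f) = (g \<cdot>\<^bsub>B\<^esub> f) \<cdot>\<^bsub>B\<^esub> \<xi> X"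
        using F.map_comp[OF G(1)[OF f] G(1)[OF g]] G(2)[OF g] G(2)[OF f]
          F.B.comp_assoc[OF F.ar[OF G(1)[OF f]] F.ar[OF G(1)[OF g]] \<xi>[OF Z]]
          F.B.comp_assoc[OF F.ar[OF G(1)[OF f]] \<xi>[OF Y] g] F.B.comp_assoc[OF \<xi>[OF X] f g] by simp
      then show ?thesis
        using \<phi>_eq[OF Z F.A.comp[OF G(1)[OF f] G(1)[OF g]]] G_ar[OF F.B.comp[OF f g]] by simp
    qed
  qed
  moreover have "bij_betw (\<phi> X Y) (Hom B (on_ob F X) Y) (Hom A X (on_ob G Y))"
    if "X \<in> Obj A" "Y \<in> Obj B" for X Y
    unfolding G_ob
  proof (rule bij_betwI[of _ _ _ "\<lambda>f. \<xi> Y \<cdot>\<^bsub>B\<^esub> on_ar F f"])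
    show "\<phi> X Y \<in> Hom B (on_ob F X) Y \<rightarrow> Hom A X (R Y)" using \<phi> that by blast
    show "(\<lambda>f. \<xi> Y \<cdot>\<^bsub>B\<^esub> on_ar F f) \<in> Hom A X (R Y) \<rightarrow> Hom B (on_ob F X) Y"
      using \<xi> that F.ar F.B.comp by blast
  qed (use \<phi> \<phi>_eq that in auto)
  ultimately have "is_right_adjoint A B F G"
    unfolding is_right_adjoint_def using nat F.is_functor_axioms by blast
  then show ?thesis by blast
qed

lemma equivalence_faithful:
  assumes "is_functor A B F" "is_functor B A G" "natural_iso A A (comp_ftr G F) id_ftr \<epsilon>"
    and f: "f \<in> Hom A X Y" and g: "g \<in> Hom A X Y" and eq: "on_ar F f = on_ar F g"
  shows "f = g"
proof -
  interpret F: is_functor A B F by fact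
  interpret G: is_functor B A G by fact
  have obs: "X \<in> Obj A" "Y \<in> Obj A" using f F.A.Hom_objs by blast+
  have \<epsilon>: "\<epsilon> X \<in> Hom A (on_ob G (on_ob F X)) X" "iso_arr A (\<epsilon> X)"
    using assms(3) obs unfolding natural_iso_def comp_ftr_def id_ftr_def by auto
  obtain e where e: "e \<in> Hom A X (on_ob G (on_ob F X))" "\<epsilon> X \<cdot>\<^bsub>A\<^esub> e = Ident A X"
    using \<epsilon> F.A.iso_arr_iff by blast
  have "\<epsilon> Y \<cdot>\<^bsub>A\<^esub> on_ar G (on_ar F k) = k \<cdot>\<^bsub>A\<^esub> \<epsilon> X" if "k \<in> Hom A X Y" for k
    using assms(3) obs that unfolding natural_iso_def comp_ftr_def id_ftr_def by auto
  then have "(f \<cdot>\<^bsub>A\<^esub> \<epsilon> X) \<cdot>\<^bsub>A\<^esub> e = (g \<cdot>\<^bsub>A\<^esub> \<epsilon> X) \<cdot>\<^bsub>A\<^esub> e" using f g eq by metis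
  then show ?thesis
    using F.A.retract_cancel_right[OF e(1) \<epsilon>(1) e(2)] f g by simp
qed

text \<open>
  Naturality of \<open>\<epsilon>\<close> forces the choice of the preimage \<open>f\<close> of \<open>k\<close>. It is compared with \<open>k\<close> after
  applying \<open>G\<close>, which is faithful.
\<close>

lemma equivalence_full:
  assumes "is_functor A B F" "is_functor B A G" "natural_iso A A (comp_ftr G F) id_ftr \<epsilon>"
    and "natural_iso B B (comp_ftr F G) id_ftr \<eta>"
    and obs: "X \<in> Obj A" "Y \<in> Obj A" and k: "k \<in> Hom B (on_ob F X) (on_ob F Y)"
  shows "\<exists>f \<in> Hom A X Y. on_ar F f = k"
proof -
  interpret F: is_functor A B F by fact
  interpret G: is_functor B A G by fact
  have \<epsilon>: "\<epsilon> Z \<in> Hom A (on_ob G (on_ob F Z)) Z" "iso_arr A (\<epsilon> Z)" if "Z \<in> Obj A" for Z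
    using assms(3) that unfolding natural_iso_def comp_ftr_def id_ftr_def by auto
  obtain e where e: "e \<in> Hom A X (on_ob G (on_ob F X))" "e \<cdot>\<^bsub>A\<^esub> \<epsilon> X = Ident A (on_ob G (on_ob F X))"
    using \<epsilon>[OF obs(1)] F.A.iso_arr_iff by blast
  obtain e' where e': "e' \<in> Hom A Y (on_ob G (on_ob F Y))"
    "e' \<cdot>\<^bsub>A\<^esub> \<epsilon> Y = Ident A (on_ob G (on_ob F Y))"
    using \<epsilon>[OF obs(2)] F.A.iso_arr_iff by blast
  have Gk: "on_ar G k \<in> Hom A (on_ob G (on_ob F X)) (on_ob G (on_ob F Y))" using G.ar k by blast
  define f where "f = \<epsilon> Y \<cdot>\<^bsub>A\<^esub> on_ar G k \<cdot>\<^bsub>A\<^esub> e"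
  have Gke: "on_ar G k \<cdot>\<^bsub>A\<^esub> e \<in> Hom A X (on_ob G (on_ob F Y))" using Gk e F.A.comp by blast
  have f: "f \<in> Hom A X Y" unfolding f_def using Gke \<epsilon>[OF obs(2)] F.A.comp by blast
  have GFf: "on_ar G (on_ar F f) \<in> Hom A (on_ob G (on_ob F X)) (on_ob G (on_ob F Y))"
    using F.ar G.ar f by blast
  have "\<epsilon> Y \<cdot>\<^bsub>A\<^esub> on_ar G (on_ar F f) = f \<cdot>\<^bsub>A\<^esub> \<epsilon> X"
    using assms(3) obs f unfolding natural_iso_def comp_ftr_def id_ftr_def by auto
  also have "\<dots> = \<epsilon> Y \<cdot>\<^bsub>A\<^esub> on_ar G k"
    unfolding f_def using F.A.comp_assoc[OF \<epsilon>(1)[OF obs(1)] Gke \<epsilon>(1)[OF obs(2)]]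
      F.A.comp_assoc[OF \<epsilon>(1)[OF obs(1)] e(1) Gk] e(2) F.A.comp_ident[OF Gk] by simp
  finally have "on_ar G (on_ar F f) = on_ar G k"
    using F.A.retract_cancel[OF \<epsilon>(1)[OF obs(2)] e'(1,2)] Gk GFf by metis
  then have "on_ar F f = k"
    using equivalence_faithful[OF assms(2,1,4)] F.ar[OF f] k by blast
  then show ?thesis using f by blast
qed

lemma equivalence_adjoint:
  assumes "is_functor A B F" "is_functor B A G" "natural_iso A A (comp_ftr G F) id_ftr \<epsilon>"
    and "natural_iso B B (comp_ftr F G) id_ftr \<eta>"
  shows "is_right_adjoint A B F G"
proof -
  interpret F: is_functor A B F by fact
  interpret G: is_functor B A G by fact
  have \<epsilon>: "\<epsilon> Z \<in> Hom A (on_ob G (on_ob F Z)) Z" "iso_arr A (\<epsilon> Z)" if "Z \<in> Obj A" for Z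
    using assms(3) that unfolding natural_iso_def comp_ftr_def id_ftr_def by auto
  have "\<forall>Z \<in> Obj A. \<exists>d. d \<in> Hom A Z (on_ob G (on_ob F Z)) \<and>
      \<epsilon> Z \<cdot>\<^bsub>A\<^esub> d = Ident A Z \<and> d \<cdot>\<^bsub>A\<^esub> \<epsilon> Z = Ident A (on_ob G (on_ob F Z))"
    using \<epsilon> F.A.iso_arr_iff by blast
  then obtain e where e: "\<And>Z. Z \<in> Obj A \<Longrightarrow> e Z \<in> Hom A Z (on_ob G (on_ob F Z))"
    "\<And>Z. Z \<in> Obj A \<Longrightarrow> \<epsilon> Z \<cdot>\<^bsub>A\<^esub> e Z = Ident A Z"
    "\<And>Z. Z \<in> Obj A \<Longrightarrow> e Z \<cdot>\<^bsub>A\<^esub> \<epsilon> Z = Ident A (on_ob G (on_ob F Z))"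
    by metis
  have e_nat: "on_ar G (on_ar F f) \<cdot>\<^bsub>A\<^esub> e X = e Y \<cdot>\<^bsub>A\<^esub> f" if f: "f \<in> Hom A X Y" for f X Y
  proof -
    have obs: "X \<in> Obj A" "Y \<in> Obj A" using f F.A.Hom_objs by blast+
    have GFf: "on_ar G (on_ar F f) \<in> Hom A (on_ob G (on_ob F X)) (on_ob G (on_ob F Y))"
      using F.ar G.ar f by blast
    have n: "\<epsilon> Y \<cdot>\<^bsub>A\<^esub> on_ar G (on_ar F f) = f \<cdot>\<^bsub>A\<^esub> \<epsilon> X"
      using assms(3) obs f unfolding natural_iso_def comp_ftr_def id_ftr_def by auto
    have "on_ar G (on_ar F f) = e Y \<cdot>\<^bsub>A\<^esub> f \<cdot>\<^bsub>A\<^esub> \<epsilon> X"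
      using F.A.retract_cancel[OF \<epsilon>(1)[OF obs(2)] e(1)[OF obs(2)] e(3)[OF obs(2)] GFf] n by simp
    then show ?thesis
      using F.A.comp_assoc[OF e(1)[OF obs(1)] F.A.comp[OF \<epsilon>(1)[OF obs(1)] f] e(1)[OF obs(2)]]
        F.A.retract_cancel_right[OF e(1)[OF obs(1)] \<epsilon>(1)[OF obs(1)] e(2)[OF obs(1)] f] by simp
  qed
  define \<phi> where "\<phi> X Y g = on_ar G g \<cdot>\<^bsub>A\<^esub> e X" for X and Y :: 'd and g
  have "bij_betw (\<phi> X Y) (Hom B (on_ob F X) Y) (Hom A X (on_ob G Y))"
    if X: "X \<in> Obj A" and Y: "Y \<in> Obj B" for X Y
  proof (intro bij_betw_imageI inj_onI subset_antisym subsetI)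
    fix g g' assume g: "g \<in> Hom B (on_ob F X) Y" and g': "g' \<in> Hom B (on_ob F X) Y"
      and "\<phi> X Y g = \<phi> X Y g'"
    then have "(on_ar G g \<cdot>\<^bsub>A\<^esub> e X) \<cdot>\<^bsub>A\<^esub> \<epsilon> X = (on_ar G g' \<cdot>\<^bsub>A\<^esub> e X) \<cdot>\<^bsub>A\<^esub> \<epsilon> X"
      by (simp add: \<phi>_def)
    then have "on_ar G g = on_ar G g'"
      using F.A.retract_cancel_right[OF \<epsilon>(1)[OF X] e(1)[OF X] e(3)[OF X]] G.ar g g' by metis
    then show "g = g'" using equivalence_faithful[OF assms(2,1,4) g g'] by simp
  next
    fix k assume "k \<in> \<phi> X Y ` Hom B (on_ob F X) Y"
    then show "k \<in> Hom A X (on_ob G Y)" using G.ar e(1)[OF X] F.A.comp unfolding \<phi>_def by blast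
  next
    fix k assume k: "k \<in> Hom A X (on_ob G Y)"
    obtain g where g: "g \<in> Hom B (on_ob F X) Y" "on_ar G g = k \<cdot>\<^bsub>A\<^esub> \<epsilon> X"
      using equivalence_full[OF assms(2,1,4,3) F.ob[OF X] Y] F.A.comp[OF \<epsilon>(1)[OF X] k] by blast
    then have "\<phi> X Y g = k"
      unfolding \<phi>_def using F.A.retract_cancel_right[OF e(1)[OF X] \<epsilon>(1)[OF X] e(2)[OF X] k] by simp
    then show "k \<in> \<phi> X Y ` Hom B (on_ob F X) Y" using g by blast
  qed
  moreover have "\<phi> X' Y' (b \<cdot>\<^bsub>B\<^esub> g \<cdot>\<^bsub>B\<^esub> on_ar F a) = on_ar G b \<cdot>\<^bsub>A\<^esub> \<phi> X Y g \<cdot>\<^bsub>A\<^esub> a"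
    if a: "a \<in> Hom A X' X" and g: "g \<in> Hom B (on_ob F X) Y" and b: "b \<in> Hom B Y Y'"
    for X' X Y Y' a g b
  proof -
    have obs: "X' \<in> Obj A" "X \<in> Obj A" using F.A.Hom_objs that by blast+
    note Fa = F.ar[OF a]
    note GFa = G.ar[OF Fa] and Gg = G.ar[OF g] and Gb = G.ar[OF b]
    have "\<phi> X' Y' (b \<cdot>\<^bsub>B\<^esub> g \<cdot>\<^bsub>B\<^esub> on_ar F a)
      = (on_ar G b \<cdot>\<^bsub>A\<^esub> on_ar G g \<cdot>\<^bsub>A\<^esub> on_ar G (on_ar F a)) \<cdot>\<^bsub>A\<^esub> e X'"
      unfolding \<phi>_def using G.map_comp[OF F.B.comp[OF Fa g] b] G.map_comp[OF Fa g] by simp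
    also have "\<dots> = on_ar G b \<cdot>\<^bsub>A\<^esub> on_ar G g \<cdot>\<^bsub>A\<^esub> e X \<cdot>\<^bsub>A\<^esub> a"
      using F.A.comp_assoc[OF e(1)[OF obs(1)] F.A.comp[OF GFa Gg] Gb]
        F.A.comp_assoc[OF e(1)[OF obs(1)] GFa Gg] e_nat[OF a] by simp
    also have "\<dots> = on_ar G b \<cdot>\<^bsub>A\<^esub> \<phi> X Y g \<cdot>\<^bsub>A\<^esub> a"
      unfolding \<phi>_def using F.A.comp_assoc[OF a e(1)[OF obs(2)] Gg] by simp
    finally show ?thesis .
  qed
  ultimately show ?thesis
    unfolding is_right_adjoint_def using assms(1,2) by blast
qed

section \<open>Additive categories\<close>

definition hsub :: "('o, 'm, 'x) additive_scheme \<Rightarrow> 'm \<Rightarrow> 'm \<Rightarrow> 'm" where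
  "hsub C f g = hadd C f (hneg C g)"

context additive_category
begin

lemma Hom_grp_simps:
  "carrier (Hom_grp C X Y) = Hom C X Y" "monoid.mult (Hom_grp C X Y) = hadd C"
  "one (Hom_grp C X Y) = hzero C X Y" "f \<in> Hom C X Y \<Longrightarrow> m_inv (Hom_grp C X Y) f = hneg C f"
  by (auto simp: Hom_grp_def hneg_def Hom_def)

lemma Hom_group: "f \<in> Hom C X Y \<Longrightarrow> comm_group (Hom_grp C X Y)"
  using Hom_comm_group Hom_objs by blast

lemma hzero_Hom: "X \<in> Obj C \<Longrightarrow> Y \<in> Obj C \<Longrightarrow> hzero C X Y \<in> Hom C X Y"
  using monoid.one_closed[of "Hom_grp C X Y"] Hom_comm_group
  by (simp add: Hom_grp_simps comm_group_def comm_monoid_def)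

context
  fixes f X Y
  assumes f: "f \<in> Hom C X Y"
begin

interpretation H: comm_group "Hom_grp C X Y" using Hom_group[OF f] .

lemma hneg_Hom: "hneg C f \<in> Hom C X Y"
  using H.inv_closed[of f] f by (simp add: Hom_grp_simps)

lemma hadd_zero: "hadd C f (hzero C X Y) = f" "hadd C (hzero C X Y) f = f"
  using H.r_one[of f] H.l_one[of f] f by (simp_all add: Hom_grp_simps)

lemma hadd_hneg: "hadd C f (hneg C f) = hzero C X Y" "hadd C (hneg C f) f = hzero C X Y"
  using H.r_inv[of f] H.l_inv[of f] f by (simp_all add: Hom_grp_simps)

lemma hneg_hneg: "hneg C (hneg C f) = f"
  using H.inv_inv[of f] f hneg_Hom by (simp add: Hom_grp_simps)

lemma hadd_idem: "hadd C f f = f \<Longrightarrow> f = hzero C X Y"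
  using H.l_cancel_one[of f f] f by (simp add: Hom_grp_simps)

lemma hadd_Hom: "g \<in> Hom C X Y \<Longrightarrow> hadd C f g \<in> Hom C X Y"
  using H.m_closed f by (simp add: Hom_grp_simps)

lemma hadd_commute: "g \<in> Hom C X Y \<Longrightarrow> hadd C f g = hadd C g f"
  using H.m_comm f by (simp add: Hom_grp_simps)

lemma hneg_unique: "g \<in> Hom C X Y \<Longrightarrow> hadd C f g = hzero C X Y \<Longrightarrow> g = hneg C f"
  using H.inv_unique'[of f g] H.m_comm[of f g] f by (simp add: Hom_grp_simps)

lemma hadd_assoc:
  "g \<in> Hom C X Y \<Longrightarrow> h \<in> Hom C X Y \<Longrightarrow> hadd C (hadd C f g) h = hadd C f (hadd C g h)"
  using H.m_assoc f by (simp add: Hom_grp_simps)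

end

lemma hsub_Hom: "f \<in> Hom C X Y \<Longrightarrow> g \<in> Hom C X Y \<Longrightarrow> hsub C f g \<in> Hom C X Y"
  unfolding hsub_def using hadd_Hom hneg_Hom by blast

lemma hsub_self: "f \<in> Hom C X Y \<Longrightarrow> hsub C f f = hzero C X Y"
  unfolding hsub_def using hadd_hneg by blast

lemma hadd_hsub: "f \<in> Hom C X Y \<Longrightarrow> g \<in> Hom C X Y \<Longrightarrow> hadd C (hsub C f g) g = f"
  unfolding hsub_def using hadd_assoc hadd_hneg hadd_zero hneg_Hom by metis

lemma hsub_eq_zeroD:
  "f \<in> Hom C X Y \<Longrightarrow> g \<in> Hom C X Y \<Longrightarrow> hsub C f g = hzero C X Y \<Longrightarrow> f = g"
  using hadd_hsub hadd_zero by metis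

lemma hadd_right_cancel:
  assumes "f \<in> Hom C X Y" "g \<in> Hom C X Y" "h \<in> Hom C X Y" "hadd C f h = hadd C g h"
  shows "f = g"
proof -
  interpret H: comm_group "Hom_grp C X Y" using Hom_group[OF assms(1)] .
  show ?thesis using H.right_cancel[of h f g] assms by (simp add: Hom_grp_simps)
qed

lemma hsub_hsub:
  assumes "f \<in> Hom C X Y" "g \<in> Hom C X Y"
  shows "hsub C f (hsub C f g) = g"
proof -
  note d = hsub_Hom[OF assms]
  have "hadd C (hsub C f (hsub C f g)) (hsub C f g) = hadd C g (hsub C f g)"
    using hadd_hsub[OF assms(1) d] hadd_hsub[OF assms] hadd_commute[OF assms(2) d] by simp
  then show ?thesis using hadd_right_cancel[OF hsub_Hom[OF assms(1) d] assms(2) d] by simp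
qed

lemma hadd_hsub_hsub:
  assumes a: "a \<in> Hom C X Y" and d: "d \<in> Hom C X Y" and v: "v \<in> Hom C X Y"
  shows "hadd C a (hsub C d (hsub C (hadd C a d) v)) = v"
proof -
  note u = hadd_Hom[OF a d]
  note uv = hsub_Hom[OF u v]
  note w = hsub_Hom[OF d uv]
  have "hadd C (hadd C a (hsub C d (hsub C (hadd C a d) v))) (hsub C (hadd C a d) v)
    = hadd C v (hsub C (hadd C a d) v)"
    using hadd_assoc[OF a w uv] hadd_hsub[OF d uv] hadd_commute[OF v uv] hadd_hsub[OF u v] by simp
  then show ?thesis using hadd_right_cancel[OF hadd_Hom[OF a w] v uv] by simp
qed

lemma comp_zero:
  assumes "f \<in> Hom C X Y" "Z \<in> Obj C"
  shows "f \<cdot> hzero C Z X = hzero C Z Y" "hzero C Y Z \<cdot> f = hzero C X Z"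
proof -
  have obs: "X \<in> Obj C" "Y \<in> Obj C" using assms Hom_objs by blast+
  note z = hzero_Hom[OF assms(2) obs(1)] and z' = hzero_Hom[OF obs(2) assms(2)]
  show "f \<cdot> hzero C Z X = hzero C Z Y"
    using hadd_idem[OF comp[OF z assms(1)]] comp_add[OF z z assms(1)] hadd_zero[OF z] by simp
  show "hzero C Y Z \<cdot> f = hzero C X Z"
    using hadd_idem[OF comp[OF assms(1) z']] add_comp[OF assms(1) z' z'] hadd_zero[OF z'] by simp
qed

lemma comp_hneg:
  assumes "f \<in> Hom C X Y" "g \<in> Hom C Y Z"
  shows "g \<cdot> hneg C f = hneg C (g \<cdot> f)" "hneg C g \<cdot> f = hneg C (g \<cdot> f)"
proof -
  have obs: "X \<in> Obj C" "Z \<in> Obj C" using assms Hom_objs by blast+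
  have gf: "g \<cdot> f \<in> Hom C X Z" using assms comp by blast
  have nf: "hneg C f \<in> Hom C X Y" and ng: "hneg C g \<in> Hom C Y Z" using hneg_Hom assms by blast+
  show "g \<cdot> hneg C f = hneg C (g \<cdot> f)"
    using hneg_unique[OF gf comp[OF nf assms(2)]] comp_add[OF assms(1) nf assms(2)]
      hadd_hneg[OF assms(1)] comp_zero(1)[OF assms(2) obs(1)] by simp
  show "hneg C g \<cdot> f = hneg C (g \<cdot> f)"
    using hneg_unique[OF gf comp[OF assms(1) ng]] add_comp[OF assms(1,2) ng]
      hadd_hneg[OF assms(2)] comp_zero(2)[OF assms(1) obs(2)] by simp
qed

lemma comp_hsub:
  assumes "f \<in> Hom C X Y" "f' \<in> Hom C X Y" "g \<in> Hom C Y Z"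
  shows "g \<cdot> hsub C f f' = hsub C (g \<cdot> f) (g \<cdot> f')"
  unfolding hsub_def using comp_add[OF assms(1) hneg_Hom[OF assms(2)] assms(3)]
    comp_hneg(1)[OF assms(2,3)] by simp

lemma hsub_comp:
  assumes "f \<in> Hom C X Y" "g \<in> Hom C Y Z" "g' \<in> Hom C Y Z"
  shows "hsub C g g' \<cdot> f = hsub C (g \<cdot> f) (g' \<cdot> f)"
  unfolding hsub_def using add_comp[OF assms(1,2) hneg_Hom[OF assms(3)]]
    comp_hneg(2)[OF assms(1,3)] by simp

lemma hneg_eq_zeroD:
  "f \<in> Hom C X Y \<Longrightarrow> hneg C f = hzero C X Y \<Longrightarrow> f = hzero C X Y"
  using hadd_hneg(1) hadd_zero(1) by metis

lemma comp_eq_zero_if_hneg: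
  assumes "f \<in> Hom C X Y" "g \<in> Hom C Y Z" "hneg C g \<cdot> f = hzero C X Z"
  shows "g \<cdot> f = hzero C X Z"
  using assms comp_hneg hneg_eq_zeroD comp by metis

lemma zero_object_if_ident:
  assumes "Z \<in> Obj C" "Ident C Z = hzero C Z Z"
  shows "zero_object C Z"
proof -
  have "f = hzero C Z X" if "f \<in> Hom C Z X" for f X
    using comp_ident[OF that] comp_zero(1)[OF that assms(1)] assms(2) by simp
  moreover have "f = hzero C X Z" if "f \<in> Hom C X Z" for f X
    using ident_comp[OF that] comp_zero(2)[OF that assms(1)] assms(2) by simp
  ultimately show ?thesis
    unfolding zero_object_def using assms(1) hzero_Hom by metis
qed

lemma zero_objectD:
  assumes "zero_object C Z"
  shows "Z \<in> Obj C" "f \<in> Hom C Z X \<Longrightarrow> f = hzero C Z X" "f \<in> Hom C X Z \<Longrightarrow> f = hzero C X Z"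
proof -
  show Z: "Z \<in> Obj C" using assms by (simp add: zero_object_def)
  show "f \<in> Hom C Z X \<Longrightarrow> f = hzero C Z X" "f \<in> Hom C X Z \<Longrightarrow> f = hzero C X Z"
    using assms Z Hom_objs hzero_Hom unfolding zero_object_def by metis+
qed

lemma zero_object_empty_coproduct: "zero_object C Z \<Longrightarrow> is_coproduct C {} X Z \<iota>"
  unfolding zero_object_def is_coproduct_def by simp

lemma zero_object_exists: "\<exists>Z. zero_object C Z"
proof -
  obtain Z \<iota> where Z: "is_coproduct C ({} :: nat set) (\<lambda>_. undefined) Z \<iota>"
    using finite_coproducts[of "{}" "\<lambda>_. undefined"] by auto
  have "Z \<in> Obj C" using coproductD[OF Z] by simp
  moreover have "Ident C Z = hzero C Z Z"
    using coproduct_eqI[OF Z ident hzero_Hom] calculation by blast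
  ultimately show ?thesis using zero_object_if_ident by blast
qed

lemma coproduct_projections:
  assumes cop: "is_coproduct C I X P \<iota>"
  shows "\<exists>p. \<forall>i \<in> I. p i \<in> Hom C P (X i) \<and> p i \<cdot> \<iota> i = Ident C (X i) \<and>
    (\<forall>j \<in> I. j \<noteq> i \<longrightarrow> p i \<cdot> \<iota> j = hzero C (X j) (X i))"
proof -
  note cD = coproductD[OF cop]
  have "\<exists>p. p \<in> Hom C P (X i) \<and>
      (\<forall>j \<in> I. p \<cdot> \<iota> j = (if j = i then Ident C (X i) else hzero C (X j) (X i)))" if i: "i \<in> I" for i
  proof -
    have "(if j = i then Ident C (X i) else hzero C (X j) (X i)) \<in> Hom C (X j) (X i)" if "j \<in> I" for j
      using cD i that ident hzero_Hom by auto
    then show ?thesis by (rule coproduct_map_ex[OF cop cD(2)[OF i]])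
  qed
  then have "\<forall>i \<in> I. \<exists>p. p \<in> Hom C P (X i) \<and>
      (\<forall>j \<in> I. p \<cdot> \<iota> j = (if j = i then Ident C (X i) else hzero C (X j) (X i)))" by blast
  from bchoice[OF this] obtain p where "\<forall>i \<in> I. p i \<in> Hom C P (X i) \<and>
      (\<forall>j \<in> I. p i \<cdot> \<iota> j = (if j = i then Ident C (X i) else hzero C (X j) (X i)))" ..
  then show ?thesis by (intro exI[of _ p]) simp
qed

end

section \<open>Triangulated categories\<close>

definition quasi_inverse ::
  "('o, 'm, 'x) category_scheme \<Rightarrow> ('p, 'n, 'y) category_scheme \<Rightarrow>
   ('o, 'm, 'p, 'n) ftr \<Rightarrow> ('p, 'n, 'o, 'm) ftr \<Rightarrow> bool" where
  "quasi_inverse A B F G \<longleftrightarrow> is_functor B A G \<and>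
     (\<exists>\<epsilon> \<eta>. natural_iso A A (comp_ftr G F) id_ftr \<epsilon> \<and> natural_iso B B (comp_ftr F G) id_ftr \<eta>)"

text \<open>
  Some quasi-inverse of \<open>\<Sigma>\<close>. It provides the negative shifts of an object, which are determined up to
  isomorphism.
\<close>

definition Desusp :: "('o, 'm, 'x) triangulated_scheme \<Rightarrow> ('o, 'm, 'o, 'm) ftr" where
  "Desusp T = (SOME G. quasi_inverse T T (Susp T) G)"

abbreviation desusp_ob :: "('o, 'm, 'x) triangulated_scheme \<Rightarrow> 'o \<Rightarrow> 'o" where
  "desusp_ob T \<equiv> on_ob (Desusp T)"

context triangulated_category
begin

lemma Susp_functor: "is_functor T T (Susp T)"
  using Susp_equivalence by (simp add: is_equivalence_def)

lemma Desusp: "quasi_inverse T T (Susp T) (Desusp T)"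
proof -
  have "\<exists>G. quasi_inverse T T (Susp T) G"
    using Susp_equivalence unfolding is_equivalence_def quasi_inverse_def by blast
  then show ?thesis unfolding Desusp_def by (rule someI_ex)
qed

lemma Desusp_functor: "is_functor T T (Desusp T)"
  using Desusp by (simp add: quasi_inverse_def)

sublocale S: is_functor T T "Susp T" by (rule Susp_functor)

lemma Susp_Desusp_adjoint:
  "is_right_adjoint T T (Susp T) (Desusp T)" "is_right_adjoint T T (Desusp T) (Susp T)"
  using Desusp Susp_functor equivalence_adjoint unfolding quasi_inverse_def by blast+

lemma isomorphic_Susp_Desusp: "X \<in> Obj T \<Longrightarrow> isomorphic T (susp_ob T (desusp_ob T X)) X"
  using Desusp unfolding quasi_inverse_def natural_iso_def isomorphic_def comp_ftr_def id_ftr_def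
  by auto

lemma isomorphic_Desusp_Susp: "X \<in> Obj T \<Longrightarrow> isomorphic T (desusp_ob T (susp_ob T X)) X"
  using Desusp unfolding quasi_inverse_def natural_iso_def isomorphic_def comp_ftr_def id_ftr_def
  by auto

lemma Susp_faithful:
  assumes "f \<in> Hom T X Y" "g \<in> Hom T X Y" "susp_ar T f = susp_ar T g"
  shows "f = g"
  using Desusp Susp_functor assms equivalence_faithful unfolding quasi_inverse_def by metis

lemma Susp_full:
  assumes "X \<in> Obj T" "Y \<in> Obj T" "k \<in> Hom T (susp_ob T X) (susp_ob T Y)"
  obtains f where "f \<in> Hom T X Y" "susp_ar T f = k"
proof -
  have "\<exists>f \<in> Hom T X Y. susp_ar T f = k"
    using Desusp Susp_functor assms equivalence_full unfolding quasi_inverse_def by metis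
  then show thesis using that by blast
qed

lemma Susp_zero_object:
  assumes "zero_object T Z"
  shows "zero_object T (susp_ob T Z)"
proof -
  have Z: "Z \<in> Obj T" and SZ: "susp_ob T Z \<in> Obj T" using zero_objectD[OF assms] S.ob by auto
  obtain f where f: "f \<in> Hom T Z Z" "susp_ar T f = hzero T (susp_ob T Z) (susp_ob T Z)"
    using Susp_full[OF Z Z hzero_Hom[OF SZ SZ]] .
  have "f = Ident T Z" using zero_objectD[OF assms] f ident Z by metis
  then show ?thesis using zero_object_if_ident[OF SZ] f S.map_ident[OF Z] by simp
qed

text \<open>
  Zero maps are those that factor through a zero object, and \<open>\<Sigma>\<close> preserves zero objects.
\<close>

lemma Susp_zero:
  assumes "X \<in> Obj T" "Y \<in> Obj T"
  shows "susp_ar T (hzero T X Y) = hzero T (susp_ob T X) (susp_ob T Y)"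
proof -
  obtain Z where Z: "zero_object T Z" using zero_object_exists by blast
  note ZO = zero_objectD(1)[OF Z]
  note z1 = hzero_Hom[OF assms(1) ZO] and z2 = hzero_Hom[OF ZO assms(2)]
  have "hzero T X Y = hzero T Z Y \<cdot> hzero T X Z" using comp_zero(1)[OF z2 assms(1)] by simp
  then have "susp_ar T (hzero T X Y) = susp_ar T (hzero T Z Y) \<cdot> susp_ar T (hzero T X Z)"
    using S.map_comp[OF z1 z2] by simp
  also have "\<dots> = susp_ar T (hzero T Z Y) \<cdot> hzero T (susp_ob T X) (susp_ob T Z)"
    using zero_objectD(3)[OF Susp_zero_object[OF Z] S.ar[OF z1]] by simp
  also have "\<dots> = hzero T (susp_ob T X) (susp_ob T Y)"
    using comp_zero(1)[OF S.ar[OF z2] S.ob[OF assms(1)]] .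
  finally show ?thesis .
qed

lemma exact_triangleD:
  assumes "exact_triangle T X Y Z a b c"
  shows "a \<in> Hom T X Y" "b \<in> Hom T Y Z" "c \<in> Hom T Z (susp_ob T X)"
    "X \<in> Obj T" "Y \<in> Obj T" "Z \<in> Obj T"
proof -
  show h: "a \<in> Hom T X Y" "b \<in> Hom T Y Z" "c \<in> Hom T Z (susp_ob T X)"
    using assms unfolding exact_triangle_def triangle_def by auto
  show "X \<in> Obj T" "Y \<in> Obj T" "Z \<in> Obj T" using Hom_objs[OF h(1)] Hom_objs[OF h(2)] by auto
qed

lemma rotate:
  assumes "exact_triangle T X Y Z a b c"
  shows "exact_triangle T Y Z (susp_ob T X) b c (hneg T (susp_ar T a))"
proof -
  have "triangle T X Y Z a b c" using assms unfolding exact_triangle_def by blast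
  from TR2[OF this] show ?thesis using assms by blast
qed

text \<open>
  The triangle \<open>X \<rightarrow> X \<rightarrow> 0\<close> maps to the given one, by the identity and \<open>a\<close>.
\<close>

lemma exact_comp_zero:
  assumes ex: "exact_triangle T X Y Z a b c"
  shows "b \<cdot> a = hzero T X Z"
proof -
  note eD = exact_triangleD[OF ex]
  obtain N where N: "zero_object T N" using zero_object_exists by blast
  note NO = zero_objectD(1)[OF N]
  have "a \<cdot> Ident T X = a \<cdot> Ident T X" ..
  then obtain w where w: "w \<in> Hom T N Z" "w \<cdot> hzero T X N = b \<cdot> a"
    using TR3[OF TR1_ident[OF eD(4) N] ex ident[OF eD(4)] eD(1)] by blast
  then show ?thesis using comp_zero(1)[OF w(1) eD(4)] by simp
qed

text \<open>
  Exactness of \<open>Hom(W, -)\<close> on triangles: compare the triangle with a rotation of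
  \<open>W \<rightarrow> W \<rightarrow> 0\<close>.
\<close>

lemma exact_lift:
  assumes ex: "exact_triangle T X Y Z a b c" and f: "f \<in> Hom T W Y" "b \<cdot> f = hzero T W Z"
  obtains g where "g \<in> Hom T W X" "a \<cdot> g = f"
proof -
  note eD = exact_triangleD[OF ex]
  have W: "W \<in> Obj T" using f Hom_objs by blast
  obtain N where N: "zero_object T N" using zero_object_exists by blast
  note NO = zero_objectD(1)[OF N]
  have z: "hzero T N Z \<in> Hom T N Z" using NO eD hzero_Hom by blast
  have sq: "hzero T N Z \<cdot> hzero T W N = b \<cdot> f"
    using comp_zero(1)[OF z W] f by simp
  obtain w where w: "w \<in> Hom T (susp_ob T W) (susp_ob T X)"
    and eq: "susp_ar T f \<cdot> hneg T (susp_ar T (Ident T W)) = hneg T (susp_ar T a) \<cdot> w"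
    using TR3[OF rotate[OF TR1_ident[OF W N]] rotate[OF ex] f(1) z sq] by blast
  obtain g where g: "g \<in> Hom T W X" "susp_ar T g = w" using Susp_full[OF W eD(4) w] .
  have ag: "a \<cdot> g \<in> Hom T W Y" using comp[OF g(1) eD(1)] .
  have "hneg T (susp_ar T f) = hneg T (susp_ar T (a \<cdot> g))"
    using eq comp_hneg(1)[OF ident[OF S.ob[OF W]] S.ar[OF f(1)]] comp_ident[OF S.ar[OF f(1)]]
      S.map_ident[OF W] comp_hneg(2)[OF w S.ar[OF eD(1)]] S.map_comp[OF g(1) eD(1)] g(2) by simp
  then have "susp_ar T f = susp_ar T (a \<cdot> g)"
    using hneg_hneg S.ar f(1) ag by metis
  then show thesis using that g Susp_faithful[OF f(1) ag] by simp
qed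

text \<open>
  Dually, compare the triangle with \<open>0 \<rightarrow> W \<rightarrow> W\<close>, which is exact since its rotation is
  \<open>W \<rightarrow> W \<rightarrow> \<Sigma>0\<close>.
\<close>

lemma exact_extend:
  assumes ex: "exact_triangle T X Y Z a b c" and f: "f \<in> Hom T Y W" "f \<cdot> a = hzero T X W"
  obtains g where "g \<in> Hom T Z W" "g \<cdot> b = f"
proof -
  note eD = exact_triangleD[OF ex]
  have W: "W \<in> Obj T" using f Hom_objs by blast
  obtain N where N: "zero_object T N" using zero_object_exists by blast
  note NO = zero_objectD(1)[OF N]
  note SO = Susp_zero_object[OF N]
  note SNO = zero_objectD(1)[OF SO]
  have z: "hzero T N W \<in> Hom T N W" using NO W hzero_Hom by blast
  have "hneg T (susp_ar T (hzero T N W)) = hzero T (susp_ob T N) (susp_ob T W)"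
    using zero_objectD(2)[OF SO] hneg_Hom[OF S.ar[OF z]] by blast
  moreover have "triangle T N W W (hzero T N W) (Ident T W) (hzero T W (susp_ob T N))"
    unfolding triangle_def using z ident[OF W] hzero_Hom[OF W SNO] by blast
  ultimately have ex0: "exact_triangle T N W W (hzero T N W) (Ident T W) (hzero T W (susp_ob T N))"
    using TR2 TR1_ident[OF W SO] by simp
  have z': "hzero T X N \<in> Hom T X N" using NO eD hzero_Hom by blast
  have "f \<cdot> a = hzero T N W \<cdot> hzero T X N" using comp_zero(1)[OF z eD(4)] f by simp
  then obtain w where w: "w \<in> Hom T Z W" "w \<cdot> b = Ident T W \<cdot> f"
    using TR3[OF ex ex0 z' f(1)] by blast
  then show thesis using that ident_comp[OF f(1)] by simp
qed

text \<open>Rotating backwards requires a desuspension of the third object.\<close>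

lemma rotate_back:
  assumes ex: "exact_triangle T X Y Z a b c" and W: "W \<in> Obj T" and iso: "isomorphic T (susp_ob T W) Z"
  shows "\<exists>a' c'. exact_triangle T W X Y a' a c'"
proof -
  note eD = exact_triangleD[OF ex]
  obtain v v' where v: "v \<in> Hom T (susp_ob T W) Z" and v': "v' \<in> Hom T Z (susp_ob T W)"
    and inv: "v' \<cdot> v = Ident T (susp_ob T W)" "v \<cdot> v' = Ident T Z"
    using iso unfolding isomorphic_iff by blast
  have cv: "c \<cdot> v \<in> Hom T (susp_ob T W) (susp_ob T X)" using comp[OF v eD(3)] .
  obtain a' where a': "a' \<in> Hom T W X" "susp_ar T a' = hneg T (c \<cdot> v)"
    using Susp_full[OF W eD(4) hneg_Hom[OF cv]] .
  have neg: "hneg T (susp_ar T a') = c \<cdot> v" using a' hneg_hneg[OF cv] by simp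
  have tri: "triangle T X Y (susp_ob T W) a (v' \<cdot> b) (c \<cdot> v)"
    unfolding triangle_def using eD cv v' comp by blast
  have "exact_triangle T X Y (susp_ob T W) a (v' \<cdot> b) (c \<cdot> v)"
  proof (rule TR1_iso[OF ex tri ident[OF eD(4)] ident[OF eD(5)] v'])
    show "iso_arr T (Ident T X)" "iso_arr T (Ident T Y)" using iso_arr_ident eD by blast+
    show "iso_arr T v'" using iso_arr_iff[OF v'] v inv by blast
    show "Ident T Y \<cdot> a = a \<cdot> Ident T X" using ident_comp[OF eD(1)] comp_ident[OF eD(1)] by simp
    show "v' \<cdot> b = (v' \<cdot> b) \<cdot> Ident T Y" using comp_ident[OF comp[OF eD(2) v']] by simp
    show "susp_ar T (Ident T X) \<cdot> c = (c \<cdot> v) \<cdot> v'"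
      using S.map_ident[OF eD(4)] ident_comp[OF eD(3)] comp_assoc[OF v' v eD(3)] inv
        comp_ident[OF eD(3)] by simp
  qed
  moreover have "triangle T W X Y a' a (v' \<cdot> b)"
    unfolding triangle_def using a' eD v' comp by blast
  ultimately have "exact_triangle T W X Y a' a (v' \<cdot> b)" using TR2[of W X Y] neg by simp
  then show ?thesis by blast
qed

lemma Susp_exact:
  "exact_triangle T X Y Z a b c \<Longrightarrow>
     \<exists>a b c. exact_triangle T (susp_ob T X) (susp_ob T Y) (susp_ob T Z) a b c"
  using rotate by blast

lemma Desusp_exact:
  assumes ex: "exact_triangle T X Y Z a b c"
  shows "\<exists>a b c. exact_triangle T (desusp_ob T X) (desusp_ob T Y) (desusp_ob T Z) a b c"
proof -
  interpret D: is_functor T T "Desusp T" by (rule Desusp_functor)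
  note eD = exact_triangleD[OF ex]
  show ?thesis
    using ex rotate_back isomorphic_Susp_Desusp D.ob eD(4-6) by meson
qed

lemma exact_cocone:
  assumes b: "b \<in> Hom T Y Z"
  obtains X a c where "exact_triangle T X Y Z a b c"
proof -
  interpret D: is_functor T T "Desusp T" by (rule Desusp_functor)
  obtain W c d where ex: "exact_triangle T Y Z W b c d" using TR1_cone[OF b] by blast
  note eD = exact_triangleD[OF ex]
  show thesis
    using that rotate_back[OF ex D.ob[OF eD(6)] isomorphic_Susp_Desusp[OF eD(6)]] by blast
qed

end

section \<open>Perfect objects\<close>

text \<open>
  Condition (PG2) by itself. In contrast to being a perfect generator, it is inherited by shifts and by
  coproducts.
\<close>

definition perfect_object :: "('o, 'm, 'x) triangulated_scheme \<Rightarrow> 'o \<Rightarrow> bool" where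
  "perfect_object T S \<longleftrightarrow> S \<in> Obj T \<and>
     (\<forall>X Y f P \<iota> Q \<kappa> h.
        is_coproduct T (UNIV :: nat set) X P \<iota> \<and> is_coproduct T (UNIV :: nat set) Y Q \<kappa> \<and>
        (\<forall>i. f i \<in> Hom T (X i) (Y i)) \<and>
        (\<forall>i. \<forall>g \<in> Hom T S (Y i). \<exists>k \<in> Hom T S (X i). f i \<cdot>\<^bsub>T\<^esub> k = g) \<and>
        h \<in> Hom T P Q \<and> (\<forall>i. h \<cdot>\<^bsub>T\<^esub> \<iota> i = \<kappa> i \<cdot>\<^bsub>T\<^esub> f i)
        \<longrightarrow> (\<forall>g \<in> Hom T S Q. \<exists>k \<in> Hom T S P. h \<cdot>\<^bsub>T\<^esub> k = g))"

lemma perfect_object_Obj: "perfect_object T S \<Longrightarrow> S \<in> Obj T"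
  by (simp add: perfect_object_def)

lemma perfect_objectD:
  assumes "perfect_object T S"
    and "is_coproduct T (UNIV :: nat set) X P \<iota>" "is_coproduct T (UNIV :: nat set) Y Q \<kappa>"
    and "\<And>i. f i \<in> Hom T (X i) (Y i)"
    and "\<And>i g. g \<in> Hom T S (Y i) \<Longrightarrow> \<exists>k \<in> Hom T S (X i). f i \<cdot>\<^bsub>T\<^esub> k = g"
    and "h \<in> Hom T P Q" "\<And>i. h \<cdot>\<^bsub>T\<^esub> \<iota> i = \<kappa> i \<cdot>\<^bsub>T\<^esub> f i"
    and "g \<in> Hom T S Q"
  shows "\<exists>k \<in> Hom T S P. h \<cdot>\<^bsub>T\<^esub> k = g"
proof (rule assms(1)[unfolded perfect_object_def, THEN conjunct2, rule_format, of X P \<iota> Y Q \<kappa> f h])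
  show "is_coproduct T UNIV X P \<iota> \<and> is_coproduct T UNIV Y Q \<kappa> \<and> (\<forall>i. f i \<in> Hom T (X i) (Y i)) \<and>
      (\<forall>i. \<forall>g \<in> Hom T S (Y i). \<exists>k \<in> Hom T S (X i). f i \<cdot>\<^bsub>T\<^esub> k = g) \<and>
      h \<in> Hom T P Q \<and> (\<forall>i. h \<cdot>\<^bsub>T\<^esub> \<iota> i = \<kappa> i \<cdot>\<^bsub>T\<^esub> f i)"
    by (intro conjI allI ballI assms(2-7))
qed (rule assms(8))

lemma perfect_generator_perfect_object:
  fixes T :: "('o, 'm, 'x) triangulated_scheme"
  assumes "triangulated_category T" "perfect_generator u T S"
  shows "perfect_object T S"
proof -
  interpret triangulated_category T by fact
  have PG2: "(\<lambda>g. h \<cdot>\<^bsub>T\<^esub> g) ` Hom T S P = Hom T S Q"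
    if "is_coproduct T (UNIV :: nat set) X P \<iota>" "is_coproduct T (UNIV :: nat set) Y Q \<kappa>"
      "\<forall>i. f i \<in> Hom T (X i) (Y i)" "\<forall>i. (\<lambda>g. f i \<cdot>\<^bsub>T\<^esub> g) ` Hom T S (X i) = Hom T S (Y i)"
      "h \<in> Hom T P Q" "\<forall>i. h \<cdot>\<^bsub>T\<^esub> \<iota> i = \<kappa> i \<cdot>\<^bsub>T\<^esub> f i"
    for X P \<iota> Y Q \<kappa> f h
    using assms(2)[unfolded perfect_generator_def, THEN conjunct2, THEN conjunct2, rule_format,
        of UNIV X P \<iota> Y Q \<kappa> f h] that by simp
  have img: "(\<lambda>g. f \<cdot>\<^bsub>T\<^esub> g) ` Hom T S X = Hom T S Y"
    if "f \<in> Hom T X Y" "\<forall>g \<in> Hom T S Y. \<exists>k \<in> Hom T S X. f \<cdot>\<^bsub>T\<^esub> k = g" for f X Y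
    using that comp by auto
  show ?thesis
    unfolding perfect_object_def
  proof (intro conjI allI impI ballI)
    show "S \<in> Obj T" using assms(2) by (simp add: perfect_generator_def)
    fix X Y f P \<iota> Q \<kappa> h g
    assume H: "is_coproduct T (UNIV :: nat set) X P \<iota> \<and> is_coproduct T (UNIV :: nat set) Y Q \<kappa> \<and>
        (\<forall>i. f i \<in> Hom T (X i) (Y i)) \<and>
        (\<forall>i. \<forall>g \<in> Hom T S (Y i). \<exists>k \<in> Hom T S (X i). f i \<cdot>\<^bsub>T\<^esub> k = g) \<and>
        h \<in> Hom T P Q \<and> (\<forall>i. h \<cdot>\<^bsub>T\<^esub> \<iota> i = \<kappa> i \<cdot>\<^bsub>T\<^esub> f i)" and g: "g \<in> Hom T S Q"
    then have "\<forall>i. (\<lambda>g. f i \<cdot>\<^bsub>T\<^esub> g) ` Hom T S (X i) = Hom T S (Y i)" using img by blast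
    with H PG2[of X P \<iota> Y Q \<kappa> f h] have "(\<lambda>g. h \<cdot>\<^bsub>T\<^esub> g) ` Hom T S P = Hom T S Q" by blast
    then show "\<exists>k \<in> Hom T S P. h \<cdot>\<^bsub>T\<^esub> k = g" using g by (metis imageE)
  qed
qed

context triangulated_category
begin

text \<open>
  Surjectivity on maps out of \<open>E S\<close> is surjectivity on maps out of \<open>S\<close> after applying the right
  adjoint of \<open>E\<close>, and the latter preserves coproducts if it has a right adjoint in turn.
\<close>

lemma perfect_object_left_adjoint:
  assumes adj: "is_right_adjoint T T E E'" and adj': "is_right_adjoint T T E' E''"
    and S: "perfect_object T S"
  shows "perfect_object T (on_ob E S)"
proof -
  interpret E: is_functor T T E using adj by (simp add: is_right_adjoint_def)
  interpret E': is_functor T T E' using adj by (simp add: is_right_adjoint_def)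
  note SO = perfect_object_Obj[OF S]
  obtain \<phi>' where bij': "\<forall>X \<in> Obj T. \<forall>Y \<in> Obj T.
        bij_betw (\<phi>' X Y) (Hom T (on_ob E X) Y) (Hom T X (on_ob E' Y))"
    and nat': "\<forall>X' \<in> Obj T. \<forall>X \<in> Obj T. \<forall>Y \<in> Obj T. \<forall>Y' \<in> Obj T.
        \<forall>a \<in> Hom T X' X. \<forall>g \<in> Hom T (on_ob E X) Y. \<forall>b \<in> Hom T Y Y'.
          \<phi>' X' Y' (b \<cdot> g \<cdot> on_ar E a) = on_ar E' b \<cdot> \<phi>' X Y g \<cdot> a"
    using adj unfolding is_right_adjoint_def by blast
  define \<phi> where "\<phi> = \<phi>' S"
  have bij: "bij_betw (\<phi> Y) (Hom T (on_ob E S) Y) (Hom T S (on_ob E' Y))" if "Y \<in> Obj T" for Y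
    using bij' that SO unfolding \<phi>_def by blast
  have \<phi>_Hom: "\<phi> Y g \<in> Hom T S (on_ob E' Y)" if "g \<in> Hom T (on_ob E S) Y" for g Y
    using bij_betwE[OF bij] that Hom_objs by blast
  have nat: "\<phi> Y' (b \<cdot> g) = on_ar E' b \<cdot> \<phi> Y g"
    if g: "g \<in> Hom T (on_ob E S) Y" and b: "b \<in> Hom T Y Y'" for b g Y Y'
  proof -
    have "\<phi> Y' (b \<cdot> g \<cdot> on_ar E (Ident T S)) = on_ar E' b \<cdot> \<phi> Y g \<cdot> Ident T S"
      unfolding \<phi>_def using nat' SO Hom_objs[OF b] ident[OF SO] g b by blast
    then show ?thesis using E.map_ident[OF SO] comp_ident[OF g] comp_ident[OF \<phi>_Hom[OF g]] by simp
  qed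
  show ?thesis
    unfolding perfect_object_def
  proof (intro conjI allI impI ballI)
    show "on_ob E S \<in> Obj T" using E.ob[OF SO] .
    fix X Y f P \<iota> Q \<kappa> h g
    assume H: "is_coproduct T (UNIV :: nat set) X P \<iota> \<and> is_coproduct T (UNIV :: nat set) Y Q \<kappa> \<and>
        (\<forall>i. f i \<in> Hom T (X i) (Y i)) \<and>
        (\<forall>i. \<forall>g \<in> Hom T (on_ob E S) (Y i). \<exists>k \<in> Hom T (on_ob E S) (X i). f i \<cdot> k = g) \<and>
        h \<in> Hom T P Q \<and> (\<forall>i. h \<cdot> \<iota> i = \<kappa> i \<cdot> f i)" and g: "g \<in> Hom T (on_ob E S) Q"
    then have cP: "is_coproduct T UNIV X P \<iota>" and cQ: "is_coproduct T UNIV Y Q \<kappa>"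
      and f: "\<And>i. f i \<in> Hom T (X i) (Y i)"
      and sur: "\<And>i g. g \<in> Hom T (on_ob E S) (Y i) \<Longrightarrow> \<exists>k \<in> Hom T (on_ob E S) (X i). f i \<cdot> k = g"
      and h: "h \<in> Hom T P Q" "\<And>i. h \<cdot> \<iota> i = \<kappa> i \<cdot> f i" by blast+
    note P = coproductD[OF cP] and Q = coproductD[OF cQ]
    have "\<exists>k \<in> Hom T S (on_ob E' P). on_ar E' h \<cdot> k = \<phi> Q g"
    proof (rule perfect_objectD[OF S left_adjoint_preserves_coproduct[OF adj' cP]
          left_adjoint_preserves_coproduct[OF adj' cQ]])
      show "on_ar E' (f i) \<in> Hom T ((on_ob E' \<circ> X) i) ((on_ob E' \<circ> Y) i)" for i
        using E'.ar[OF f] by simp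
      show "on_ar E' h \<in> Hom T (on_ob E' P) (on_ob E' Q)" using E'.ar[OF h(1)] .
      show "\<phi> Q g \<in> Hom T S (on_ob E' Q)" using \<phi>_Hom[OF g] .
      show "on_ar E' h \<cdot> (on_ar E' \<circ> \<iota>) i = (on_ar E' \<circ> \<kappa>) i \<cdot> on_ar E' (f i)" for i
        using E'.map_comp[OF P(3) h(1)] E'.map_comp[OF f Q(3)] h(2) by simp
      show "\<exists>k \<in> Hom T S ((on_ob E' \<circ> X) i). on_ar E' (f i) \<cdot> k = g'"
        if "g' \<in> Hom T S ((on_ob E' \<circ> Y) i)" for i g'
      proof -
        have "g' \<in> \<phi> (Y i) ` Hom T (on_ob E S) (Y i)"
          using that bij[OF Q(2)] by (simp add: bij_betw_def)
        then obtain g0 where g0: "g0 \<in> Hom T (on_ob E S) (Y i)" "g' = \<phi> (Y i) g0" by blast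
        obtain k where k: "k \<in> Hom T (on_ob E S) (X i)" "f i \<cdot> k = g0" using sur[OF g0(1)] by blast
        have "on_ar E' (f i) \<cdot> \<phi> (X i) k = g'" using nat[OF k(1) f] k g0 by simp
        then show ?thesis using \<phi>_Hom[OF k(1)] by auto
      qed
    qed
    then obtain k' where k': "k' \<in> Hom T S (on_ob E' P)" "on_ar E' h \<cdot> k' = \<phi> Q g" by blast
    have "k' \<in> \<phi> P ` Hom T (on_ob E S) P"
      using k'(1) bij[OF P(1)] by (simp add: bij_betw_def)
    then obtain k where k: "k \<in> Hom T (on_ob E S) P" "k' = \<phi> P k" by blast
    have "\<phi> Q (h \<cdot> k) = \<phi> Q g" using nat[OF k(1) h(1)] k k' by simp
    then have "h \<cdot> k = g"
      using bij[OF Q(1)] comp[OF k(1) h(1)] g by (auto simp: bij_betw_def inj_on_def)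
    then show "\<exists>k \<in> Hom T (on_ob E S) P. h \<cdot> k = g" using k by blast
  qed
qed

text \<open>
  A map out of \<open>S\<close> is a family of maps out of the \<open>R j\<close>, which can be lifted one at a time; that
  \<open>Hom(R j, X i) \<rightarrow> Hom(R j, Y i)\<close> is surjective holds since \<open>R j\<close> is a retract of \<open>S\<close>.
\<close>

lemma perfect_object_coproduct:
  assumes cop: "is_coproduct T J R S \<rho>" and R: "\<And>j. j \<in> J \<Longrightarrow> perfect_object T (R j)"
  shows "perfect_object T S"
  unfolding perfect_object_def
proof (intro conjI allI impI ballI)
  note cD = coproductD[OF cop]
  show "S \<in> Obj T" using cD by simp
  fix X Y f P \<iota> Q \<kappa> h g
  assume H: "is_coproduct T (UNIV :: nat set) X P \<iota> \<and> is_coproduct T (UNIV :: nat set) Y Q \<kappa> \<and>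
      (\<forall>i. f i \<in> Hom T (X i) (Y i)) \<and>
      (\<forall>i. \<forall>g \<in> Hom T S (Y i). \<exists>k \<in> Hom T S (X i). f i \<cdot> k = g) \<and>
      h \<in> Hom T P Q \<and> (\<forall>i. h \<cdot> \<iota> i = \<kappa> i \<cdot> f i)" and g: "g \<in> Hom T S Q"
  then have cP: "is_coproduct T UNIV X P \<iota>" and cQ: "is_coproduct T UNIV Y Q \<kappa>"
    and f: "\<And>i. f i \<in> Hom T (X i) (Y i)"
    and sur: "\<And>i g. g \<in> Hom T S (Y i) \<Longrightarrow> \<exists>k \<in> Hom T S (X i). f i \<cdot> k = g"
    and h: "h \<in> Hom T P Q" "\<And>i. h \<cdot> \<iota> i = \<kappa> i \<cdot> f i" by blast+
  from coproduct_projections[OF cop] obtain p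
    where p_all: "\<forall>j \<in> J. p j \<in> Hom T S (R j) \<and> p j \<cdot> \<rho> j = Ident T (R j) \<and>
      (\<forall>i \<in> J. i \<noteq> j \<longrightarrow> p j \<cdot> \<rho> i = hzero T (R i) (R j))" ..
  then have p: "p j \<in> Hom T S (R j)" "p j \<cdot> \<rho> j = Ident T (R j)" if "j \<in> J" for j
    using that by auto
  have "\<exists>k \<in> Hom T (R j) P. h \<cdot> k = g \<cdot> \<rho> j" if j: "j \<in> J" for j
  proof (rule perfect_objectD[OF R[OF j] cP cQ f _ h comp[OF cD(3)[OF j] g]])
    fix i g' assume g': "g' \<in> Hom T (R j) (Y i)"
    obtain k where k: "k \<in> Hom T S (X i)" "f i \<cdot> k = g' \<cdot> p j"
      using sur comp[OF p(1)[OF j] g'] by blast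
    have "f i \<cdot> k \<cdot> \<rho> j = g'"
      using comp_assoc[OF cD(3)[OF j] k(1) f] k
        retract_cancel_right[OF cD(3)[OF j] p(1)[OF j] p(2)[OF j] g'] by simp
    then show "\<exists>k \<in> Hom T (R j) (X i). f i \<cdot> k = g'" using comp[OF cD(3)[OF j] k(1)] by blast
  qed
  then have "\<forall>j \<in> J. \<exists>k. k \<in> Hom T (R j) P \<and> h \<cdot> k = g \<cdot> \<rho> j" by blast
  from bchoice[OF this] obtain k
    where k_all: "\<forall>j \<in> J. k j \<in> Hom T (R j) P \<and> h \<cdot> k j = g \<cdot> \<rho> j" ..
  then have k: "k j \<in> Hom T (R j) P" "h \<cdot> k j = g \<cdot> \<rho> j" if "j \<in> J" for j
    using that by auto
  obtain k' where k': "k' \<in> Hom T S P" "\<And>j. j \<in> J \<Longrightarrow> k' \<cdot> \<rho> j = k j"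
    using coproduct_map[OF cop coproductD(1)[OF cP] k(1)] by blast
  have "h \<cdot> k' = g"
  proof (rule coproduct_eqI[OF cop comp[OF k'(1) h(1)] g])
    fix j assume j: "j \<in> J"
    show "(h \<cdot> k') \<cdot> \<rho> j = g \<cdot> \<rho> j"
      using comp_assoc[OF cD(3)[OF j] k'(1) h(1)] k'(2)[OF j] k(2)[OF j] by simp
  qed
  then show "\<exists>k \<in> Hom T S P. h \<cdot> k = g" using k' by blast
qed

end

section \<open>Telescopes\<close>

locale cocomplete_triangulated = triangulated_category T
  for T :: "('o, 'm, 'x) triangulated_scheme" (structure) +
  fixes u :: "'u itself"
  assumes uncountable_universe: "uncountable (UNIV :: 'u set)"
    and loc_small: "locally_small u T"
    and has_coprods: "has_coproducts u T"
begin

lemma small_coprod: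
  assumes "small u I" "\<And>i. i \<in> I \<Longrightarrow> X i \<in> Obj T"
  shows "\<exists>P \<iota>. is_coproduct T I X P \<iota>"
  by (rule small_coproduct[OF has_coprods]) (use assms in auto)

lemma nat_coprod:
  assumes "\<And>i :: nat. X i \<in> Obj T"
  shows "\<exists>P \<iota>. is_coproduct T UNIV X P \<iota>"
  by (rule small_coprod[OF small_countable[OF uncountable_universe]]) (use assms in auto)

lemma small_Hom: "X \<in> Obj T \<Longrightarrow> Y \<in> Obj T \<Longrightarrow> small u (Hom T X Y)"
  using loc_small unfolding locally_small_def by blast

text \<open>
  This is how perfectness enters: each \<open>C i\<close> is covered by a coproduct of copies of \<open>S\<close>, so any
  map from \<open>S\<close> into the coproduct of the \<open>C i\<close> comes from the coproduct of these covers, which is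
  tested on the individual maps \<open>S \<rightarrow> C i\<close>.
\<close>

lemma perfect_detects_zero:
  assumes S: "perfect_object T S" and cop: "is_coproduct T (UNIV :: nat set) C P \<iota>"
    and e: "e \<in> Hom T P Z" and t: "t \<in> Hom T S P"
    and zero: "\<And>i f. f \<in> Hom T S (C i) \<Longrightarrow> e \<cdot> \<iota> i \<cdot> f = hzero T S Z"
  shows "e \<cdot> t = hzero T S Z"
proof -
  note SO = perfect_object_Obj[OF S]
  note cD = coproductD[OF cop]
  have "\<exists>W inc. is_coproduct T (Hom T S (C i)) (\<lambda>_. S) W inc" for i
    by (rule small_coprod[OF small_Hom[OF SO cD(2)[OF UNIV_I]] SO])
  then obtain W inc where W: "\<And>i. is_coproduct T (Hom T S (C i)) (\<lambda>_. S) (W i) (inc i)"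
    by metis
  have "\<exists>w. w \<in> Hom T (W i) (C i) \<and> (\<forall>f \<in> Hom T S (C i). w \<cdot> inc i f = f)" for i
    by (rule coproduct_map_ex[OF W]) (use cD in auto)
  then obtain w where w: "\<And>i. w i \<in> Hom T (W i) (C i)"
    "\<And>i f. f \<in> Hom T S (C i) \<Longrightarrow> w i \<cdot> inc i f = f" by metis
  obtain R \<rho> where R: "is_coproduct T (UNIV :: nat set) W R \<rho>"
    using nat_coprod[of W, OF coproductD(1)[OF W]] by blast
  have "\<exists>v. v \<in> Hom T R P \<and> (\<forall>i \<in> UNIV. v \<cdot> \<rho> i = \<iota> i \<cdot> w i)"
    using comp[OF w(1) cD(3)] by (intro coproduct_map_ex[OF R cD(1)]) blast
  then obtain v where v: "v \<in> Hom T R P" "\<And>i. v \<cdot> \<rho> i = \<iota> i \<cdot> w i" by blast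
  have "\<exists>k \<in> Hom T S R. v \<cdot> k = t"
  proof (rule perfect_objectD[OF S R cop w(1) _ v t])
    fix i g assume g: "g \<in> Hom T S (C i)"
    then show "\<exists>k \<in> Hom T S (W i). w i \<cdot> k = g" using w(2) coproductD(3)[OF W] by blast
  qed
  then obtain k where k: "k \<in> Hom T S R" "v \<cdot> k = t" by blast
  have ev: "e \<cdot> v \<in> Hom T R Z" using comp[OF v(1) e] .
  have ZO: "Z \<in> Obj T" and RO: "R \<in> Obj T" using Hom_objs ev by blast+
  have "e \<cdot> v = hzero T R Z"
  proof (rule coproduct_eqI[OF R ev hzero_Hom[OF RO ZO]])
    fix i
    note \<rho> = coproductD(3)[OF R UNIV_I, of i]
    have "(e \<cdot> v) \<cdot> \<rho> i = hzero T (W i) Z"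
    proof (rule coproduct_eqI[OF W comp[OF \<rho> ev] hzero_Hom[OF coproductD(1)[OF W] ZO]])
      fix f assume f: "f \<in> Hom T S (C i)"
      note inc = coproductD(3)[OF W f]
      have "((e \<cdot> v) \<cdot> \<rho> i) \<cdot> inc i f = e \<cdot> \<iota> i \<cdot> f"
        using comp_assoc[OF \<rho> v(1) e] comp_assoc[OF inc comp[OF \<rho> v(1)] e] v(2)
          comp_assoc[OF inc w(1) cD(3)] w(2)[OF f] by simp
      then show "((e \<cdot> v) \<cdot> \<rho> i) \<cdot> inc i f = hzero T (W i) Z \<cdot> inc i f"
        using zero[OF f] comp_zero(2)[OF inc ZO] by simp
    qed
    then show "(e \<cdot> v) \<cdot> \<rho> i = hzero T R Z \<cdot> \<rho> i" using comp_zero(2)[OF \<rho> ZO] by simp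
  qed
  then show ?thesis
    using comp_assoc[OF k(1) v(1) e] k comp_zero(2)[OF k(1) ZO] by simp
qed

text \<open>
  With \<open>D i \<rightarrow> B i\<close> the cocone of \<open>b i\<close>, a map into \<open>\<Coprod>B i\<close> killed by \<open>\<Coprod>b i\<close> lifts to \<open>\<Coprod>D i\<close>: the
  maps \<open>C i \<rightarrow> E\<close> into the cone of \<open>\<Coprod>D i \<rightarrow> \<Coprod>B i\<close> show that it is killed by \<open>\<Coprod>B i \<rightarrow> E\<close>. The lift is
  then subject to the previous lemma.
\<close>

lemma perfect_detects_zero_on_kernel:
  assumes S: "perfect_object T S"
    and B: "is_coproduct T (UNIV :: nat set) B P \<kappa>" and C: "is_coproduct T (UNIV :: nat set) C Q \<iota>"
    and b: "\<And>i. b i \<in> Hom T (B i) (C i)"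
    and b': "b' \<in> Hom T P Q" "\<And>i. b' \<cdot> \<kappa> i = \<iota> i \<cdot> b i"
    and e: "e \<in> Hom T P Z" and t: "t \<in> Hom T S P" "b' \<cdot> t = hzero T S Q"
    and zero: "\<And>i f. f \<in> Hom T S (B i) \<Longrightarrow> b i \<cdot> f = hzero T S (C i) \<Longrightarrow>
      e \<cdot> \<kappa> i \<cdot> f = hzero T S Z"
  shows "e \<cdot> t = hzero T S Z"
proof -
  note SO = perfect_object_Obj[OF S]
  note BD = coproductD[OF B] and CD = coproductD[OF C]
  have "\<exists>D d c. exact_triangle T D (B i) (C i) d (b i) c" for i
    using exact_cocone[OF b] by metis
  then obtain D d c where ex: "\<And>i. exact_triangle T (D i) (B i) (C i) (d i) (b i) (c i)" by metis
  note eD = exact_triangleD[OF ex]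
  obtain R \<rho> where R: "is_coproduct T (UNIV :: nat set) D R \<rho>" using nat_coprod[of D, OF eD(4)] by blast
  note RD = coproductD[OF R]
  have "\<exists>v. v \<in> Hom T R P \<and> (\<forall>i \<in> UNIV. v \<cdot> \<rho> i = \<kappa> i \<cdot> d i)"
    using comp[OF eD(1) BD(3)] by (intro coproduct_map_ex[OF R BD(1)]) blast
  then obtain v where v: "v \<in> Hom T R P" "\<And>i. v \<cdot> \<rho> i = \<kappa> i \<cdot> d i" by blast
  obtain E q r where E: "exact_triangle T R P E v q r" using TR1_cone[OF v(1)] by blast
  note ED = exact_triangleD[OF E]
  have "\<exists>\<theta>. \<theta> \<in> Hom T (C i) E \<and> \<theta> \<cdot> b i = q \<cdot> \<kappa> i" for i
  proof -
    have q\<kappa>: "q \<cdot> \<kappa> i \<in> Hom T (B i) E" using comp[OF BD(3) ED(2)] by simp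
    have "(q \<cdot> \<kappa> i) \<cdot> d i = (q \<cdot> v) \<cdot> \<rho> i"
      using comp_assoc[OF eD(1) BD(3) ED(2)] comp_assoc[OF RD(3) v(1) ED(2)] v(2) by simp
    then have "(q \<cdot> \<kappa> i) \<cdot> d i = hzero T (D i) E"
      using exact_comp_zero[OF E] comp_zero(2)[OF RD(3) ED(6)] by simp
    then show ?thesis using exact_extend[OF ex q\<kappa>] by blast
  qed
  then obtain \<theta> where \<theta>: "\<And>i. \<theta> i \<in> Hom T (C i) E" "\<And>i. \<theta> i \<cdot> b i = q \<cdot> \<kappa> i" by metis
  obtain \<Theta> where \<Theta>: "\<Theta> \<in> Hom T Q E" "\<And>i. \<Theta> \<cdot> \<iota> i = \<theta> i"
    using coproduct_map_ex[OF C ED(6) \<theta>(1)] by blast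
  have "\<Theta> \<cdot> b' = q"
  proof (rule coproduct_eqI[OF B comp[OF b'(1) \<Theta>(1)] ED(2)])
    show "(\<Theta> \<cdot> b') \<cdot> \<kappa> i = q \<cdot> \<kappa> i" for i
      using comp_assoc[OF BD(3) b'(1) \<Theta>(1)] b'(2) comp_assoc[OF b CD(3) \<Theta>(1)] \<Theta>(2) \<theta>(2) by simp
  qed
  then have "q \<cdot> t = hzero T S E"
    using comp_assoc[OF t(1) b'(1) \<Theta>(1)] t(2) comp_zero(1)[OF \<Theta>(1) SO] by simp
  then obtain t' where t': "t' \<in> Hom T S R" "v \<cdot> t' = t" using exact_lift[OF E t(1)] by blast
  have "(e \<cdot> v) \<cdot> t' = hzero T S Z"
  proof (rule perfect_detects_zero[OF S R comp[OF v(1) e] t'(1)])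
    fix i f assume f: "f \<in> Hom T S (D i)"
    have df: "d i \<cdot> f \<in> Hom T S (B i)" using comp[OF f eD(1)] .
    have "b i \<cdot> d i \<cdot> f = hzero T S (C i)"
      using comp_assoc[OF f eD(1,2)] exact_comp_zero[OF ex] comp_zero(2)[OF f eD(6)] by simp
    then have "e \<cdot> \<kappa> i \<cdot> d i \<cdot> f = hzero T S Z" using zero[OF df] by simp
    moreover have "(e \<cdot> v) \<cdot> \<rho> i \<cdot> f = e \<cdot> \<kappa> i \<cdot> d i \<cdot> f"
      using comp_assoc[OF comp[OF f RD(3)] v(1) e] comp_assoc[OF f RD(3) v(1)] v(2)
        comp_assoc[OF f eD(1) BD(3)] by simp
    ultimately show "(e \<cdot> v) \<cdot> \<rho> i \<cdot> f = hzero T S Z" by simp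
  qed
  then show ?thesis using comp_assoc[OF t'(1) v(1) e] t' by simp
qed

end

context cocomplete_triangulated
begin

text \<open>
  By \<open>image\<close> and \<open>kernel\<close>, the groups \<open>Hom(S, X\<^sub>i)\<close> are, for \<open>i \<ge> 1\<close>, direct sums of a constant
  sequence, the image of \<open>Hom(S, X\<^sub>0)\<close>, and a sequence with zero transition maps. For both kinds of
  sequence, \<open>1 - shift\<close> on the direct sum is injective with the colimit as its cokernel. This proof
  carries the splitting over to \<open>\<T>\<close>, where coproducts are not seen termwise by \<open>S\<close>: after one
  shift, a map \<open>S \<rightarrow> P\<close> factors through the coproduct \<open>P0\<close> of countably many copies of \<open>X\<^sub>0\<close>, and
  there \<open>1 - shift\<close> has an explicit left inverse.
\<close>

lemma telescope:
  assumes S: "perfect_object T S" and P: "is_coproduct T (UNIV :: nat set) X P \<iota>"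
    and \<phi>: "\<And>i. \<phi> i \<in> Hom T (X i) (X (Suc i))"
    and sh: "sh \<in> Hom T P P" "\<And>i. sh \<cdot> \<iota> i = \<iota> (Suc i) \<cdot> \<phi> i"
    and x: "x 0 = Ident T (X 0)" "\<And>i. x (Suc i) = \<phi> i \<cdot> x i"
    and image: "\<And>i f. f \<in> Hom T S (X i) \<Longrightarrow> \<exists>g \<in> Hom T S (X 0). \<phi> i \<cdot> f = x (Suc i) \<cdot> g"
    and kernel: "\<And>i g. g \<in> Hom T S (X 0) \<Longrightarrow> x (Suc i) \<cdot> g = hzero T S (X (Suc i)) \<Longrightarrow>
      \<phi> 0 \<cdot> g = hzero T S (X (Suc 0))"
    and f: "f \<in> Hom T S P"
  shows "sh \<cdot> f = f \<Longrightarrow> f = hzero T S P"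
    and "\<exists>g \<in> Hom T S (X 0). \<exists>h \<in> Hom T S P.
      f = hadd T (\<iota> (Suc 0) \<cdot> \<phi> 0 \<cdot> g) (hsub T (Ident T P) sh \<cdot> h)"
proof -
  note SO = perfect_object_Obj[OF S]
  note PO = coproductD(1)[OF P] and XO = coproductD(2)[OF P UNIV_I] and \<iota> = coproductD(3)[OF P UNIV_I]
  have x_Hom: "x i \<in> Hom T (X 0) (X i)" for i
    by (induction i) (use x ident[OF XO] comp[OF _ \<phi>] in auto)
  obtain P0 \<kappa> where P0: "is_coproduct T (UNIV :: nat set) (\<lambda>_. X 0) P0 \<kappa>"
    using nat_coprod[of "\<lambda>_. X 0", OF XO] by blast
  note \<kappa> = coproductD(3)[OF P0 UNIV_I]
  have \<iota>x: "\<iota> i \<cdot> x i \<in> Hom T (X 0) P" for i using comp[OF x_Hom \<iota>] .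
  obtain fold where fold: "fold \<in> Hom T P0 (X 0)" "\<And>i. fold \<cdot> \<kappa> i = Ident T (X 0)"
    using coproduct_map_ex[OF P0 XO ident[OF XO]] by blast
  obtain sh0 where sh0: "sh0 \<in> Hom T P0 P0" "\<And>i. sh0 \<cdot> \<kappa> i = \<kappa> (Suc i)"
    using coproduct_map_ex[OF P0 coproductD(1)[OF P0] \<kappa>, of Suc] by blast
  obtain m0 where m0: "m0 \<in> Hom T P0 P" "\<And>i. m0 \<cdot> \<kappa> i = \<iota> i \<cdot> x i"
    using coproduct_map_ex[OF P0 PO \<iota>x, of "\<lambda>i. i"] by blast
  obtain m where m: "m \<in> Hom T P0 P" "\<And>i. m \<cdot> \<kappa> i = \<iota> (Suc i) \<cdot> x (Suc i)"
    using coproduct_map_ex[OF P0 PO \<iota>x, of Suc] by blast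
  have m_sh: "m = sh \<cdot> m0"
  proof (rule coproduct_eqI[OF P0 m(1) comp[OF m0(1) sh(1)]])
    fix i
    have "(sh \<cdot> m0) \<cdot> \<kappa> i = (sh \<cdot> \<iota> i) \<cdot> x i"
      using comp_assoc[OF \<kappa> m0(1) sh(1)] m0(2) comp_assoc[OF x_Hom \<iota> sh(1)] by simp
    also have "\<dots> = \<iota> (Suc i) \<cdot> x (Suc i)"
      using sh(2) comp_assoc[OF x_Hom \<phi> \<iota>] x(2) by simp
    finally show "m \<cdot> \<kappa> i = (sh \<cdot> m0) \<cdot> \<kappa> i" using m(2) by simp
  qed
  have m_sh0: "m = m0 \<cdot> sh0"
  proof (rule coproduct_eqI[OF P0 m(1) comp[OF sh0(1) m0(1)]])
    show "m \<cdot> \<kappa> i = (m0 \<cdot> sh0) \<cdot> \<kappa> i" for i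
      using comp_assoc[OF \<kappa> sh0(1) m0(1)] sh0(2) m0(2) m(2) by simp
  qed

  \<comment> \<open>The map \<open>e'\<close> is \<open>m\<close> after the left inverse \<open>\<kappa> i \<mapsto> - (\<kappa> 0 + \<dots> + \<kappa> (i - 1))\<close> of \<open>1 - sh0\<close>.\<close>
  define e where "e = rec_nat (hzero T (X 0) P) (\<lambda>i ei. hsub T ei (\<iota> (Suc i) \<cdot> x (Suc i)))"
  have e_simps: "e 0 = hzero T (X 0) P" "\<And>i. e (Suc i) = hsub T (e i) (\<iota> (Suc i) \<cdot> x (Suc i))"
    by (simp_all add: e_def)
  have e_Hom: "e i \<in> Hom T (X 0) P" for i
    by (induction i) (use e_simps hzero_Hom[OF XO PO] hsub_Hom[OF _ \<iota>x] in auto)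
  obtain e' where e': "e' \<in> Hom T P0 P" "\<And>i. e' \<cdot> \<kappa> i = e i"
    using coproduct_map_ex[OF P0 PO e_Hom, of "\<lambda>i. i"] by blast
  define D0 where "D0 = hsub T (Ident T P0) sh0"
  define D where "D = hsub T (Ident T P) sh"
  note P0O = coproductD(1)[OF P0]
  have D0: "D0 \<in> Hom T P0 P0" unfolding D0_def using hsub_Hom[OF ident[OF P0O] sh0(1)] .
  have D: "D \<in> Hom T P P" unfolding D_def using hsub_Hom[OF ident[OF PO] sh(1)] .
  have D0_\<kappa>: "D0 \<cdot> \<kappa> i = hsub T (\<kappa> i) (\<kappa> (Suc i))" for i
    unfolding D0_def using hsub_comp[OF \<kappa> ident[OF P0O] sh0(1)] ident_comp[OF \<kappa>] sh0(2) by simp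
  have D_comp: "D \<cdot> k = hsub T k (sh \<cdot> k)" if "k \<in> Hom T W P" for k W
    unfolding D_def using hsub_comp[OF that ident[OF PO] sh(1)] ident_comp[OF that] by simp
  have D_\<iota>x: "D \<cdot> \<iota> i \<cdot> x i = hsub T (\<iota> i \<cdot> x i) (\<iota> (Suc i) \<cdot> x (Suc i))" for i
    using D_comp[OF \<iota>x] comp_assoc[OF x_Hom \<iota> sh(1)] sh(2) comp_assoc[OF x_Hom \<phi> \<iota>] x(2) by simp
  have eD0: "e' \<cdot> D0 = m"
  proof (rule coproduct_eqI[OF P0 comp[OF D0 e'(1)] m(1)])
    show "(e' \<cdot> D0) \<cdot> \<kappa> i = m \<cdot> \<kappa> i" for i
      using comp_assoc[OF \<kappa> D0 e'(1)] D0_\<kappa> comp_hsub[OF \<kappa> \<kappa> e'(1)] e'(2) e_simps(2)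
        hsub_hsub[OF e_Hom \<iota>x] m(2) by simp
  qed
  define a where "a = \<iota> (Suc 0) \<cdot> \<phi> 0"
  have a: "a \<in> Hom T (X 0) P" unfolding a_def using comp[OF \<phi> \<iota>] .
  have a_x: "a = \<iota> (Suc 0) \<cdot> x (Suc 0)" unfolding a_def using x comp_ident[OF \<phi>] by simp
  have De: "hadd T a (D \<cdot> e i) = \<iota> (Suc i) \<cdot> x (Suc i)" for i
  proof (induction i)
    case 0
    show ?case using e_simps(1) comp_zero(1)[OF D XO] hadd_zero(1)[OF a] a_x by simp
  next
    case (Suc i)
    have "D \<cdot> e (Suc i) = hsub T (D \<cdot> e i) (hsub T (hadd T a (D \<cdot> e i)) (\<iota> (Suc (Suc i)) \<cdot> x (Suc (Suc i))))"
      using e_simps(2) comp_hsub[OF e_Hom \<iota>x D] D_\<iota>x Suc by simp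
    then show ?case using hadd_hsub_hsub[OF a comp[OF e_Hom D] \<iota>x] by simp
  qed
  have m_eq: "m = hadd T (a \<cdot> fold) (D \<cdot> e')"
  proof (rule coproduct_eqI[OF P0 m(1) hadd_Hom[OF comp[OF fold(1) a] comp[OF e'(1) D]]])
    show "m \<cdot> \<kappa> i = hadd T (a \<cdot> fold) (D \<cdot> e') \<cdot> \<kappa> i" for i
      using add_comp[OF \<kappa> comp[OF fold(1) a] comp[OF e'(1) D]] comp_assoc[OF \<kappa> fold(1) a]
        comp_assoc[OF \<kappa> e'(1) D] fold(2) e'(2) comp_ident[OF a] De m(2) by simp
  qed

  \<comment> \<open>Factoring through \<open>m\<close> means to be killed by its cone, and this can be tested on the maps
    \<open>S \<rightarrow> X i\<close>.\<close>
  have sh_factors: "\<exists>g \<in> Hom T S P0. sh \<cdot> f = m \<cdot> g"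
  proof -
    obtain Z q r where ex: "exact_triangle T P0 P Z m q r" using TR1_cone[OF m(1)] by blast
    note exD = exact_triangleD[OF ex]
    have "(q \<cdot> sh) \<cdot> f = hzero T S Z"
    proof (rule perfect_detects_zero[OF S P comp[OF sh(1) exD(2)] f])
      fix i k assume k: "k \<in> Hom T S (X i)"
      obtain g where g: "g \<in> Hom T S (X 0)" "\<phi> i \<cdot> k = x (Suc i) \<cdot> g" using image[OF k] by blast
      have "sh \<cdot> \<iota> i \<cdot> k = m \<cdot> \<kappa> i \<cdot> g"
        using comp_assoc[OF k \<iota> sh(1)] sh(2) comp_assoc[OF k \<phi> \<iota>] g
          comp_assoc[OF g(1) x_Hom \<iota>] m(2) comp_assoc[OF g(1) \<kappa> m(1)] by metis
      then have "(q \<cdot> sh) \<cdot> \<iota> i \<cdot> k = (q \<cdot> m) \<cdot> \<kappa> i \<cdot> g"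
        using comp_assoc[OF comp[OF k \<iota>] sh(1) exD(2)]
          comp_assoc[OF comp[OF g(1) \<kappa>] m(1) exD(2)] by simp
      then show "(q \<cdot> sh) \<cdot> \<iota> i \<cdot> k = hzero T S Z"
        using exact_comp_zero[OF ex] comp_zero(2)[OF comp[OF g(1) \<kappa>] exD(6)] by simp
    qed
    then have "q \<cdot> sh \<cdot> f = hzero T S Z" using comp_assoc[OF f sh(1) exD(2)] by simp
    then show ?thesis using exact_lift[OF ex comp[OF f sh(1)]] by metis
  qed
  then obtain g where g: "g \<in> Hom T S P0" "sh \<cdot> f = m \<cdot> g" by blast

  show "f = hzero T S P" if fixed: "sh \<cdot> f = f"
  proof -
    \<comment> \<open>Passing from \<open>m\<close> to \<open>m0\<close> makes \<open>D0 \<cdot> g1\<close> a map into copies of \<open>X 0\<close> killed by the coproduct of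
      the maps \<open>x i\<close>.\<close>
    define g1 where "g1 = sh0 \<cdot> g"
    have g1: "g1 \<in> Hom T S P0" unfolding g1_def using comp[OF g(1) sh0(1)] .
    have f_eq: "f = m0 \<cdot> g1"
      using g fixed m_sh0 comp_assoc[OF g(1) sh0(1) m0(1)] unfolding g1_def by simp
    have mg1: "m \<cdot> g1 = f"
      using m_sh comp_assoc[OF g1 m0(1) sh(1)] f_eq fixed by simp
    have t: "D0 \<cdot> g1 \<in> Hom T S P0" using comp[OF g1 D0] .
    have "m0 \<cdot> D0 = hsub T m0 m"
      unfolding D0_def using comp_hsub[OF ident[OF P0O] sh0(1) m0(1)] comp_ident[OF m0(1)] m_sh0 by simp
    then have "m0 \<cdot> D0 \<cdot> g1 = hzero T S P"
      using comp_assoc[OF g1 D0 m0(1)] hsub_comp[OF g1 m0(1) m(1)] mg1 f_eq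
        hsub_self[OF comp[OF g1 m0(1)]] by simp
    then have "e' \<cdot> D0 \<cdot> g1 = hzero T S P"
    proof (rule perfect_detects_zero_on_kernel[OF S P0 P x_Hom m0 e'(1) t])
      fix i k assume k: "k \<in> Hom T S (X 0)" and xk: "x i \<cdot> k = hzero T S (X i)"
      have "e i \<cdot> k = hzero T S P"
      proof (cases i)
        case 0
        then show ?thesis using e_simps(1) comp_zero(2)[OF k PO] by simp
      next
        case (Suc n)
        then have k0: "\<phi> 0 \<cdot> k = hzero T S (X (Suc 0))" using kernel[OF k] xk by simp
        have xk': "x (Suc j) \<cdot> k = hzero T S (X (Suc j))" for j
        proof (induction j)
          case 0
          show ?case using k0 x comp_ident[OF \<phi>] by simp
        next
          case (Suc j)
          then show ?case
            using x(2)[of "Suc j"] comp_assoc[OF k x_Hom \<phi>] comp_zero(1)[OF \<phi> SO] by simp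
        qed
        show ?thesis
        proof (induction i)
          case 0
          show ?case using e_simps(1) comp_zero(2)[OF k PO] by simp
        next
          case (Suc i)
          have "(\<iota> (Suc i) \<cdot> x (Suc i)) \<cdot> k = hzero T S P"
            using comp_assoc[OF k x_Hom \<iota>] xk' comp_zero(1)[OF \<iota> SO] by simp
          then show ?case
            using e_simps(2) hsub_comp[OF k e_Hom \<iota>x] Suc hsub_self[OF hzero_Hom[OF SO PO]] by simp
        qed
      qed
      then show "e' \<cdot> \<kappa> i \<cdot> k = hzero T S P" using comp_assoc[OF k \<kappa> e'(1)] e'(2) by simp
    qed
    then have "m \<cdot> g1 = hzero T S P" using eD0 comp_assoc[OF g1 D0 e'(1)] by simp
    then show ?thesis using mg1 by simp
  qed

  have fg: "fold \<cdot> g \<in> Hom T S (X 0)" using comp[OF g(1) fold(1)] .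
  have eg: "e' \<cdot> g \<in> Hom T S P" using comp[OF g(1) e'(1)] .
  have afg: "a \<cdot> fold \<cdot> g \<in> Hom T S P" using comp[OF fg a] .
  have "sh \<cdot> f = hadd T (a \<cdot> fold \<cdot> g) (D \<cdot> e' \<cdot> g)"
    using g m_eq add_comp[OF g(1) comp[OF fold(1) a] comp[OF e'(1) D]]
      comp_assoc[OF g(1) fold(1) a] comp_assoc[OF g(1) e'(1) D] by simp
  moreover have "f = hadd T (sh \<cdot> f) (D \<cdot> f)"
    using hadd_hsub[OF f comp[OF f sh(1)]] D_comp[OF f]
      hadd_commute[OF comp[OF f sh(1)] comp[OF f D]] by simp
  ultimately have "f = hadd T (a \<cdot> fold \<cdot> g) (D \<cdot> hadd T (e' \<cdot> g) f)"
    using hadd_assoc[OF afg comp[OF eg D] comp[OF f D]] comp_add[OF eg f D] by simp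
  moreover have "a \<cdot> fold \<cdot> g = \<iota> (Suc 0) \<cdot> \<phi> 0 \<cdot> fold \<cdot> g"
    unfolding a_def using comp_assoc[OF fg \<phi> \<iota>] .
  ultimately have "f = hadd T (\<iota> (Suc 0) \<cdot> \<phi> 0 \<cdot> fold \<cdot> g) (hsub T (Ident T P) sh \<cdot> hadd T (e' \<cdot> g) f)"
    unfolding D_def by simp
  then show "\<exists>g \<in> Hom T S (X 0). \<exists>h \<in> Hom T S P.
      f = hadd T (\<iota> (Suc 0) \<cdot> \<phi> 0 \<cdot> g) (hsub T (Ident T P) sh \<cdot> h)"
    using fg hadd_Hom[OF eg f] by blast
qed

end

section \<open>Cohomological functors to abelian groups\<close>

context ab_functor_op
begin

lemma ar_closed: "f \<in> Hom C X Y \<Longrightarrow> y \<in> carrier (on_ob F Y) \<Longrightarrow> on_ar F f y \<in> carrier (on_ob F X)"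
  using ar by (auto simp: hom_def)

lemma ob_group: "X \<in> Obj C \<Longrightarrow> group (on_ob F X)"
  using ob by (simp add: comm_group_def)

lemma ar_one: "f \<in> Hom C X Y \<Longrightarrow> on_ar F f \<one>\<^bsub>on_ob F Y\<^esub> = \<one>\<^bsub>on_ob F X\<^esub>"
  using hom_one[OF ar] ob_group Hom_objs by blast

lemma one_closed: "X \<in> Obj C \<Longrightarrow> \<one>\<^bsub>on_ob F X\<^esub> \<in> carrier (on_ob F X)"
  using ob_group by (simp add: group.is_monoid)

lemma ar_mult:
  assumes "f \<in> Hom C X Y" "y \<in> carrier (on_ob F Y)" "y' \<in> carrier (on_ob F Y)"
  shows "on_ar F f (y \<otimes>\<^bsub>on_ob F Y\<^esub> y') = on_ar F f y \<otimes>\<^bsub>on_ob F X\<^esub> on_ar F f y'"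
  using ar[OF assms(1)] assms(2,3) by (simp add: hom_def)

lemma coproducts_to_products_iff:
  "coproducts_to_products u C F \<longleftrightarrow>
     (\<forall>(I :: 'u set) X P \<iota> x. small u I \<and> is_coproduct C I X P \<iota> \<and>
        (\<forall>i \<in> I. x i \<in> carrier (on_ob F (X i))) \<longrightarrow>
        (\<exists>!p. p \<in> carrier (on_ob F P) \<and> (\<forall>i \<in> I. on_ar F (\<iota> i) p = x i)))"
proof -
  have iff: "(\<lambda>p. \<lambda>i\<in>I. on_ar F (\<iota> i) p) \<in> iso (on_ob F P) (product_group I (\<lambda>i. on_ob F (X i))) \<longleftrightarrow>
      (\<forall>x. (\<forall>i \<in> I. x i \<in> carrier (on_ob F (X i))) \<longrightarrow>
        (\<exists>!p. p \<in> carrier (on_ob F P) \<and> (\<forall>i \<in> I. on_ar F (\<iota> i) p = x i)))"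
    (is "?\<Phi> \<in> iso ?G ?H \<longleftrightarrow> ?R")
    if cop: "is_coproduct C I X P \<iota>" for I :: "'u set" and X P \<iota>
  proof -
    note cD = coproductD[OF cop]
    have closed: "on_ar F (\<iota> i) p \<in> carrier (on_ob F (X i))" if "i \<in> I" "p \<in> carrier ?G" for i p
      using ar_closed[OF cD(3)] that by blast
    have "?\<Phi> \<in> hom ?G ?H"
    proof (rule homI)
      show "?\<Phi> p \<in> carrier ?H" if "p \<in> carrier ?G" for p using closed that by auto
      show "?\<Phi> (p \<otimes>\<^bsub>?G\<^esub> q) = ?\<Phi> p \<otimes>\<^bsub>?H\<^esub> ?\<Phi> q" if "p \<in> carrier ?G" "q \<in> carrier ?G" for p q
        using ar_mult[OF cD(3)] that by (auto intro!: restrict_ext)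
    qed
    moreover have "bij_betw ?\<Phi> (carrier ?G) (carrier ?H) \<longleftrightarrow> ?R"
    proof
      assume bij: "bij_betw ?\<Phi> (carrier ?G) (carrier ?H)"
      show ?R
      proof (intro allI impI)
        fix x assume x: "\<forall>i \<in> I. x i \<in> carrier (on_ob F (X i))"
        then have "restrict x I \<in> ?\<Phi> ` carrier ?G" using bij by (auto simp: bij_betw_def)
        then obtain p where p: "p \<in> carrier ?G" "restrict x I = ?\<Phi> p" by blast
        then have px: "\<forall>i \<in> I. on_ar F (\<iota> i) p = x i" by (metis restrict_apply')
        show "\<exists>!p. p \<in> carrier ?G \<and> (\<forall>i \<in> I. on_ar F (\<iota> i) p = x i)"
        proof (rule ex1I[of _ p])
          fix q assume q: "q \<in> carrier ?G \<and> (\<forall>i \<in> I. on_ar F (\<iota> i) q = x i)"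
          then have "?\<Phi> q = ?\<Phi> p" using px by (auto intro!: restrict_ext)
          then show "q = p" using bij p q by (auto simp: bij_betw_def inj_on_def)
        qed (use p px in auto)
      qed
    next
      assume R: ?R
      show "bij_betw ?\<Phi> (carrier ?G) (carrier ?H)"
      proof (intro bij_betw_imageI inj_onI subset_antisym subsetI)
        fix p q assume pq: "p \<in> carrier ?G" "q \<in> carrier ?G" "?\<Phi> p = ?\<Phi> q"
        have eq: "on_ar F (\<iota> i) p = on_ar F (\<iota> i) q" if "i \<in> I" for i
          using fun_cong[OF pq(3), of i] that by simp
        have "\<exists>!r. r \<in> carrier ?G \<and> (\<forall>i \<in> I. on_ar F (\<iota> i) r = on_ar F (\<iota> i) q)"
          using R[rule_format, of "\<lambda>i. on_ar F (\<iota> i) q"] closed pq(2) by simp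
        then show "p = q" using pq(1,2) eq by blast
      next
        fix y assume "y \<in> ?\<Phi> ` carrier ?G"
        then show "y \<in> carrier ?H" using closed by auto
      next
        fix y assume y: "y \<in> carrier ?H"
        then obtain p where p: "p \<in> carrier ?G" "\<forall>i \<in> I. on_ar F (\<iota> i) p = y i"
          using R[rule_format, of y] by auto
        have "y = ?\<Phi> p" using y p(2) by (auto simp: PiE_def extensional_def intro!: ext)
        then show "y \<in> ?\<Phi> ` carrier ?G" using p(1) by blast
      qed
    qed
    ultimately show ?thesis by (simp add: iso_def)
  qed
  show ?thesis
    unfolding coproducts_to_products_def
  proof (intro iffI allI impI; elim conjE)
    fix I :: "'u set" and X P \<iota> x
    assume "\<forall>(I :: 'u set) X P \<iota>. small u I \<and> is_coproduct C I X P \<iota> \<longrightarrow>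
        (\<lambda>x. \<lambda>i\<in>I. on_ar F (\<iota> i) x) \<in> iso (on_ob F P) (product_group I (\<lambda>i. on_ob F (X i)))"
      and "small u I" "is_coproduct C I X P \<iota>" and x: "\<forall>i \<in> I. x i \<in> carrier (on_ob F (X i))"
    then show "\<exists>!p. p \<in> carrier (on_ob F P) \<and> (\<forall>i \<in> I. on_ar F (\<iota> i) p = x i)"
      using iff[of I X P \<iota>] by simp
  next
    fix I :: "'u set" and X P \<iota>
    assume "\<forall>(I :: 'u set) X P \<iota> x. small u I \<and> is_coproduct C I X P \<iota> \<and>
        (\<forall>i \<in> I. x i \<in> carrier (on_ob F (X i))) \<longrightarrow>
        (\<exists>!p. p \<in> carrier (on_ob F P) \<and> (\<forall>i \<in> I. on_ar F (\<iota> i) p = x i))"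
      and "small u I" "is_coproduct C I X P \<iota>"
    then show "(\<lambda>x. \<lambda>i\<in>I. on_ar F (\<iota> i) x) \<in> iso (on_ob F P) (product_group I (\<lambda>i. on_ob F (X i)))"
      using iff[of I X P \<iota>] by simp
  qed
qed

end

text \<open>
  Exactness at \<open>F Z\<close> is exactness in the middle for the rotated triangle.
\<close>

lemma cohomological_op_iff:
  fixes T :: "('o, 'm, 'x) triangulated_scheme"
  assumes "triangulated_category T" "ab_functor_op T u F"
  shows "cohomological_op T F \<longleftrightarrow>
    (\<forall>X Y Z a b c. exact_triangle T X Y Z a b c \<longrightarrow>
       (\<forall>y \<in> carrier (on_ob F Y). on_ar F a y = \<one>\<^bsub>on_ob F X\<^esub> \<longleftrightarrow>
          (\<exists>z \<in> carrier (on_ob F Z). y = on_ar F b z)))"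
proof -
  interpret triangulated_category T by fact
  interpret F: ab_functor_op T u F by fact
  have iff: "exact_seq ([on_ob F X, on_ob F Y, on_ob F Z, on_ob F (susp_ob T X)],
        [on_ar F a, on_ar F b, on_ar F c]) \<longleftrightarrow>
      kernel (on_ob F Z) (on_ob F Y) (on_ar F b) = on_ar F c ` carrier (on_ob F (susp_ob T X)) \<and>
      kernel (on_ob F Y) (on_ob F X) (on_ar F a) = on_ar F b ` carrier (on_ob F Z)"
    if ex: "exact_triangle T X Y Z a b c" for X Y Z a b c
  proof -
    note eD = exact_triangleD[OF ex]
    show ?thesis
      using F.ob_group[OF eD(4)] F.ob_group[OF eD(5)] F.ob_group[OF eD(6)]
        F.ob_group[OF S.ob[OF eD(4)]] F.ar[OF eD(1)] F.ar[OF eD(2)] F.ar[OF eD(3)]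
      by (auto simp: group_hom_def group_hom_axioms_def)
  qed
  have ker: "kernel (on_ob F Y) (on_ob F X) (on_ar F a) = on_ar F b ` carrier (on_ob F Z) \<longleftrightarrow>
     (\<forall>y \<in> carrier (on_ob F Y). on_ar F a y = \<one>\<^bsub>on_ob F X\<^esub> \<longleftrightarrow>
          (\<exists>z \<in> carrier (on_ob F Z). y = on_ar F b z))"
    if b: "b \<in> Hom T Y Z" for X Y Z a b
    using F.ar_closed[OF b] by (auto simp: kernel_def)
  show ?thesis
  proof
    assume coh: "cohomological_op T F"
    have "kernel (on_ob F Y) (on_ob F X) (on_ar F a) = on_ar F b ` carrier (on_ob F Z)"
      if ex: "exact_triangle T X Y Z a b c" for X Y Z a b c
      using iffD1[OF iff[OF ex] coh[unfolded cohomological_op_def, rule_format, OF ex]] ..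
    then show "\<forall>X Y Z a b c. exact_triangle T X Y Z a b c \<longrightarrow>
       (\<forall>y \<in> carrier (on_ob F Y). on_ar F a y = \<one>\<^bsub>on_ob F X\<^esub> \<longleftrightarrow>
          (\<exists>z \<in> carrier (on_ob F Z). y = on_ar F b z))"
      by (intro allI impI) (rule iffD1[OF ker[OF exact_triangleD(2)]])
  next
    assume R: "\<forall>X Y Z a b c. exact_triangle T X Y Z a b c \<longrightarrow>
       (\<forall>y \<in> carrier (on_ob F Y). on_ar F a y = \<one>\<^bsub>on_ob F X\<^esub> \<longleftrightarrow>
          (\<exists>z \<in> carrier (on_ob F Z). y = on_ar F b z))"
    have K: "kernel (on_ob F Y) (on_ob F X) (on_ar F a) = on_ar F b ` carrier (on_ob F Z)"
      if ex: "exact_triangle T X Y Z a b c" for X Y Z a b c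
      by (rule iffD2[OF ker[OF exact_triangleD(2)[OF ex]]])
        (rule R[THEN spec, THEN spec, THEN spec, THEN spec, THEN spec, THEN spec, THEN mp, OF ex])
    show "cohomological_op T F"
      unfolding cohomological_op_def
    proof (intro allI impI)
      fix X Y Z a b c assume ex: "exact_triangle T X Y Z a b c"
      show "exact_seq ([on_ob F X, on_ob F Y, on_ob F Z, on_ob F (susp_ob T X)],
        [on_ar F a, on_ar F b, on_ar F c])"
        by (rule iffD2[OF iff[OF ex] conjI[OF K[OF rotate[OF ex]] K[OF ex]]])
    qed
  qed
qed

locale brown_functor =
  cocomplete_triangulated T u + F: ab_functor_op T u F
  for T :: "('o, 'm, 'x) triangulated_scheme" (structure) and u :: "'u itself"
    and F :: "('o, 'm, 'g monoid, 'g \<Rightarrow> 'g) ftr" +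
  assumes cohomological: "cohomological_op T F"
    and products: "coproducts_to_products u T F"
begin

lemma exactness:
  assumes "exact_triangle T X Y Z a b c" "y \<in> carrier (on_ob F Y)" "on_ar F a y = \<one>\<^bsub>on_ob F X\<^esub>"
  obtains z where "z \<in> carrier (on_ob F Z)" "on_ar F b z = y"
  using cohomological[unfolded cohomological_op_iff[OF triangulated_category_axioms
    F.ab_functor_op_axioms], rule_format, OF assms(1,2)] assms(3) by auto

lemma product_ex1:
  assumes cop: "is_coproduct T I X P \<iota>" and sm: "small u I"
    and x: "\<And>i. i \<in> I \<Longrightarrow> x i \<in> carrier (on_ob F (X i))"
  shows "\<exists>!p. p \<in> carrier (on_ob F P) \<and> (\<forall>i \<in> I. on_ar F (\<iota> i) p = x i)"
proof -
  obtain g :: "_ \<Rightarrow> 'u" where g: "inj_on g I"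
    using sm unfolding small_def lesspoll_def lepoll_def by blast
  define h where "h = the_inv_into I g"
  have h: "bij_betw h (g ` I) I"
    unfolding h_def using bij_betw_the_inv_into[OF inj_on_imp_bij_betw[OF g]] .
  have hg: "h (g i) = i" if "i \<in> I" for i unfolding h_def using the_inv_into_f_f[OF g that] .
  have sm': "small u (g ` I)"
    using sm eq_lesspoll_trans inj_on_image_eqpoll_self[OF g] unfolding small_def by blast
  have x': "\<forall>j \<in> g ` I. (x \<circ> h) j \<in> carrier (on_ob F ((X \<circ> h) j))" using x hg by auto
  have "\<exists>!p. p \<in> carrier (on_ob F P) \<and> (\<forall>j \<in> g ` I. on_ar F ((\<iota> \<circ> h) j) p = (x \<circ> h) j)"
    using products[unfolded F.coproducts_to_products_iff, rule_format, of "g ` I" "X \<circ> h" P "\<iota> \<circ> h" "x \<circ> h"]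
      coproduct_reindex[OF cop h] sm' x' by blast
  moreover have "(\<forall>j \<in> g ` I. on_ar F ((\<iota> \<circ> h) j) p = (x \<circ> h) j) \<longleftrightarrow> (\<forall>i \<in> I. on_ar F (\<iota> i) p = x i)"
    for p using hg by auto
  ultimately show ?thesis by simp
qed

lemma product_eqI:
  assumes "is_coproduct T I X P \<iota>" "small u I" "p \<in> carrier (on_ob F P)" "q \<in> carrier (on_ob F P)"
    and "\<And>i. i \<in> I \<Longrightarrow> on_ar F (\<iota> i) p = on_ar F (\<iota> i) q"
  shows "p = q"
proof -
  have "\<exists>!r. r \<in> carrier (on_ob F P) \<and> (\<forall>i \<in> I. on_ar F (\<iota> i) r = on_ar F (\<iota> i) q)"
    by (rule product_ex1[OF assms(1,2)]) (use F.ar_closed coproductD(3)[OF assms(1)] assms(4) in blast)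
  then show ?thesis using assms(3-5) by blast
qed

lemma small_nat_set: "small u (A :: nat set)"
  by (rule small_countable[OF uncountable_universe]) simp

lemma ar_zero:
  assumes XO: "X \<in> Obj T" and YO: "Y \<in> Obj T" and y: "y \<in> carrier (on_ob F Y)"
  shows "on_ar F (hzero T X Y) y = \<one>\<^bsub>on_ob F X\<^esub>"
proof -
  obtain N where N: "zero_object T N" using zero_object_exists by blast
  note NO = zero_objectD(1)[OF N]
  note z = hzero_Hom[OF XO NO] and z' = hzero_Hom[OF NO YO]
  have cop: "is_coproduct T ({} :: nat set) (\<lambda>_. N) N (\<lambda>_. Ident T N)"
    using zero_object_empty_coproduct[OF N] .
  have "on_ar F (hzero T N Y) y = \<one>\<^bsub>on_ob F N\<^esub>"
    by (rule product_eqI[OF cop small_nat_set F.ar_closed[OF z' y] F.one_closed[OF NO]]) simp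
  then have "on_ar F (hzero T N Y \<cdot> hzero T X N) y = \<one>\<^bsub>on_ob F X\<^esub>"
    using F.map_comp[OF z z' y] F.ar_one[OF z] by simp
  then show ?thesis using comp_zero(1)[OF z' XO] by simp
qed

text \<open>
  Additivity is a consequence of sending the coproduct \<open>X \<oplus> X\<close> to a product, as the sum of two maps
  \<open>X \<rightarrow> Y\<close> factors through the diagonal of \<open>X \<oplus> X\<close>.
\<close>

lemma ar_add:
  assumes f: "f \<in> Hom T X Y" and g: "g \<in> Hom T X Y" and y: "y \<in> carrier (on_ob F Y)"
  shows "on_ar F (hadd T f g) y = on_ar F f y \<otimes>\<^bsub>on_ob F X\<^esub> on_ar F g y"
proof -
  have XO: "X \<in> Obj T" and YO: "Y \<in> Obj T" using f Hom_objs by blast+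
  define I where "I = {0, 1 :: nat}"
  obtain P \<iota> where P: "is_coproduct T I (\<lambda>_. X) P \<iota>"
    using small_coprod[OF small_nat_set XO, of I] by blast
  have I: "0 \<in> I" "1 \<in> I" by (auto simp: I_def)
  note PD = coproductD[OF P]
  note \<iota>0 = PD(3)[OF I(1)] and \<iota>1 = PD(3)[OF I(2)]
  from coproduct_projections[OF P] obtain \<pi> where \<pi>:
    "\<forall>i \<in> I. \<pi> i \<in> Hom T P X \<and> \<pi> i \<cdot> \<iota> i = Ident T X \<and>
      (\<forall>j \<in> I. j \<noteq> i \<longrightarrow> \<pi> i \<cdot> \<iota> j = hzero T X X)" ..
  then have \<pi>0: "\<pi> 0 \<in> Hom T P X" "\<pi> 0 \<cdot> \<iota> 0 = Ident T X" "\<pi> 0 \<cdot> \<iota> 1 = hzero T X X"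
    and \<pi>1: "\<pi> 1 \<in> Hom T P X" "\<pi> 1 \<cdot> \<iota> 1 = Ident T X" "\<pi> 1 \<cdot> \<iota> 0 = hzero T X X"
    using I by auto
  define d where "d = hadd T (\<iota> 0) (\<iota> 1)"
  have d: "d \<in> Hom T X P" unfolding d_def using hadd_Hom[OF \<iota>0 \<iota>1] .
  have \<pi>d: "\<pi> 0 \<cdot> d = Ident T X" "\<pi> 1 \<cdot> d = Ident T X"
    unfolding d_def using comp_add[OF \<iota>0 \<iota>1] \<pi>0 \<pi>1 hadd_zero[OF ident[OF XO]] by simp_all
  have "\<exists>v. v \<in> Hom T P Y \<and> (\<forall>i \<in> I. v \<cdot> \<iota> i = (if i = 0 then f else g))"
    by (rule coproduct_map_ex[OF P YO]) (use f g in auto)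
  then obtain v where v: "v \<in> Hom T P Y" "v \<cdot> \<iota> 0 = f" "v \<cdot> \<iota> 1 = g" using I by fastforce
  define p where "p = on_ar F v y"
  have p: "p \<in> carrier (on_ob F P)" unfolding p_def using F.ar_closed[OF v(1) y] .
  define p0 where "p0 = on_ar F (\<iota> 0) p"
  define p1 where "p1 = on_ar F (\<iota> 1) p"
  have p01: "p0 \<in> carrier (on_ob F X)" "p1 \<in> carrier (on_ob F X)"
    unfolding p0_def p1_def using F.ar_closed[OF _ p] \<iota>0 \<iota>1 by auto
  have p0f: "p0 = on_ar F f y" and p1g: "p1 = on_ar F g y"
    unfolding p0_def p1_def p_def
    using F.map_comp[OF \<iota>0 v(1) y] F.map_comp[OF \<iota>1 v(1) y] v by auto
  interpret FX: comm_group "on_ob F X" using F.ob[OF XO] by simp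
  interpret FP: comm_group "on_ob F P" using F.ob[OF PD(1)] by simp
  note q0 = F.ar_closed[OF \<pi>0(1) p01(1)] and q1 = F.ar_closed[OF \<pi>1(1) p01(2)]
  have \<iota>q0: "on_ar F (\<iota> 0) (on_ar F (\<pi> 0) p0) = p0" "on_ar F (\<iota> 1) (on_ar F (\<pi> 0) p0) = \<one>\<^bsub>on_ob F X\<^esub>"
    using F.map_comp[OF \<iota>0 \<pi>0(1) p01(1)] F.map_comp[OF \<iota>1 \<pi>0(1) p01(1)] \<pi>0
      ar_zero[OF XO XO p01(1)] F.map_ident[OF XO p01(1)] by auto
  have \<iota>q1: "on_ar F (\<iota> 1) (on_ar F (\<pi> 1) p1) = p1" "on_ar F (\<iota> 0) (on_ar F (\<pi> 1) p1) = \<one>\<^bsub>on_ob F X\<^esub>"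
    using F.map_comp[OF \<iota>1 \<pi>1(1) p01(2)] F.map_comp[OF \<iota>0 \<pi>1(1) p01(2)] \<pi>1
      ar_zero[OF XO XO p01(2)] F.map_ident[OF XO p01(2)] by auto
  have eq: "p = on_ar F (\<pi> 0) p0 \<otimes>\<^bsub>on_ob F P\<^esub> on_ar F (\<pi> 1) p1"
  proof (rule product_eqI[OF P small_nat_set p FP.m_closed[OF q0 q1]])
    fix i assume "i \<in> I"
    then consider "i = 0" | "i = 1" by (auto simp: I_def)
    then show "on_ar F (\<iota> i) p = on_ar F (\<iota> i) (on_ar F (\<pi> 0) p0 \<otimes>\<^bsub>on_ob F P\<^esub> on_ar F (\<pi> 1) p1)"
    proof cases
      case 1
      have "on_ar F (\<iota> 0) (on_ar F (\<pi> 0) p0 \<otimes>\<^bsub>on_ob F P\<^esub> on_ar F (\<pi> 1) p1) = p0"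
        unfolding F.ar_mult[OF \<iota>0 q0 q1] \<iota>q0 \<iota>q1 FX.r_one[OF p01(1)] ..
      then show ?thesis unfolding 1 by (metis p0_def)
    next
      case 2
      have "on_ar F (\<iota> 1) (on_ar F (\<pi> 0) p0 \<otimes>\<^bsub>on_ob F P\<^esub> on_ar F (\<pi> 1) p1) = p1"
        unfolding F.ar_mult[OF \<iota>1 q0 q1] \<iota>q0 \<iota>q1 FX.l_one[OF p01(2)] ..
      then show ?thesis unfolding 2 by (metis p1_def)
    qed
  qed
  have "v \<cdot> d = hadd T f g" unfolding d_def using comp_add[OF \<iota>0 \<iota>1 v(1)] v by simp
  then have "on_ar F (hadd T f g) y = on_ar F d p"
    unfolding p_def using F.map_comp[OF d v(1) y] by simp
  also have "\<dots> = on_ar F d (on_ar F (\<pi> 0) p0 \<otimes>\<^bsub>on_ob F P\<^esub> on_ar F (\<pi> 1) p1)"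
    using eq by simp
  also have "\<dots> = p0 \<otimes>\<^bsub>on_ob F X\<^esub> p1"
    using F.ar_mult[OF d q0 q1] F.map_comp[OF d \<pi>0(1) p01(1)] F.map_comp[OF d \<pi>1(1) p01(2)]
      \<pi>d F.map_ident[OF XO] p01 by simp
  finally show ?thesis using p0f p1g by simp
qed

lemma ar_hsub_eq_one_iff:
  assumes f: "f \<in> Hom T X Y" and g: "g \<in> Hom T X Y" and y: "y \<in> carrier (on_ob F Y)"
  shows "on_ar F (hsub T f g) y = \<one>\<^bsub>on_ob F X\<^esub> \<longleftrightarrow> on_ar F f y = on_ar F g y"
proof -
  have XO: "X \<in> Obj T" using f Hom_objs by blast
  interpret FX: comm_group "on_ob F X" using F.ob[OF XO] by simp
  have "on_ar F f y = on_ar F (hsub T f g) y \<otimes>\<^bsub>on_ob F X\<^esub> on_ar F g y"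
    using ar_add[OF hsub_Hom[OF f g] g y] hadd_hsub[OF f g] by simp
  then show ?thesis
    using F.ar_closed[OF hsub_Hom[OF f g] y] F.ar_closed[OF f y] F.ar_closed[OF g y]
    by (metis FX.l_one FX.one_closed FX.right_cancel)
qed

end

section \<open>Shifts\<close>

text \<open>
  Words in \<open>\<Sigma>\<close> and its quasi-inverse take the place of integer shifts: a class defined by a condition
  on all \<open>shift_ob T w Y\<close> is closed under both operations by concatenation, with no need to cancel one
  against the other.
\<close>

primrec shift_ob :: "('o, 'm, 'x) triangulated_scheme \<Rightarrow> bool list \<Rightarrow> 'o \<Rightarrow> 'o" where
  "shift_ob T [] X = X"
| "shift_ob T (s # w) X = (if s then susp_ob T (shift_ob T w X) else desusp_ob T (shift_ob T w X))"

lemma shift_ob_append: "shift_ob T (v @ w) X = shift_ob T v (shift_ob T w X)"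
  by (induction v) auto

context triangulated_category
begin

sublocale D: is_functor T T "Desusp T" by (rule Desusp_functor)

lemma shift_ob_isomorphic:
  "isomorphic T X Y \<Longrightarrow> isomorphic T (shift_ob T w X) (shift_ob T w Y)"
  by (induction w) (auto intro: S.preserves_isomorphic D.preserves_isomorphic)

lemma shift_ob_exact:
  "exact_triangle T X Y Z a b c \<Longrightarrow>
     \<exists>a b c. exact_triangle T (shift_ob T w X) (shift_ob T w Y) (shift_ob T w Z) a b c"
proof (induction w)
  case (Cons s w)
  then obtain a' b' c' where
    "exact_triangle T (shift_ob T w X) (shift_ob T w Y) (shift_ob T w Z) a' b' c'" by blast
  from Susp_exact[OF this] Desusp_exact[OF this] show ?case by (cases s) simp_all
qed auto

lemma shift_ob_coproduct:
  assumes "is_coproduct T I X P \<iota>"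
  shows "\<exists>\<kappa>. is_coproduct T I (\<lambda>i. shift_ob T w (X i)) (shift_ob T w P) \<kappa>"
proof (induction w)
  case Nil
  show ?case using assms by auto
next
  case (Cons s w)
  then obtain \<kappa> where \<kappa>: "is_coproduct T I (\<lambda>i. shift_ob T w (X i)) (shift_ob T w P) \<kappa>" by blast
  show ?case
    using left_adjoint_preserves_coproduct[OF Susp_Desusp_adjoint(1) \<kappa>]
      left_adjoint_preserves_coproduct[OF Susp_Desusp_adjoint(2) \<kappa>]
    by (cases s) (auto simp: comp_def)
qed

lemma shift_ob_perfect: "perfect_object T S \<Longrightarrow> perfect_object T (shift_ob T w S)"
  by (induction w) (auto intro: perfect_object_left_adjoint[OF Susp_Desusp_adjoint]
      perfect_object_left_adjoint[OF Susp_Desusp_adjoint(2,1)])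

end

section \<open>Objects at which a functor is represented\<close>

text \<open>
  The natural map \<open>Hom(-, X) \<rightarrow> F\<close> given by \<open>\<xi> \<in> F X\<close> is bijective at \<open>Y\<close>.
\<close>

definition represented_at ::
  "('o, 'm, 'x) category_scheme \<Rightarrow> ('o, 'm, 'g monoid, 'g \<Rightarrow> 'g) ftr \<Rightarrow> 'o \<Rightarrow> 'g \<Rightarrow> 'o \<Rightarrow> bool" where
  "represented_at C F X \<xi> Y \<longleftrightarrow>
     (\<forall>y \<in> carrier (on_ob F Y). \<exists>!f. f \<in> Hom C Y X \<and> on_ar F f \<xi> = y)"

context brown_functor
begin

lemma represented_atI:
  assumes X: "X \<in> Obj T" and \<xi>: "\<xi> \<in> carrier (on_ob F X)" and Y: "Y \<in> Obj T"
    and surj: "\<And>y. y \<in> carrier (on_ob F Y) \<Longrightarrow> \<exists>f \<in> Hom T Y X. on_ar F f \<xi> = y"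
    and inj: "\<And>f. f \<in> Hom T Y X \<Longrightarrow> on_ar F f \<xi> = \<one>\<^bsub>on_ob F Y\<^esub> \<Longrightarrow> f = hzero T Y X"
  shows "represented_at T F X \<xi> Y"
  unfolding represented_at_def
proof
  fix y assume "y \<in> carrier (on_ob F Y)"
  then obtain f where f: "f \<in> Hom T Y X" "on_ar F f \<xi> = y" using surj by blast
  show "\<exists>!f. f \<in> Hom T Y X \<and> on_ar F f \<xi> = y"
  proof (rule ex1I[of _ f])
    fix g assume g: "g \<in> Hom T Y X \<and> on_ar F g \<xi> = y"
    have "on_ar F (hsub T g f) \<xi> = \<one>\<^bsub>on_ob F Y\<^esub>"
      using ar_hsub_eq_one_iff[OF _ f(1) \<xi>] f(2) g by simp
    then show "g = f" using inj[OF hsub_Hom] hsub_eq_zeroD g f(1) by blast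
  qed (use f in simp)
qed

lemma represented_atD:
  assumes "represented_at T F X \<xi> Y"
  shows "y \<in> carrier (on_ob F Y) \<Longrightarrow> \<exists>f \<in> Hom T Y X. on_ar F f \<xi> = y"
    and "\<xi> \<in> carrier (on_ob F X) \<Longrightarrow> f \<in> Hom T Y X \<Longrightarrow> g \<in> Hom T Y X \<Longrightarrow>
      on_ar F f \<xi> = on_ar F g \<xi> \<Longrightarrow> f = g"
    and "\<xi> \<in> carrier (on_ob F X) \<Longrightarrow> f \<in> Hom T Y X \<Longrightarrow> on_ar F f \<xi> = \<one>\<^bsub>on_ob F Y\<^esub> \<Longrightarrow>
      f = hzero T Y X"
proof -
  show "y \<in> carrier (on_ob F Y) \<Longrightarrow> \<exists>f \<in> Hom T Y X. on_ar F f \<xi> = y"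
    using assms unfolding represented_at_def by blast
  show inj: "f = g" if "\<xi> \<in> carrier (on_ob F X)" "f \<in> Hom T Y X" "g \<in> Hom T Y X"
      "on_ar F f \<xi> = on_ar F g \<xi>" for f g
    using assms F.ar_closed[OF that(3,1)] that(2-4) unfolding represented_at_def by blast
  show "f = hzero T Y X" if "\<xi> \<in> carrier (on_ob F X)" "f \<in> Hom T Y X" "on_ar F f \<xi> = \<one>\<^bsub>on_ob F Y\<^esub>" for f
    using inj[OF that(1,2) hzero_Hom] ar_zero that Hom_objs[OF that(2)] by simp
qed

lemma represented_at_retract:
  assumes X: "X \<in> Obj T" and \<xi>: "\<xi> \<in> carrier (on_ob F X)"
    and i: "i \<in> Hom T Y Z" and p: "p \<in> Hom T Z Y" and pi: "p \<cdot> i = Ident T Y"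
    and Z: "represented_at T F X \<xi> Z"
  shows "represented_at T F X \<xi> Y"
proof -
  have YO: "Y \<in> Obj T" using Hom_objs i by blast
  show ?thesis
  proof (rule represented_atI[OF X \<xi> YO])
    fix y assume y: "y \<in> carrier (on_ob F Y)"
    obtain f where f: "f \<in> Hom T Z X" "on_ar F f \<xi> = on_ar F p y"
      using represented_atD(1)[OF Z] F.ar_closed[OF p y] by blast
    have "on_ar F (f \<cdot> i) \<xi> = y"
      using F.map_comp[OF i f(1) \<xi>] f(2) F.map_comp[OF i p y] pi F.map_ident[OF YO y] by simp
    then show "\<exists>f \<in> Hom T Y X. on_ar F f \<xi> = y" using comp[OF i f(1)] by blast
  next
    fix f assume f: "f \<in> Hom T Y X" "on_ar F f \<xi> = \<one>\<^bsub>on_ob F Y\<^esub>"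
    have fp: "f \<cdot> p \<in> Hom T Z X" using comp[OF p f(1)] .
    have "on_ar F (f \<cdot> p) \<xi> = \<one>\<^bsub>on_ob F Z\<^esub>"
      using F.map_comp[OF p f(1) \<xi>] f(2) F.ar_one[OF p] by simp
    then have "f \<cdot> p = hzero T Z X" using represented_atD(3)[OF Z \<xi> fp] by blast
    then show "f = hzero T Y X"
      using retract_cancel_right[OF i p pi f(1)] comp_zero(2)[OF i X] by simp
  qed
qed

lemma represented_at_isomorphic:
  assumes "X \<in> Obj T" "\<xi> \<in> carrier (on_ob F X)" "isomorphic T Y Z" "represented_at T F X \<xi> Z"
  shows "represented_at T F X \<xi> Y"
  using assms(3) represented_at_retract[OF assms(1,2) _ _ _ assms(4)] unfolding isomorphic_iff by blast

text \<open>
  The five lemma for the long exact sequences of \<open>Hom(-, X)\<close> and \<open>F\<close>, in the range from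
  \<open>\<Sigma>B\<close> to \<open>A\<close>.
\<close>

lemma represented_at_cone:
  assumes X: "X \<in> Obj T" and \<xi>: "\<xi> \<in> carrier (on_ob F X)"
    and ex: "exact_triangle T A B Z a b c"
    and A: "represented_at T F X \<xi> A" and B: "represented_at T F X \<xi> B"
    and SA: "represented_at T F X \<xi> (susp_ob T A)" and SB: "represented_at T F X \<xi> (susp_ob T B)"
  shows "represented_at T F X \<xi> Z"
proof -
  note eD = exact_triangleD[OF ex]
  note ex' = rotate[OF ex] note ex'' = rotate[OF ex']
  note eD'' = exact_triangleD[OF ex'']
  show ?thesis
  proof (rule represented_atI[OF X \<xi> eD(6)])
    fix z assume z: "z \<in> carrier (on_ob F Z)"
    have bz: "on_ar F b z \<in> carrier (on_ob F B)" using F.ar_closed[OF eD(2) z] .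
    obtain \<beta> where \<beta>: "\<beta> \<in> Hom T B X" "on_ar F \<beta> \<xi> = on_ar F b z"
      using represented_atD(1)[OF B bz] by blast
    have "on_ar F (b \<cdot> a) z = \<one>\<^bsub>on_ob F A\<^esub>" using exact_comp_zero[OF ex] ar_zero[OF eD(4,6) z] by simp
    then have "on_ar F (\<beta> \<cdot> a) \<xi> = \<one>\<^bsub>on_ob F A\<^esub>"
      using F.map_comp[OF eD(1) \<beta>(1) \<xi>] F.map_comp[OF eD(1,2) z] \<beta>(2) by simp
    then have "\<beta> \<cdot> a = hzero T A X" using represented_atD(3)[OF A \<xi> comp[OF eD(1) \<beta>(1)]] by blast
    then obtain \<zeta> where \<zeta>: "\<zeta> \<in> Hom T Z X" "\<zeta> \<cdot> b = \<beta>" using exact_extend[OF ex \<beta>(1)] by blast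
    interpret FZ: comm_group "on_ob F Z" using F.ob[OF eD(6)] by simp
    interpret FB: comm_group "on_ob F B" using F.ob[OF eD(5)] by simp
    define z' where "z' = inv\<^bsub>on_ob F Z\<^esub> (on_ar F \<zeta> \<xi>) \<otimes>\<^bsub>on_ob F Z\<^esub> z"
    note \<zeta>\<xi> = F.ar_closed[OF \<zeta>(1) \<xi>]
    have z': "z' \<in> carrier (on_ob F Z)" unfolding z'_def using \<zeta>\<xi> z by simp
    have z_eq: "z = on_ar F \<zeta> \<xi> \<otimes>\<^bsub>on_ob F Z\<^esub> z'"
      unfolding z'_def using \<zeta>\<xi> z by (simp add: FZ.m_assoc[symmetric])
    have "on_ar F b z = on_ar F b (on_ar F \<zeta> \<xi>) \<otimes>\<^bsub>on_ob F B\<^esub> on_ar F b z'"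
      using trans[OF arg_cong[OF z_eq, of "on_ar F b"] F.ar_mult[OF eD(2) \<zeta>\<xi> z']] .
    moreover have "on_ar F b (on_ar F \<zeta> \<xi>) = on_ar F b z"
      using F.map_comp[OF eD(2) \<zeta>(1) \<xi>] \<zeta>(2) \<beta>(2) by simp
    ultimately have "on_ar F b z' = \<one>\<^bsub>on_ob F B\<^esub>"
      using bz F.ar_closed[OF eD(2) z'] FB.l_cancel_one' by metis
    then obtain \<sigma> where \<sigma>: "\<sigma> \<in> carrier (on_ob F (susp_ob T A))" "on_ar F c \<sigma> = z'"
      using exactness[OF ex' z'] by blast
    obtain s where s: "s \<in> Hom T (susp_ob T A) X" "on_ar F s \<xi> = \<sigma>"
      using represented_atD(1)[OF SA \<sigma>(1)] by blast
    have sc: "s \<cdot> c \<in> Hom T Z X" using comp[OF eD(3) s(1)] .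
    have "on_ar F (hadd T \<zeta> (s \<cdot> c)) \<xi> = z"
      using ar_add[OF \<zeta>(1) sc \<xi>] F.map_comp[OF eD(3) s(1) \<xi>] s(2) \<sigma>(2) z_eq[symmetric] by simp
    then show "\<exists>f \<in> Hom T Z X. on_ar F f \<xi> = z" using hadd_Hom[OF \<zeta>(1) sc] by blast
  next
    fix \<zeta> assume \<zeta>: "\<zeta> \<in> Hom T Z X" "on_ar F \<zeta> \<xi> = \<one>\<^bsub>on_ob F Z\<^esub>"
    have "on_ar F (\<zeta> \<cdot> b) \<xi> = \<one>\<^bsub>on_ob F B\<^esub>"
      using F.map_comp[OF eD(2) \<zeta>(1) \<xi>] \<zeta>(2) F.ar_one[OF eD(2)] by simp
    then have "\<zeta> \<cdot> b = hzero T B X" using represented_atD(3)[OF B \<xi> comp[OF eD(2) \<zeta>(1)]] by blast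
    then obtain s where s: "s \<in> Hom T (susp_ob T A) X" "s \<cdot> c = \<zeta>"
      using exact_extend[OF ex' \<zeta>(1)] by blast
    have "on_ar F c (on_ar F s \<xi>) = \<one>\<^bsub>on_ob F Z\<^esub>"
      using F.map_comp[OF eD(3) s(1) \<xi>] s(2) \<zeta>(2) by simp
    then obtain \<tau> where \<tau>: "\<tau> \<in> carrier (on_ob F (susp_ob T B))"
        "on_ar F (hneg T (susp_ar T a)) \<tau> = on_ar F s \<xi>"
      using exactness[OF ex'' F.ar_closed[OF s(1) \<xi>]] by blast
    obtain t where t: "t \<in> Hom T (susp_ob T B) X" "on_ar F t \<xi> = \<tau>"
      using represented_atD(1)[OF SB \<tau>(1)] by blast
    note tS = comp[OF eD''(2) t(1)]
    have "on_ar F (t \<cdot> hneg T (susp_ar T a)) \<xi> = on_ar F s \<xi>"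
      using F.map_comp[OF eD''(2) t(1) \<xi>] t(2) \<tau>(2) by simp
    then have "t \<cdot> hneg T (susp_ar T a) = s" using represented_atD(2)[OF SA \<xi> tS s(1)] by blast
    then have "\<zeta> = t \<cdot> hneg T (susp_ar T a) \<cdot> c"
      using comp_assoc[OF eD(3) eD''(2) t(1)] s(2) by simp
    then show "\<zeta> = hzero T Z X"
      using exact_comp_zero[OF ex''] comp_zero(1)[OF t(1) eD(6)] by simp
  qed
qed

lemma represented_at_coproduct:
  assumes X: "X \<in> Obj T" and \<xi>: "\<xi> \<in> carrier (on_ob F X)"
    and cop: "is_coproduct T I Y P \<iota>" and I: "small u I"
    and Y: "\<And>i. i \<in> I \<Longrightarrow> represented_at T F X \<xi> (Y i)"
  shows "represented_at T F X \<xi> P"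
proof (rule represented_atI[OF X \<xi>])
  note cD = coproductD[OF cop]
  show PO: "P \<in> Obj T" using cD by simp
  fix p assume p: "p \<in> carrier (on_ob F P)"
  have "\<forall>i \<in> I. \<exists>f. f \<in> Hom T (Y i) X \<and> on_ar F f \<xi> = on_ar F (\<iota> i) p"
    using represented_atD(1)[OF Y F.ar_closed[OF cD(3) p]] by blast
  from bchoice[OF this] obtain f where f:
    "\<forall>i \<in> I. f i \<in> Hom T (Y i) X \<and> on_ar F (f i) \<xi> = on_ar F (\<iota> i) p" ..
  then have "\<exists>h. h \<in> Hom T P X \<and> (\<forall>i \<in> I. h \<cdot> \<iota> i = f i)"
    by (intro coproduct_map_ex[OF cop X]) blast
  then obtain h where h: "h \<in> Hom T P X" "\<forall>i \<in> I. h \<cdot> \<iota> i = f i" by blast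
  have "on_ar F h \<xi> = p"
  proof (rule product_eqI[OF cop I F.ar_closed[OF h(1) \<xi>] p])
    fix i assume i: "i \<in> I"
    show "on_ar F (\<iota> i) (on_ar F h \<xi>) = on_ar F (\<iota> i) p"
      using F.map_comp[OF cD(3)[OF i] h(1) \<xi>] h(2) f i by simp
  qed
  then show "\<exists>f \<in> Hom T P X. on_ar F f \<xi> = p" using h(1) by blast
next
  note cD = coproductD[OF cop]
  fix f assume f: "f \<in> Hom T P X" "on_ar F f \<xi> = \<one>\<^bsub>on_ob F P\<^esub>"
  show "f = hzero T P X"
  proof (rule coproduct_eqI[OF cop f(1) hzero_Hom[OF cD(1) X]])
    fix i assume i: "i \<in> I"
    note \<iota> = cD(3)[OF i]
    have "on_ar F (f \<cdot> \<iota> i) \<xi> = \<one>\<^bsub>on_ob F (Y i)\<^esub>"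
      using F.map_comp[OF \<iota> f(1) \<xi>] f(2) F.ar_one[OF \<iota>] by simp
    then show "f \<cdot> \<iota> i = hzero T P X \<cdot> \<iota> i"
      using represented_atD(3)[OF Y[OF i] \<xi> comp[OF \<iota> f(1)]] comp_zero(2)[OF \<iota> X] by simp
  qed
qed

text \<open>
  The objects all of whose shifts are represented form a triangulated subcategory closed under
  coproducts, so (PG1) applies. As the class is closed under \<open>\<Sigma>\<close> and its inverse, any two vertices
  of a triangle may be rotated into the first two positions.
\<close>

lemma represented_everywhere:
  assumes X: "X \<in> Obj T" and \<xi>: "\<xi> \<in> carrier (on_ob F X)"
    and gen: "perfect_generator u T S"
    and S: "\<And>w. represented_at T F X \<xi> (shift_ob T w S)"
    and Y: "Y \<in> Obj T"
  shows "represented_at T F X \<xi> Y"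
proof -
  define L where "L = {Y \<in> Obj T. \<forall>w. represented_at T F X \<xi> (shift_ob T w Y)}"
  have SO: "S \<in> Obj T" using gen by (simp add: perfect_generator_def)
  have L_Obj: "Y \<in> Obj T" if "Y \<in> L" for Y using that by (simp add: L_def)
  have L_iso: "Y \<in> L" if "isomorphic T Y Z" "Z \<in> L" for Y Z
  proof -
    have "Y \<in> Obj T" using that(1) Hom_objs unfolding isomorphic_def by blast
    moreover have "represented_at T F X \<xi> (shift_ob T w Y)" for w
      using represented_at_isomorphic[OF X \<xi> shift_ob_isomorphic[OF that(1)]] that(2)
      by (simp add: L_def)
    ultimately show ?thesis by (simp add: L_def)
  qed
  have L_Susp: "susp_ob T Y \<in> L" if "Y \<in> L" for Y
  proof -
    have "represented_at T F X \<xi> (shift_ob T w (susp_ob T Y))" for w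
    proof -
      have "represented_at T F X \<xi> (shift_ob T (w @ [True]) Y)"
        using that unfolding L_def by blast
      then show ?thesis by (simp add: shift_ob_append)
    qed
    then show ?thesis using S.ob[OF L_Obj[OF that]] by (simp add: L_def)
  qed
  have L_Desusp: "desusp_ob T Y \<in> L" if "Y \<in> L" for Y
  proof -
    have "represented_at T F X \<xi> (shift_ob T w (desusp_ob T Y))" for w
    proof -
      have "represented_at T F X \<xi> (shift_ob T (w @ [False]) Y)"
        using that unfolding L_def by blast
      then show ?thesis by (simp add: shift_ob_append)
    qed
    then show ?thesis using D.ob[OF L_Obj[OF that]] by (simp add: L_def)
  qed
  have L_unSusp: "Y \<in> L" if "Y \<in> Obj T" "susp_ob T Y \<in> L" for Y
    using L_iso[OF isomorphic_sym[OF isomorphic_Desusp_Susp[OF that(1)]] L_Desusp[OF that(2)]] .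
  have L_cone: "Z \<in> L" if ex: "exact_triangle T A B Z a b c" and A: "A \<in> L" and B: "B \<in> L"
    for A B Z a b c
  proof -
    have "represented_at T F X \<xi> (shift_ob T w Z)" for w
    proof -
      obtain a' b' c' where
        "exact_triangle T (shift_ob T w A) (shift_ob T w B) (shift_ob T w Z) a' b' c'"
        using shift_ob_exact[OF ex] by blast
      moreover have "represented_at T F X \<xi> (shift_ob T (True # w) A)"
        "represented_at T F X \<xi> (shift_ob T (True # w) B)"
        using A B unfolding L_def by blast+
      ultimately show ?thesis
        using represented_at_cone[OF X \<xi>] A B by (simp add: L_def)
    qed
    then show ?thesis using exact_triangleD(6)[OF ex] by (simp add: L_def)
  qed
  have Susp_iter: "(susp_ob T ^^ n) Y \<in> L" if "Y \<in> L" for n Y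
    by (induction n) (use that L_Susp in auto)
  have unSusp_iter: "W \<in> L" if "(susp_ob T ^^ n) W \<in> L" "W \<in> Obj T" for n W
    using that
  proof (induction n arbitrary: W)
    case (Suc n)
    have "(susp_ob T ^^ n) (susp_ob T W) \<in> L" using Suc.prems(1) by (simp add: funpow_swap1)
    then show ?case using Suc.IH S.ob L_unSusp Suc.prems(2) by blast
  qed simp
  have "triangulated_subcategory T L"
    unfolding triangulated_subcategory_def
  proof (intro conjI ballI allI impI)
    show "L \<subseteq> Obj T" using L_Obj by blast
    show "L \<noteq> {}" using S SO by (auto simp: L_def)
    show "(susp_ob T ^^ n) Y \<in> L" if "Y \<in> L" for Y n using Susp_iter[OF that] .
    show "W \<in> L" if "Y \<in> L" "W \<in> Obj T" "isomorphic T ((susp_ob T ^^ n) W) Y" for Y n W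
      using unSusp_iter[OF L_iso[OF that(3,1)] that(2)] .
    fix A B Z a b c assume ex: "exact_triangle T A B Z a b c"
    note eD = exact_triangleD[OF ex]
    show "Z \<in> L" if "A \<in> L \<and> B \<in> L" using L_cone[OF ex] that by blast
    show "B \<in> L" if "A \<in> L \<and> Z \<in> L"
      using L_cone[OF rotate[OF rotate[OF ex]]] L_Susp L_unSusp[OF eD(5)] that by blast
    show "A \<in> L" if "B \<in> L \<and> Z \<in> L"
      using L_cone[OF rotate[OF ex]] L_unSusp[OF eD(4)] that by blast
  qed
  moreover have "S \<in> L" using S SO by (simp add: L_def)
  moreover have "closed_under_coproducts u T L"
    unfolding closed_under_coproducts_def
  proof (intro allI impI; elim conjE)
    fix I :: "'u set" and Y P \<iota>
    assume I: "small u I" and Y: "\<forall>i \<in> I. Y i \<in> L" and cop: "is_coproduct T I Y P \<iota>"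
    have "represented_at T F X \<xi> (shift_ob T w P)" for w
    proof -
      obtain \<kappa> where \<kappa>: "is_coproduct T I (\<lambda>i. shift_ob T w (Y i)) (shift_ob T w P) \<kappa>"
        using shift_ob_coproduct[OF cop] by blast
      show ?thesis
        by (rule represented_at_coproduct[OF X \<xi> \<kappa> I]) (use Y in \<open>auto simp: L_def\<close>)
    qed
    then show "P \<in> L" using coproductD(1)[OF cop] by (simp add: L_def)
  qed
  ultimately have "L = Obj T" using gen unfolding perfect_generator_def by blast
  then have "represented_at T F X \<xi> (shift_ob T [] Y)" using Y unfolding L_def by blast
  then show ?thesis by simp
qed

end

section \<open>Construction of the representing object\<close>

context brown_functor
begin

text \<open>
  \<open>A'\<close> is the cone of \<open>\<Coprod>S \<rightarrow> A\<close>, with one copy of \<open>S\<close> for each map \<open>f\<close> to be killed. As \<open>F\<close> sends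
  \<open>\<Coprod>S\<close> to a product, \<open>\<xi>\<close> restricts to zero on \<open>\<Coprod>S\<close>, hence extends to \<open>A'\<close>.
\<close>

lemma kill_kernel:
  assumes S: "S \<in> Obj T" and A: "A \<in> Obj T" and \<xi>: "\<xi> \<in> carrier (on_ob F A)"
  shows "\<exists>A' \<phi> \<xi>'. \<phi> \<in> Hom T A A' \<and> \<xi>' \<in> carrier (on_ob F A') \<and> on_ar F \<phi> \<xi>' = \<xi> \<and>
    (\<forall>f \<in> Hom T S A. on_ar F f \<xi> = \<one>\<^bsub>on_ob F S\<^esub> \<longrightarrow> \<phi> \<cdot> f = hzero T S A')"
proof -
  define K where "K = {f \<in> Hom T S A. on_ar F f \<xi> = \<one>\<^bsub>on_ob F S\<^esub>}"
  have smK: "small u K" by (rule small_subset[OF small_Hom[OF S A]]) (auto simp: K_def)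
  obtain U inc where U: "is_coproduct T K (\<lambda>_. S) U inc" using small_coprod[OF smK, of "\<lambda>_. S", OF S] by blast
  note UD = coproductD[OF U]
  have "\<exists>v. v \<in> Hom T U A \<and> (\<forall>f \<in> K. v \<cdot> inc f = f)"
    by (rule coproduct_map_ex[OF U A]) (simp add: K_def)
  then obtain v where v: "v \<in> Hom T U A" "\<forall>f \<in> K. v \<cdot> inc f = f" by blast
  have "on_ar F v \<xi> = \<one>\<^bsub>on_ob F U\<^esub>"
  proof (rule product_eqI[OF U smK F.ar_closed[OF v(1) \<xi>] F.one_closed[OF UD(1)]])
    fix f assume f: "f \<in> K"
    then show "on_ar F (inc f) (on_ar F v \<xi>) = on_ar F (inc f) \<one>\<^bsub>on_ob F U\<^esub>"
      using F.map_comp[OF UD(3)[OF f] v(1) \<xi>] v(2) F.ar_one[OF UD(3)[OF f]] by (simp add: K_def)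
  qed
  moreover obtain A' \<phi> c where ex: "exact_triangle T U A A' v \<phi> c" using TR1_cone[OF v(1)] by blast
  note eD = exact_triangleD[OF ex]
  ultimately obtain \<xi>' where \<xi>': "\<xi>' \<in> carrier (on_ob F A')" "on_ar F \<phi> \<xi>' = \<xi>"
    using exactness[OF ex \<xi>] by blast
  have "\<phi> \<cdot> f = hzero T S A'" if "f \<in> Hom T S A" "on_ar F f \<xi> = \<one>\<^bsub>on_ob F S\<^esub>" for f
  proof -
    have f: "f \<in> K" using that by (simp add: K_def)
    have "\<phi> \<cdot> f = (\<phi> \<cdot> v) \<cdot> inc f" using comp_assoc[OF UD(3)[OF f] v(1) eD(2)] v(2) f by simp
    then show ?thesis using exact_comp_zero[OF ex] comp_zero(2)[OF UD(3)[OF f] eD(6)] by simp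
  qed
  then show ?thesis using eD(2) \<xi>' by blast
qed

text \<open>
  Take one copy of \<open>S\<close> for each element of \<open>F S\<close>.
\<close>

lemma hit_all_elements:
  assumes S: "S \<in> Obj T"
  shows "\<exists>A \<in> Obj T. \<exists>\<xi> \<in> carrier (on_ob F A). \<forall>y \<in> carrier (on_ob F S). \<exists>f \<in> Hom T S A. on_ar F f \<xi> = y"
proof -
  have sm: "small u (carrier (on_ob F S))" using F.ob[OF S] by simp
  obtain A inc where A: "is_coproduct T (carrier (on_ob F S)) (\<lambda>_. S) A inc"
    using small_coprod[OF sm, of "\<lambda>_. S", OF S] by blast
  obtain \<xi> where "\<xi> \<in> carrier (on_ob F A)" "\<forall>y \<in> carrier (on_ob F S). on_ar F (inc y) \<xi> = y"
    using product_ex1[OF A sm, of "\<lambda>y. y"] by blast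
  then show ?thesis using coproductD(1,3)[OF A] by blast
qed

lemma approximating_sequence:
  assumes S: "S \<in> Obj T"
  shows "\<exists>X \<xi> \<phi>. (\<forall>i :: nat. X i \<in> Obj T \<and> \<xi> i \<in> carrier (on_ob F (X i)) \<and>
      \<phi> i \<in> Hom T (X i) (X (Suc i)) \<and> on_ar F (\<phi> i) (\<xi> (Suc i)) = \<xi> i \<and>
      (\<forall>f \<in> Hom T S (X i). on_ar F f (\<xi> i) = \<one>\<^bsub>on_ob F S\<^esub> \<longrightarrow> \<phi> i \<cdot> f = hzero T S (X (Suc i)))) \<and>
    (\<forall>y \<in> carrier (on_ob F S). \<exists>f \<in> Hom T S (X 0). on_ar F f (\<xi> 0) = y)"
proof -
  define ok where "ok p \<longleftrightarrow> fst p \<in> Obj T \<and> snd p \<in> carrier (on_ob F (fst p))" for p :: "'o \<times> 'g"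
  define start where "start p \<longleftrightarrow>
    (\<forall>y \<in> carrier (on_ob F S). \<exists>f \<in> Hom T S (fst p). on_ar F f (snd p) = y)" for p :: "'o \<times> 'g"
  define link where "link p q \<phi> \<longleftrightarrow> \<phi> \<in> Hom T (fst p) (fst q) \<and> on_ar F \<phi> (snd q) = snd p \<and>
    (\<forall>f \<in> Hom T S (fst p). on_ar F f (snd p) = \<one>\<^bsub>on_ob F S\<^esub> \<longrightarrow> \<phi> \<cdot> f = hzero T S (fst q))"
    for p q :: "'o \<times> 'g" and \<phi>
  have "\<exists>p. \<forall>n. (ok (p n) \<and> (n = 0 \<longrightarrow> start (p n))) \<and> (\<exists>\<phi>. link (p n) (p (Suc n)) \<phi>)"
  proof (rule dependent_nat_choice)
    obtain A \<xi> where "A \<in> Obj T" "\<xi> \<in> carrier (on_ob F A)"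
      "\<forall>y \<in> carrier (on_ob F S). \<exists>f \<in> Hom T S A. on_ar F f \<xi> = y"
      using hit_all_elements[OF S] by blast
    then have "ok (A, \<xi>) \<and> start (A, \<xi>)" by (simp add: ok_def start_def)
    then show "\<exists>p. ok p \<and> ((0::nat) = 0 \<longrightarrow> start p)" by blast
  next
    fix p and n :: nat
    assume "ok p \<and> (n = 0 \<longrightarrow> start p)"
    then have "fst p \<in> Obj T" "snd p \<in> carrier (on_ob F (fst p))" by (auto simp: ok_def)
    from kill_kernel[OF S this] obtain A' \<phi> \<xi>' where
      "\<phi> \<in> Hom T (fst p) A'" "\<xi>' \<in> carrier (on_ob F A')" "link p (A', \<xi>') \<phi>"
      unfolding link_def by auto
    then have "ok (A', \<xi>') \<and> link p (A', \<xi>') \<phi>" using Hom_objs by (auto simp: ok_def)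
    then show "\<exists>q. (ok q \<and> (Suc n = 0 \<longrightarrow> start q)) \<and> (\<exists>\<phi>. link p q \<phi>)" by blast
  qed
  then obtain p where p: "\<forall>n. (ok (p n) \<and> (n = 0 \<longrightarrow> start (p n))) \<and> (\<exists>\<phi>. link (p n) (p (Suc n)) \<phi>)" ..
  then have "\<forall>n. \<exists>\<phi>. link (p n) (p (Suc n)) \<phi>" by blast
  from choice[OF this] obtain \<phi> where "\<forall>n. link (p n) (p (Suc n)) (\<phi> n)" ..
  with p show ?thesis
    by (intro exI[of _ "\<lambda>n. fst (p n)"] exI[of _ "\<lambda>n. snd (p n)"] exI[of _ \<phi>])
      (auto simp: ok_def start_def link_def)
qed

text \<open>
  Here \<open>d\<close> is \<open>1 - shift\<close> on the coproduct \<open>P\<close> of the approximating sequence, and \<open>X\<close> is its homotopy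
  colimit. Injectivity of \<open>Hom(S, X) \<rightarrow> F S\<close> is asserted for maps that factor through \<open>P\<close>. That all maps
  do so depends on the injectivity of \<open>Hom(S, \<Sigma>d)\<close>, which is a statement about the desuspension of
  \<open>S\<close>.
\<close>

lemma homotopy_colimit:
  assumes S: "perfect_object T S"
  shows "\<exists>X \<xi> P d b c. exact_triangle T P P X d b c \<and> \<xi> \<in> carrier (on_ob F X) \<and>
    (\<forall>f \<in> Hom T S P. d \<cdot> f = hzero T S P \<longrightarrow> f = hzero T S P) \<and>
    (\<forall>y \<in> carrier (on_ob F S). \<exists>f \<in> Hom T S X. on_ar F f \<xi> = y) \<and>
    (\<forall>f \<in> Hom T S P. on_ar F (b \<cdot> f) \<xi> = \<one>\<^bsub>on_ob F S\<^esub> \<longrightarrow> b \<cdot> f = hzero T S X)"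
proof -
  note SO = perfect_object_Obj[OF S]
  from approximating_sequence[OF SO] obtain X \<xi> \<phi> where
    seq: "\<forall>i :: nat. X i \<in> Obj T \<and> \<xi> i \<in> carrier (on_ob F (X i)) \<and>
      \<phi> i \<in> Hom T (X i) (X (Suc i)) \<and> on_ar F (\<phi> i) (\<xi> (Suc i)) = \<xi> i \<and>
      (\<forall>f \<in> Hom T S (X i). on_ar F f (\<xi> i) = \<one>\<^bsub>on_ob F S\<^esub> \<longrightarrow> \<phi> i \<cdot> f = hzero T S (X (Suc i)))"
    and start: "\<forall>y \<in> carrier (on_ob F S). \<exists>f \<in> Hom T S (X 0). on_ar F f (\<xi> 0) = y"
    by (elim exE conjE)
  have XO: "X i \<in> Obj T" and \<xi>: "\<xi> i \<in> carrier (on_ob F (X i))"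
    and \<phi>: "\<phi> i \<in> Hom T (X i) (X (Suc i))" and \<phi>\<xi>: "on_ar F (\<phi> i) (\<xi> (Suc i)) = \<xi> i"
    and kill: "f \<in> Hom T S (X i) \<Longrightarrow> on_ar F f (\<xi> i) = \<one>\<^bsub>on_ob F S\<^esub> \<Longrightarrow> \<phi> i \<cdot> f = hzero T S (X (Suc i))"
    for i f using seq by blast+
  obtain P \<iota> where P: "is_coproduct T (UNIV :: nat set) X P \<iota>" using nat_coprod[of X, OF XO] by blast
  note PO = coproductD(1)[OF P] and \<iota> = coproductD(3)[OF P UNIV_I]
  have \<iota>\<phi>: "\<iota> (Suc i) \<cdot> \<phi> i \<in> Hom T (X i) P" for i using comp[OF \<phi> \<iota>] .
  obtain sh where sh: "sh \<in> Hom T P P" "\<And>i. sh \<cdot> \<iota> i = \<iota> (Suc i) \<cdot> \<phi> i"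
    using coproduct_map_ex[OF P PO \<iota>\<phi>] by blast
  define x where "x = rec_nat (Ident T (X 0)) (\<lambda>i xi. \<phi> i \<cdot> xi)"
  have x: "x 0 = Ident T (X 0)" "\<And>i. x (Suc i) = \<phi> i \<cdot> x i" by (simp_all add: x_def)
  have x_Hom: "x i \<in> Hom T (X 0) (X i)" for i
    by (induction i) (use x ident[OF XO] comp[OF _ \<phi>] in auto)
  have x\<xi>: "on_ar F (x i) (\<xi> i) = \<xi> 0" for i
  proof (induction i)
    case 0
    show ?case using x(1) F.map_ident[OF XO \<xi>] by simp
  next
    case (Suc i)
    then show ?case using x(2) F.map_comp[OF x_Hom \<phi> \<xi>] \<phi>\<xi> by simp
  qed
  have image: "\<exists>g \<in> Hom T S (X 0). \<phi> i \<cdot> f = x (Suc i) \<cdot> g" if f: "f \<in> Hom T S (X i)" for i f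
  proof -
    obtain g where g: "g \<in> Hom T S (X 0)" "on_ar F g (\<xi> 0) = on_ar F f (\<xi> i)"
      using start F.ar_closed[OF f \<xi>] by blast
    have xg: "x i \<cdot> g \<in> Hom T S (X i)" using comp[OF g(1) x_Hom] .
    have "on_ar F f (\<xi> i) = on_ar F (x i \<cdot> g) (\<xi> i)"
      using F.map_comp[OF g(1) x_Hom \<xi>] x\<xi> g(2) by simp
    then have "\<phi> i \<cdot> hsub T f (x i \<cdot> g) = hzero T S (X (Suc i))"
      using kill[OF hsub_Hom[OF f xg]] ar_hsub_eq_one_iff[OF f xg \<xi>] by simp
    then have "\<phi> i \<cdot> f = \<phi> i \<cdot> x i \<cdot> g"
      using comp_hsub[OF f xg \<phi>] hsub_eq_zeroD[OF comp[OF f \<phi>] comp[OF xg \<phi>]] by simp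
    then show ?thesis using g(1) x(2) comp_assoc[OF g(1) x_Hom \<phi>] by metis
  qed
  have kernel: "\<phi> 0 \<cdot> g = hzero T S (X (Suc 0))"
    if g: "g \<in> Hom T S (X 0)" and "x (Suc i) \<cdot> g = hzero T S (X (Suc i))" for i g
  proof -
    have "on_ar F g (\<xi> 0) = \<one>\<^bsub>on_ob F S\<^esub>"
      using F.map_comp[OF g x_Hom \<xi>, of "Suc i"] x\<xi> that(2) ar_zero[OF SO XO \<xi>] by simp
    then show ?thesis using kill[OF g] by simp
  qed
  have fixed_zero: "f = hzero T S P" if "f \<in> Hom T S P" "sh \<cdot> f = f" for f
    by (rule telescope(1)[OF S P \<phi> sh x _ _ that]) (erule image, erule (1) kernel)
  have decompose: "\<exists>g \<in> Hom T S (X 0). \<exists>h \<in> Hom T S P.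
      f = hadd T (\<iota> (Suc 0) \<cdot> \<phi> 0 \<cdot> g) (hsub T (Ident T P) sh \<cdot> h)" if "f \<in> Hom T S P" for f
    by (rule telescope(2)[OF S P \<phi> sh x _ _ that]) (erule image, erule (1) kernel)
  define d where "d = hsub T (Ident T P) sh"
  have d: "d \<in> Hom T P P" unfolding d_def using hsub_Hom[OF ident[OF PO] sh(1)] .
  obtain Z b c where ex: "exact_triangle T P P Z d b c" using TR1_cone[OF d] by blast
  note eD = exact_triangleD[OF ex]
  have "\<exists>!p. p \<in> carrier (on_ob F P) \<and> (\<forall>i \<in> UNIV. on_ar F (\<iota> i) p = \<xi> i)"
    by (rule product_ex1[OF P small_nat_set \<xi>])
  then obtain p where p: "p \<in> carrier (on_ob F P)" "\<And>i. on_ar F (\<iota> i) p = \<xi> i" by blast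
  have "on_ar F d p = \<one>\<^bsub>on_ob F P\<^esub>"
  proof (rule product_eqI[OF P small_nat_set F.ar_closed[OF d p(1)] F.one_closed[OF PO]])
    fix i
    have "d \<cdot> \<iota> i = hsub T (\<iota> i) (\<iota> (Suc i) \<cdot> \<phi> i)"
      unfolding d_def using hsub_comp[OF \<iota> ident[OF PO] sh(1)] ident_comp[OF \<iota>] sh(2) by simp
    moreover have "on_ar F (\<iota> i) p = on_ar F (\<iota> (Suc i) \<cdot> \<phi> i) p"
      using F.map_comp[OF \<phi> \<iota> p(1)] p(2) \<phi>\<xi> by simp
    ultimately have "on_ar F (d \<cdot> \<iota> i) p = \<one>\<^bsub>on_ob F (X i)\<^esub>"
      using ar_hsub_eq_one_iff[OF \<iota> \<iota>\<phi> p(1)] by simp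
    then show "on_ar F (\<iota> i) (on_ar F d p) = on_ar F (\<iota> i) \<one>\<^bsub>on_ob F P\<^esub>"
      using F.map_comp[OF \<iota> d p(1)] F.ar_one[OF \<iota>] by simp
  qed
  then obtain \<zeta> where \<zeta>: "\<zeta> \<in> carrier (on_ob F Z)" "on_ar F b \<zeta> = p"
    using exactness[OF ex p(1)] by blast
  have \<iota>\<zeta>: "on_ar F (\<iota> i) (on_ar F b \<zeta>) = \<xi> i" for i using \<zeta>(2) p(2) by simp
  have "f = hzero T S P" if f: "f \<in> Hom T S P" and df: "d \<cdot> f = hzero T S P" for f
  proof -
    have "hsub T f (sh \<cdot> f) = hzero T S P"
      using df hsub_comp[OF f ident[OF PO] sh(1)] ident_comp[OF f] unfolding d_def by simp
    then have "sh \<cdot> f = f" using hsub_eq_zeroD[OF f comp[OF f sh(1)]] by simp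
    then show ?thesis using fixed_zero[OF f] by blast
  qed
  moreover have "\<exists>f \<in> Hom T S Z. on_ar F f \<zeta> = y" if y: "y \<in> carrier (on_ob F S)" for y
  proof -
    obtain g where g: "g \<in> Hom T S (X 0)" "on_ar F g (\<xi> 0) = y" using start y by blast
    have \<iota>g: "\<iota> 0 \<cdot> g \<in> Hom T S P" using comp[OF g(1) \<iota>] .
    have "on_ar F (b \<cdot> \<iota> 0 \<cdot> g) \<zeta> = y"
      using F.map_comp[OF \<iota>g eD(2) \<zeta>(1)] F.map_comp[OF g(1) \<iota> F.ar_closed[OF eD(2) \<zeta>(1)]] \<iota>\<zeta> g(2) by simp
    then show ?thesis using comp[OF \<iota>g eD(2)] by blast
  qed
  moreover have "b \<cdot> f = hzero T S Z" if f: "f \<in> Hom T S P" and bf: "on_ar F (b \<cdot> f) \<zeta> = \<one>\<^bsub>on_ob F S\<^esub>" for f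
  proof -
    obtain g h where g: "g \<in> Hom T S (X 0)" and h: "h \<in> Hom T S P"
      and f_eq: "f = hadd T (\<iota> (Suc 0) \<cdot> \<phi> 0 \<cdot> g) (d \<cdot> h)"
      using decompose[OF f] unfolding d_def by blast
    note \<phi>g = comp[OF g \<phi>]
    note \<iota>\<phi>g = comp[OF \<phi>g \<iota>]
    have "b \<cdot> d \<cdot> h = hzero T S Z"
      using comp_assoc[OF h d eD(2)] exact_comp_zero[OF ex] comp_zero(2)[OF h eD(6)] by simp
    then have bf_eq: "b \<cdot> f = b \<cdot> \<iota> (Suc 0) \<cdot> \<phi> 0 \<cdot> g"
      unfolding f_eq using comp_add[OF \<iota>\<phi>g comp[OF h d] eD(2)] hadd_zero(1)[OF comp[OF \<iota>\<phi>g eD(2)]] by simp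
    have "on_ar F (b \<cdot> f) \<zeta> = on_ar F g (\<xi> 0)"
      unfolding bf_eq
      using F.map_comp[OF \<iota>\<phi>g eD(2) \<zeta>(1)] F.map_comp[OF \<phi>g \<iota> F.ar_closed[OF eD(2) \<zeta>(1)]]
        F.map_comp[OF g \<phi> \<xi>] \<iota>\<zeta> \<phi>\<xi> by simp
    then have "\<phi> 0 \<cdot> g = hzero T S (X (Suc 0))" using kill[OF g] bf by simp
    then show ?thesis
      using bf_eq comp_zero(1)[OF \<iota> SO] comp_zero(1)[OF eD(2) SO] by simp
  qed
  ultimately show ?thesis using ex \<zeta>(1) by blast
qed

text \<open>
  The homotopy colimit is formed for the coproduct \<open>S'\<close> of all shifts of \<open>S\<close>, so that its properties
  hold for each shift \<open>R w\<close> as a retract of \<open>S'\<close>, and the one on \<open>d\<close> can be applied to a desuspension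
  of \<open>R w\<close>. Treating all shifts through the single object \<open>S'\<close> also keeps the index sets small: a
  countable union of small sets might not be small.
\<close>

theorem representable:
  assumes gen: "perfect_generator u T S"
  shows "\<exists>X \<in> Obj T. \<exists>\<xi> \<in> carrier (on_ob F X). \<forall>Y \<in> Obj T. represented_at T F X \<xi> Y"
proof -
  note S = perfect_generator_perfect_object[OF triangulated_category_axioms gen]
  define R where "R w = shift_ob T w S" for w
  have R: "perfect_object T (R w)" for w unfolding R_def using shift_ob_perfect[OF S] .
  note RO = perfect_object_Obj[OF R]
  have "small u (UNIV :: bool list set)" by (rule small_countable[OF uncountable_universe]) simp
  from small_coprod[OF this, of R, OF RO] obtain S' \<rho> where S': "is_coproduct T UNIV R S' \<rho>" by blast
  note \<rho> = coproductD(3)[OF S' UNIV_I]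
  from coproduct_projections[OF S'] obtain \<pi> where "\<forall>w \<in> UNIV. \<pi> w \<in> Hom T S' (R w) \<and>
      \<pi> w \<cdot> \<rho> w = Ident T (R w) \<and> (\<forall>v \<in> UNIV. v \<noteq> w \<longrightarrow> \<pi> w \<cdot> \<rho> v = hzero T (R v) (R w))" ..
  then have \<pi>: "\<pi> w \<in> Hom T S' (R w)" "\<pi> w \<cdot> \<rho> w = Ident T (R w)" for w by auto
  from homotopy_colimit[OF perfect_object_coproduct[OF S' R]] obtain X \<xi> P d b c
    where ex: "exact_triangle T P P X d b c" and \<xi>: "\<xi> \<in> carrier (on_ob F X)"
    and d_inj: "\<forall>f \<in> Hom T S' P. d \<cdot> f = hzero T S' P \<longrightarrow> f = hzero T S' P"
    and surj: "\<forall>y \<in> carrier (on_ob F S'). \<exists>f \<in> Hom T S' X. on_ar F f \<xi> = y"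
    and b_inj: "\<forall>f \<in> Hom T S' P. on_ar F (b \<cdot> f) \<xi> = \<one>\<^bsub>on_ob F S'\<^esub> \<longrightarrow> b \<cdot> f = hzero T S' X"
    by (elim exE conjE)
  note eD = exact_triangleD[OF ex]
  note ex' = rotate[OF ex] note ex'' = rotate[OF ex']
  have retract_zero: "f = hzero T (R w) Y" if f: "f \<in> Hom T (R w) Y" and "f \<cdot> \<pi> w = hzero T S' Y" for f w Y
    using retract_cancel_right[OF \<rho> \<pi> f] that(2) comp_zero(2)[OF \<rho> Hom_objs(2)[OF f]] by simp
  have d_injR: "f = hzero T (R w) P" if f: "f \<in> Hom T (R w) P" and df: "d \<cdot> f = hzero T (R w) P" for f w
  proof -
    have "d \<cdot> f \<cdot> \<pi> w = hzero T S' P"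
      using comp_assoc[OF \<pi>(1) f eD(1)] df comp_zero(2)[OF \<pi>(1) eD(4)] by simp
    then show ?thesis using d_inj comp[OF \<pi>(1) f] retract_zero[OF f] by blast
  qed
  have "represented_at T F X \<xi> (R w)" for w
  proof (rule represented_atI[OF eD(6) \<xi> RO])
    fix y assume y: "y \<in> carrier (on_ob F (R w))"
    obtain f where f: "f \<in> Hom T S' X" "on_ar F f \<xi> = on_ar F (\<pi> w) y"
      using surj F.ar_closed[OF \<pi>(1) y] by blast
    have "on_ar F (f \<cdot> \<rho> w) \<xi> = y"
      using F.map_comp[OF \<rho> f(1) \<xi>, of w] f(2) F.map_comp[OF \<rho> \<pi>(1) y, of w] \<pi>(2)[of w]
        F.map_ident[OF RO y] by simp
    then show "\<exists>f \<in> Hom T (R w) X. on_ar F f \<xi> = y" using comp[OF \<rho> f(1)] by blast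
  next
    fix f assume f: "f \<in> Hom T (R w) X" "on_ar F f \<xi> = \<one>\<^bsub>on_ob F (R w)\<^esub>"
    define R' where "R' = R (False # w)"
    note R'O = RO[of "False # w", folded R'_def]
    have "isomorphic T (susp_ob T R') (R w)"
      using isomorphic_Susp_Desusp[OF RO[of w]] unfolding R'_def R_def by simp
    then obtain v v' where v: "v \<in> Hom T (susp_ob T R') (R w)" and v': "v' \<in> Hom T (R w) (susp_ob T R')"
      and inv: "v \<cdot> v' = Ident T (R w)" unfolding isomorphic_iff by blast
    note cf = comp[OF f(1) eD(3)]
    obtain k where k: "k \<in> Hom T R' P" "susp_ar T k = (c \<cdot> f) \<cdot> v"
      using Susp_full[OF R'O eD(4) comp[OF v cf]] .
    note Sd = S.ar[OF eD(1)]
    have "hneg T (susp_ar T d) \<cdot> c = hzero T X (susp_ob T P)" using exact_comp_zero[OF ex''] .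
    then have Sdc: "susp_ar T d \<cdot> c = hzero T X (susp_ob T P)"
      using comp_eq_zero_if_hneg[OF eD(3) Sd] by blast
    have "susp_ar T (d \<cdot> k) = ((susp_ar T d \<cdot> c) \<cdot> f) \<cdot> v"
      using S.map_comp[OF k(1) eD(1)] k(2) comp_assoc[OF v cf Sd] comp_assoc[OF f(1) eD(3) Sd] by simp
    also have "\<dots> = susp_ar T (hzero T R' P)"
      using Sdc comp_zero(2)[OF f(1) S.ob[OF eD(4)]] comp_zero(2)[OF v S.ob[OF eD(4)]] Susp_zero[OF R'O eD(4)] by simp
    finally have "d \<cdot> k = hzero T R' P"
      using Susp_faithful[OF comp[OF k(1) eD(1)] hzero_Hom[OF R'O eD(4)]] by blast
    then have "k = hzero T R' P" using d_injR k(1) unfolding R'_def by blast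
    then have "(c \<cdot> f) \<cdot> v = hzero T (susp_ob T R') (susp_ob T P)"
      using k(2) Susp_zero[OF R'O eD(4)] by simp
    then have "c \<cdot> f = hzero T (R w) (susp_ob T P)"
      using retract_cancel_right[OF v' v inv cf] comp_zero(2)[OF v' S.ob[OF eD(4)]] by simp
    then obtain g where g: "g \<in> Hom T (R w) P" "b \<cdot> g = f" using exact_lift[OF ex' f(1)] by blast
    have "on_ar F (f \<cdot> \<pi> w) \<xi> = \<one>\<^bsub>on_ob F S'\<^esub>"
      using F.map_comp[OF \<pi>(1) f(1) \<xi>] f(2) F.ar_one[OF \<pi>(1)] by simp
    then have "on_ar F (b \<cdot> g \<cdot> \<pi> w) \<xi> = \<one>\<^bsub>on_ob F S'\<^esub>"
      using comp_assoc[OF \<pi>(1) g(1) eD(2)] g(2) by simp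
    then have "b \<cdot> g \<cdot> \<pi> w = hzero T S' X" using b_inj comp[OF \<pi>(1) g(1)] by blast
    then have "f \<cdot> \<pi> w = hzero T S' X" using comp_assoc[OF \<pi>(1) g(1) eD(2)] g(2) by simp
    then show "f = hzero T (R w) X" using retract_zero[OF f(1)] by blast
  qed
  then have "\<forall>Y \<in> Obj T. represented_at T F X \<xi> Y"
    using represented_everywhere[OF eD(6) \<xi> gen] unfolding R_def by blast
  then show ?thesis using eD(6) \<xi> by blast
qed

lemma represented_natural_iso:
  assumes X: "X \<in> Obj T" and \<xi>: "\<xi> \<in> carrier (on_ob F X)"
    and rep: "\<And>Y. Y \<in> Obj T \<Longrightarrow> represented_at T F X \<xi> Y"
  shows "\<exists>\<eta>. ab_natural_iso_op T F (Hom_functor T X) \<eta>"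
proof -
  define \<eta> where "\<eta> Y y = (THE f. f \<in> Hom T Y X \<and> on_ar F f \<xi> = y)" for Y y
  have \<eta>: "\<eta> Y y \<in> Hom T Y X" "on_ar F (\<eta> Y y) \<xi> = y"
    if "Y \<in> Obj T" "y \<in> carrier (on_ob F Y)" for Y y
  proof -
    have "\<exists>!f. f \<in> Hom T Y X \<and> on_ar F f \<xi> = y"
      using rep[OF that(1)] that(2) unfolding represented_at_def by blast
    from theI'[OF this] show "\<eta> Y y \<in> Hom T Y X" "on_ar F (\<eta> Y y) \<xi> = y"
      unfolding \<eta>_def by blast+
  qed
  have \<eta>_eq: "\<eta> Y y = f" if f: "f \<in> Hom T Y X" "on_ar F f \<xi> = y" for Y y f
  proof -
    have Y: "Y \<in> Obj T" using Hom_objs f(1) by blast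
    have y: "y \<in> carrier (on_ob F Y)" using F.ar_closed[OF f(1) \<xi>] f(2) by simp
    show ?thesis using represented_atD(2)[OF rep[OF Y] \<xi> \<eta>(1)[OF Y y] f(1)] \<eta>(2)[OF Y y] f(2) by simp
  qed
  have "\<eta> Y \<in> iso (on_ob F Y) (Hom_grp T Y X)" if Y: "Y \<in> Obj T" for Y
  proof -
    interpret FY: comm_group "on_ob F Y" using F.ob[OF Y] by simp
    have "\<eta> Y \<in> hom (on_ob F Y) (Hom_grp T Y X)"
    proof (rule homI; unfold Hom_grp_simps)
      show "\<eta> Y y \<in> Hom T Y X" if "y \<in> carrier (on_ob F Y)" for y using \<eta>(1)[OF Y that] .
      fix y z assume y: "y \<in> carrier (on_ob F Y)" and z: "z \<in> carrier (on_ob F Y)"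
      show "\<eta> Y (y \<otimes>\<^bsub>on_ob F Y\<^esub> z) = hadd T (\<eta> Y y) (\<eta> Y z)"
        by (rule \<eta>_eq)
          (use hadd_Hom[OF \<eta>(1)[OF Y y] \<eta>(1)[OF Y z]] ar_add[OF \<eta>(1)[OF Y y] \<eta>(1)[OF Y z] \<xi>]
            \<eta>(2)[OF Y y] \<eta>(2)[OF Y z] in auto)
    qed
    moreover have "bij_betw (\<eta> Y) (carrier (on_ob F Y)) (Hom T Y X)"
      by (rule bij_betwI[of _ _ _ "\<lambda>f. on_ar F f \<xi>"]) (use \<eta>[OF Y] \<eta>_eq F.ar_closed[OF _ \<xi>] in auto)
    ultimately show ?thesis by (simp add: iso_def Hom_grp_simps)
  qed
  moreover have "\<eta> Y (on_ar F f y) = \<eta> Z y \<cdot> f"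
    if f: "f \<in> Hom T Y Z" and y: "y \<in> carrier (on_ob F Z)" for Y Z f y
  proof -
    have Z: "Z \<in> Obj T" using Hom_objs f by blast
    show ?thesis
      using \<eta>_eq[OF comp[OF f \<eta>(1)[OF Z y]]] F.map_comp[OF f \<eta>(1)[OF Z y] \<xi>] \<eta>(2)[OF Z y] by simp
  qed
  ultimately have "ab_natural_iso_op T F (Hom_functor T X) \<eta>"
    unfolding ab_natural_iso_op_def Hom_functor_def by simp
  then show ?thesis by blast
qed

end

section \<open>The representability theorem and right adjoints\<close>

lemma representable_functor_properties:
  fixes T :: "('o, 'm, 'x) triangulated_scheme" and u :: "'u itself"
  assumes "triangulated_category T" "ab_functor_op T u F" and X: "X \<in> Obj T"
    and nat: "ab_natural_iso_op T F (Hom_functor T X) \<eta>"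
  shows "cohomological_op T F" "coproducts_to_products u T F"
proof -
  interpret triangulated_category T by fact
  interpret F: ab_functor_op T u F by fact
  have iso: "\<eta> Y \<in> iso (on_ob F Y) (Hom_grp T Y X)" if "Y \<in> Obj T" for Y
    using nat that unfolding ab_natural_iso_op_def Hom_functor_def by simp
  have bij: "bij_betw (\<eta> Y) (carrier (on_ob F Y)) (Hom T Y X)" if "Y \<in> Obj T" for Y
    using iso[OF that] by (simp add: iso_def Hom_grp_simps)
  have \<eta>_Hom: "\<eta> Y y \<in> Hom T Y X" if "Y \<in> Obj T" "y \<in> carrier (on_ob F Y)" for Y y
    using bij_betwE[OF bij[OF that(1)]] that(2) by blast
  have inj: "\<eta> Y y = \<eta> Y z \<longleftrightarrow> y = z"
    if "Y \<in> Obj T" "y \<in> carrier (on_ob F Y)" "z \<in> carrier (on_ob F Y)" for Y y z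
    using bij[OF that(1)] that(2,3) by (auto simp: bij_betw_def inj_on_def)
  have surj: "\<exists>y \<in> carrier (on_ob F Y). \<eta> Y y = f" if "f \<in> Hom T Y X" for Y f
    using bij[OF Hom_objs(1)[OF that]] that by (metis bij_betw_imp_surj_on imageE)
  have one: "\<eta> Y \<one>\<^bsub>on_ob F Y\<^esub> = hzero T Y X" if Y: "Y \<in> Obj T" for Y
    using hom_one[of "\<eta> Y" "on_ob F Y" "Hom_grp T Y X"] iso[OF Y] F.ob_group[OF Y]
      Hom_comm_group[OF Y X] by (simp add: iso_def comm_group_def Hom_grp_simps)
  have natural: "\<eta> Y (on_ar F f y) = \<eta> Z y \<cdot>\<^bsub>T\<^esub> f"
    if "f \<in> Hom T Y Z" "y \<in> carrier (on_ob F Z)" for Y Z f y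
    using nat that Hom_objs[OF that(1)] unfolding ab_natural_iso_op_def Hom_functor_def by simp
  have nat_eq: "on_ar F f y = z \<longleftrightarrow> \<eta> Z y \<cdot>\<^bsub>T\<^esub> f = \<eta> Y z"
    if f: "f \<in> Hom T Y Z" and y: "y \<in> carrier (on_ob F Z)" and z: "z \<in> carrier (on_ob F Y)" for Y Z f y z
    using inj[OF Hom_objs(1)[OF f] F.ar_closed[OF f y] z] natural[OF f y] by simp
  show "cohomological_op T F"
    unfolding cohomological_op_iff[OF assms(1,2)]
  proof (intro allI impI ballI)
    fix A B Z a b c y assume ex: "exact_triangle T A B Z a b c" and y: "y \<in> carrier (on_ob F B)"
    note eD = exact_triangleD[OF ex]
    note \<eta>y = \<eta>_Hom[OF eD(5) y]
    have "on_ar F a y = \<one>\<^bsub>on_ob F A\<^esub> \<longleftrightarrow> \<eta> B y \<cdot>\<^bsub>T\<^esub> a = hzero T A X"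
      using nat_eq[OF eD(1) y F.one_closed[OF eD(4)]] one[OF eD(4)] by simp
    also have "\<dots> \<longleftrightarrow> (\<exists>g \<in> Hom T Z X. g \<cdot>\<^bsub>T\<^esub> b = \<eta> B y)"
    proof
      show "\<exists>g \<in> Hom T Z X. g \<cdot>\<^bsub>T\<^esub> b = \<eta> B y" if "\<eta> B y \<cdot>\<^bsub>T\<^esub> a = hzero T A X"
        using exact_extend[OF ex \<eta>y that] by blast
      assume "\<exists>g \<in> Hom T Z X. g \<cdot>\<^bsub>T\<^esub> b = \<eta> B y"
      then obtain g where g: "g \<in> Hom T Z X" "g \<cdot>\<^bsub>T\<^esub> b = \<eta> B y" by blast
      then show "\<eta> B y \<cdot>\<^bsub>T\<^esub> a = hzero T A X"
        using comp_assoc[OF eD(1,2) g(1)] exact_comp_zero[OF ex] comp_zero(1)[OF g(1) eD(4)] by simp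
    qed
    also have "\<dots> \<longleftrightarrow> (\<exists>z \<in> carrier (on_ob F Z). \<eta> Z z \<cdot>\<^bsub>T\<^esub> b = \<eta> B y)"
      using surj \<eta>_Hom[OF eD(6)] by (metis (no_types))
    also have "\<dots> \<longleftrightarrow> (\<exists>z \<in> carrier (on_ob F Z). y = on_ar F b z)"
      using nat_eq[OF eD(2) _ y] by (metis (no_types))
    finally show "on_ar F a y = \<one>\<^bsub>on_ob F A\<^esub> \<longleftrightarrow> (\<exists>z \<in> carrier (on_ob F Z). y = on_ar F b z)" .
  qed
  show "coproducts_to_products u T F"
    unfolding F.coproducts_to_products_iff
  proof (intro allI impI; elim conjE)
    fix I :: "'u set" and Y P \<iota> y
    assume cop: "is_coproduct T I Y P \<iota>" and y: "\<forall>i \<in> I. y i \<in> carrier (on_ob F (Y i))"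
    note cD = coproductD[OF cop]
    have "\<exists>h. h \<in> Hom T P X \<and> (\<forall>i \<in> I. h \<cdot>\<^bsub>T\<^esub> \<iota> i = \<eta> (Y i) (y i))"
      by (rule coproduct_map_ex[OF cop X]) (use \<eta>_Hom cD(2) y in blast)
    then obtain h where h: "h \<in> Hom T P X" "\<forall>i \<in> I. h \<cdot>\<^bsub>T\<^esub> \<iota> i = \<eta> (Y i) (y i)" by blast
    obtain p where p: "p \<in> carrier (on_ob F P)" "\<eta> P p = h" using surj[OF h(1)] by blast
    show "\<exists>!p. p \<in> carrier (on_ob F P) \<and> (\<forall>i \<in> I. on_ar F (\<iota> i) p = y i)"
    proof (rule ex1I[of _ p])
      show "p \<in> carrier (on_ob F P) \<and> (\<forall>i \<in> I. on_ar F (\<iota> i) p = y i)"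
        using p h nat_eq[OF cD(3) p(1)] y by auto
      fix q assume q: "q \<in> carrier (on_ob F P) \<and> (\<forall>i \<in> I. on_ar F (\<iota> i) q = y i)"
      have "\<eta> P q = h"
      proof (rule coproduct_eqI[OF cop \<eta>_Hom[OF cD(1)] h(1)])
        fix i assume i: "i \<in> I"
        show "\<eta> P q \<cdot>\<^bsub>T\<^esub> \<iota> i = h \<cdot>\<^bsub>T\<^esub> \<iota> i"
          using natural[OF cD(3)[OF i]] q h(2) i by metis
      qed (use q in simp)
      then show "q = p" using inj[OF cD(1)] p q by metis
    qed
  qed
qed

text \<open>
  An object representing \<open>Hom(F -, Y)\<close> is the value at \<open>Y\<close> of a right adjoint of \<open>F\<close>.
\<close>

lemma pulled_back_Hom_brown_functor:
  fixes T :: "('o, 'm, 'x) triangulated_scheme" and U :: "('p, 'n, 'y) triangulated_scheme"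
    and u :: "'u itself"
  assumes "cocomplete_triangulated T u" "triangulated_category U" "locally_small u U"
    and ex: "exact_functor T U F \<eta>" and pres: "preserves_coproducts u T U F" and Y: "Y \<in> Obj U"
  shows "brown_functor T u
    \<lparr>on_ob = (\<lambda>X. Hom_grp U (on_ob F X) Y), on_ar = (\<lambda>f g. g \<cdot>\<^bsub>U\<^esub> on_ar F f)\<rparr>"
    (is "brown_functor T u ?H")
proof -
  interpret T: cocomplete_triangulated T u by fact
  interpret U: triangulated_category U by fact
  interpret F: is_functor T U F using ex by (simp add: exact_functor_def)
  have H: "ab_functor_op T u ?H"
  proof
    show "comm_group (on_ob ?H X) \<and> small u (carrier (on_ob ?H X))" if "X \<in> Obj T" for X
      using U.Hom_comm_group[OF F.ob[OF that] Y] assms(3) F.ob[OF that] Y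
      by (simp add: locally_small_def U.Hom_grp_simps)
    show "on_ar ?H f \<in> hom (on_ob ?H Z) (on_ob ?H X)" if f: "f \<in> Hom T X Z" for f X Z
      using U.comp[OF F.ar[OF f]] U.add_comp[OF F.ar[OF f]]
      by (auto simp: hom_def U.Hom_grp_simps)
    show "on_ar ?H (Ident T X) g = g" if "X \<in> Obj T" "g \<in> carrier (on_ob ?H X)" for X g
      using F.map_ident[OF that(1)] U.comp_ident that(2) by (simp add: U.Hom_grp_simps)
    show "on_ar ?H (g \<cdot>\<^bsub>T\<^esub> f) h = on_ar ?H f (on_ar ?H g h)"
      if "f \<in> Hom T W X" "g \<in> Hom T X Z" "h \<in> carrier (on_ob ?H Z)" for f W X g Z h
      using F.map_comp[OF that(1,2)] U.comp_assoc[OF F.ar[OF that(1)] F.ar[OF that(2)]] that(3)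
      by (simp add: U.Hom_grp_simps)
  qed
  interpret H: ab_functor_op T u ?H by (rule H)
  have "cohomological_op T ?H"
    unfolding cohomological_op_iff[OF T.triangulated_category_axioms H]
  proof (intro allI impI ballI)
    fix A B Z a b c y assume tri: "exact_triangle T A B Z a b c" and "y \<in> carrier (on_ob ?H B)"
    then have y: "y \<in> Hom U (on_ob F B) Y" by (simp add: U.Hom_grp_simps)
    have tri': "exact_triangle U (on_ob F A) (on_ob F B) (on_ob F Z)
        (on_ar F a) (on_ar F b) (\<eta> A \<cdot>\<^bsub>U\<^esub> on_ar F c)"
      using ex tri unfolding exact_functor_def by blast
    note eD = U.exact_triangleD[OF tri']
    have "y \<cdot>\<^bsub>U\<^esub> on_ar F a = hzero U (on_ob F A) Y \<longleftrightarrow>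
      (\<exists>z \<in> Hom U (on_ob F Z) Y. y = z \<cdot>\<^bsub>U\<^esub> on_ar F b)"
    proof
      show "\<exists>z \<in> Hom U (on_ob F Z) Y. y = z \<cdot>\<^bsub>U\<^esub> on_ar F b"
        if "y \<cdot>\<^bsub>U\<^esub> on_ar F a = hzero U (on_ob F A) Y"
        using U.exact_extend[OF tri' y that] by blast
      assume "\<exists>z \<in> Hom U (on_ob F Z) Y. y = z \<cdot>\<^bsub>U\<^esub> on_ar F b"
      then obtain z where z: "z \<in> Hom U (on_ob F Z) Y" "y = z \<cdot>\<^bsub>U\<^esub> on_ar F b" by blast
      show "y \<cdot>\<^bsub>U\<^esub> on_ar F a = hzero U (on_ob F A) Y"
        using U.comp_assoc[OF eD(1,2) z(1)] z(2) U.exact_comp_zero[OF tri'] U.comp_zero(1)[OF z(1) eD(4)]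
        by simp
    qed
    then show "on_ar ?H a y = \<one>\<^bsub>on_ob ?H A\<^esub> \<longleftrightarrow> (\<exists>z \<in> carrier (on_ob ?H Z). y = on_ar ?H b z)"
      by (simp add: U.Hom_grp_simps)
  qed
  moreover have "coproducts_to_products u T ?H"
    unfolding H.coproducts_to_products_iff
  proof (intro allI impI; elim conjE)
    fix I :: "'u set" and X P \<iota> x
    assume "small u I" and "is_coproduct T I X P \<iota>" and x: "\<forall>i \<in> I. x i \<in> carrier (on_ob ?H (X i))"
    then have cop: "is_coproduct U I (on_ob F \<circ> X) (on_ob F P) (on_ar F \<circ> \<iota>)"
      using pres unfolding preserves_coproducts_def by blast
    have x': "x i \<in> Hom U ((on_ob F \<circ> X) i) Y" if "i \<in> I" for i
      using x that by (simp add: U.Hom_grp_simps)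
    obtain h where h: "h \<in> Hom U (on_ob F P) Y" "\<forall>i \<in> I. h \<cdot>\<^bsub>U\<^esub> (on_ar F \<circ> \<iota>) i = x i"
      using U.coproduct_map_ex[OF cop Y x'] by blast
    show "\<exists>!p. p \<in> carrier (on_ob ?H P) \<and> (\<forall>i \<in> I. on_ar ?H (\<iota> i) p = x i)"
    proof (rule ex1I[of _ h])
      show "h \<in> carrier (on_ob ?H P) \<and> (\<forall>i \<in> I. on_ar ?H (\<iota> i) h = x i)"
        using h by (simp add: U.Hom_grp_simps)
      fix q assume "q \<in> carrier (on_ob ?H P) \<and> (\<forall>i \<in> I. on_ar ?H (\<iota> i) q = x i)"
      then have q: "q \<in> Hom U (on_ob F P) Y" "\<forall>i \<in> I. q \<cdot>\<^bsub>U\<^esub> on_ar F (\<iota> i) = x i"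
        by (auto simp: U.Hom_grp_simps)
      show "q = h" by (rule U.coproduct_eqI[OF cop q(1) h(1)]) (use q(2) h(2) in simp)
    qed
  qed
  ultimately show ?thesis
    using assms(1) H by (simp add: brown_functor_def brown_functor_axioms_def)
qed

theorem mainTheorem1:
  fixes T :: "('o, 'm, 'x) triangulated_scheme"
  assumes "uncountable (UNIV :: 'u set)"
    and "triangulated_category T"
    and "locally_small TYPE('u) T"
    and "has_coproducts TYPE('u) T"
    and "\<exists>S. perfect_generator TYPE('u) T S"
  shows "(\<forall>F :: ('o, 'm, 'g monoid, 'g \<Rightarrow> 'g) ftr.
            ab_functor_op T TYPE('u) F \<longrightarrow>
              (cohomological_op T F \<and> coproducts_to_products TYPE('u) T F
                \<longleftrightarrow> (\<exists>X \<in> Obj T. \<exists>\<eta>. ab_natural_iso_op T F (Hom_functor T X) \<eta>)))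
       \<and> (\<forall>(U :: ('p, 'n, 'y) triangulated_scheme) F \<eta>.
            triangulated_category U \<and> locally_small TYPE('u) U \<and> exact_functor T U F \<eta> \<longrightarrow>
              (preserves_coproducts TYPE('u) T U F \<longleftrightarrow> (\<exists>G. is_right_adjoint T U F G)))"
proof (intro conjI allI impI)
  have T: "cocomplete_triangulated T TYPE('u)"
    using assms(1-4) by (simp add: cocomplete_triangulated_def cocomplete_triangulated_axioms_def)
  obtain S where S: "perfect_generator TYPE('u) T S" using assms(5) by blast
  show "cohomological_op T F \<and> coproducts_to_products TYPE('u) T F
      \<longleftrightarrow> (\<exists>X \<in> Obj T. \<exists>\<eta>. ab_natural_iso_op T F (Hom_functor T X) \<eta>)"
    if F: "ab_functor_op T TYPE('u) F" for F :: "('o, 'm, 'g monoid, 'g \<Rightarrow> 'g) ftr"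
  proof
    assume "cohomological_op T F \<and> coproducts_to_products TYPE('u) T F"
    then interpret brown_functor T "TYPE('u)" F
      using T F by (simp add: brown_functor_def brown_functor_axioms_def)
    obtain X \<xi> where "X \<in> Obj T" "\<xi> \<in> carrier (on_ob F X)" "\<forall>Y \<in> Obj T. represented_at T F X \<xi> Y"
      using representable[OF S] by blast
    then show "\<exists>X \<in> Obj T. \<exists>\<eta>. ab_natural_iso_op T F (Hom_functor T X) \<eta>"
      using represented_natural_iso by blast
  next
    assume "\<exists>X \<in> Obj T. \<exists>\<eta>. ab_natural_iso_op T F (Hom_functor T X) \<eta>"
    then show "cohomological_op T F \<and> coproducts_to_products TYPE('u) T F"
      using representable_functor_properties[OF assms(2) F] by blast
  qed
  fix U :: "('p, 'n, 'y) triangulated_scheme" and F \<eta>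
  assume A: "triangulated_category U \<and> locally_small TYPE('u) U \<and> exact_functor T U F \<eta>"
  show "preserves_coproducts TYPE('u) T U F \<longleftrightarrow> (\<exists>G. is_right_adjoint T U F G)"
  proof
    assume pres: "preserves_coproducts TYPE('u) T U F"
    show "\<exists>G. is_right_adjoint T U F G"
    proof (rule right_adjoint_if_universal_arrows)
      show "is_functor T U F" using A by (simp add: exact_functor_def)
      then interpret U: additive_category U
        using A by (simp add: triangulated_category_def)
      fix Y assume Y: "Y \<in> Obj U"
      interpret brown_functor T "TYPE('u)"
        "\<lparr>on_ob = (\<lambda>X. Hom_grp U (on_ob F X) Y), on_ar = (\<lambda>f g. g \<cdot>\<^bsub>U\<^esub> on_ar F f)\<rparr>"
        using pulled_back_Hom_brown_functor[OF T _ _ _ pres Y] A by blast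
      show "\<exists>X \<in> Obj T. \<exists>\<xi> \<in> Hom U (on_ob F X) Y.
          \<forall>W \<in> Obj T. \<forall>g \<in> Hom U (on_ob F W) Y. \<exists>!f. f \<in> Hom T W X \<and> \<xi> \<cdot>\<^bsub>U\<^esub> on_ar F f = g"
        using representable[OF S] by (simp add: represented_at_def U.Hom_grp_simps)
    qed
  next
    assume "\<exists>G. is_right_adjoint T U F G"
    then obtain G where "is_right_adjoint T U F G" ..
    from left_adjoint_preserves_coproduct[OF this] show "preserves_coproducts TYPE('u) T U F"
      unfolding preserves_coproducts_def by blast
  qed
qed

end
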